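(* Let $(X,\lambda)$ be a standard $\sigma$-finite space, let $G$ be a locally compact Polish group and let $\alpha: G\times X\to X$ be a (spatial) measure-preserving $G$-action on $(X,\lambda)$. Then $\alpha$ is spatially isomorphic to a continuous measure-preserving $G$-action on a locally compact Polish space $Y$ endowed with a Radon measure $\eta$.
   Context: A standard Borel space is an uncountable measurable space whose $\sigma$-algebra is the Borel $\sigma$-algebra of some Polish topology. A standard $\sigma$-finite space $(X,\lambda)$ is a standard Borel space $X$ with a nontrivial (nonzero) atomless $\sigma$-finite Borel measure $\lambda$. A measure-preserving bijection of $(X,\lambda)$ is a Borel bijection $T:X\to X$ with $\lambda(T^{-1}(A))=\lambda(A)$ for all Borel $A\subseteq X$. A (spatial) measure-preserving $G$-action of a Polish group $G$ on $(X,\lambda)$ is a Borel map $\alpha:G\times X\to X$ which is a genuine group action and such that each $\alpha(g,\cdot)$ is a measure-preserving bijection of $(X,\lambda)$. An action on a topological space $Y$ is continuous if the action map $G\times Y\to Y$ is continuous. Measure-preserving spatial $G$-actions $\alpha$ on $(X,\lambda)$ and $\beta$ on $(Y,\eta)$ are spatially isomorphic if there are a conull $\alpha(G)$-invariant Borel subset $X_0\subseteq X$ and a measure-preserving Borel injection $\Phi:X_0\to Y$ (that is, $\Phi_*(\lambda_{\restriction X_0})=\eta$) such that $\Phi(\alpha(g,x))=\beta(g,\Phi(x))$ for all $g\in G$ and all $x\in X_0$. A Borel measure on a Hausdorff space is Radon if it is finite on compact sets, inner regular (by compact sets) on open sets, and outer regular (by open sets) on Borel sets; on a locally compact Polish space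 this is equivalent to every point having an open neighborhood of finite measure. *)

theory Defs
  imports "HOL-Analysis.Analysis" "HOL-Algebra.Group_Action"
begin

section \<open>Polish spaces and Polish groups\<close>

definition polish_topology :: "'a topology \<Rightarrow> bool" where
  "polish_topology T \<longleftrightarrow> completely_metrizable_space T \<and> separable_space T"

text \<open>
  Every Polish space is homeomorphic to a subspace of the Hilbert cube, so quantifying over
  the topologies carried by subsets of the type \<open>nat \<Rightarrow> real\<close> covers all
  Polish spaces up to homeomorphism.
\<close>

definition borel_of :: "'a topology \<Rightarrow> 'a measure" where
  "borel_of T = sigma (topspace T) {U. openin T U}"

definition topological_group :: "('g, 'm) monoid_scheme \<Rightarrow> 'g topology \<Rightarrow> bool" where
  "topological_group G T \<longleftrightarrow>
     group G \<and> topspace T = carrier G \<and>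
     continuous_map (prod_topology T T) T (\<lambda>(g, h). g \<otimes>\<^bsub>G\<^esub> h) \<and>
     continuous_map T T (\<lambda>g. inv\<^bsub>G\<^esub> g)"

definition polish_group :: "('g, 'm) monoid_scheme \<Rightarrow> 'g topology \<Rightarrow> bool" where
  "polish_group G T \<longleftrightarrow> topological_group G T \<and> polish_topology T"

section \<open>Standard sigma-finite spaces\<close>

definition standard_borel_space :: "'a measure \<Rightarrow> bool" where
  "standard_borel_space M \<longleftrightarrow>
     uncountable (space M) \<and> (\<exists>T. polish_topology T \<and> sets M = sets (borel_of T))"

text \<open>
  Atoms are taken in the general measure-theoretic sense; for a sigma-finite measure on a
  standard Borel space, having none is the same as vanishing on singletons.
\<close>

definition atomless :: "'a measure \<Rightarrow> bool" where
  "atomless M \<longleftrightarrow>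
     \<not> (\<exists>A \<in> sets M. emeasure M A > 0 \<and>
          (\<forall>B \<in> sets M. B \<subseteq> A \<longrightarrow> emeasure M B = 0 \<or> emeasure M (A - B) = 0))"

definition standard_sigma_finite_space :: "'a measure \<Rightarrow> bool" where
  "standard_sigma_finite_space M \<longleftrightarrow>
     standard_borel_space M \<and> sigma_finite_measure M \<and> emeasure M (space M) \<noteq> 0 \<and> atomless M"

section \<open>Measure-preserving actions\<close>

definition measure_preserving_bijection :: "'a measure \<Rightarrow> ('a \<Rightarrow> 'a) \<Rightarrow> bool" where
  "measure_preserving_bijection M f \<longleftrightarrow>
     f \<in> M \<rightarrow>\<^sub>M M \<and> bij_betw f (space M) (space M) \<and>
     (\<forall>A \<in> sets M. emeasure M (f -` A \<inter> space M) = emeasure M A)"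

text \<open>
  \<^locale>\<open>group_action\<close> asks for each \<open>\<alpha> g\<close> to be extensional, which only normalises the
  values of \<open>\<alpha> g\<close> outside \<open>space M\<close>.
\<close>

definition measure_preserving_action ::
    "('g, 'm) monoid_scheme \<Rightarrow> 'g topology \<Rightarrow> 'a measure \<Rightarrow> ('g \<Rightarrow> 'a \<Rightarrow> 'a) \<Rightarrow> bool" where
  "measure_preserving_action G TG M \<alpha> \<longleftrightarrow>
     group_action G (space M) \<alpha> \<and>
     (\<lambda>(g, x). \<alpha> g x) \<in> borel_of TG \<Otimes>\<^sub>M M \<rightarrow>\<^sub>M M \<and>
     (\<forall>g \<in> carrier G. measure_preserving_bijection M (\<alpha> g))"

definition continuous_action ::
    "'g topology \<Rightarrow> 'a topology \<Rightarrow> ('g \<Rightarrow> 'a \<Rightarrow> 'a) \<Rightarrow> bool" where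
  "continuous_action TG T \<alpha> \<longleftrightarrow> continuous_map (prod_topology TG T) T (\<lambda>(g, x). \<alpha> g x)"

definition spatially_isomorphic ::
    "('g, 'm) monoid_scheme \<Rightarrow> 'a measure \<Rightarrow> ('g \<Rightarrow> 'a \<Rightarrow> 'a) \<Rightarrow>
       'b measure \<Rightarrow> ('g \<Rightarrow> 'b \<Rightarrow> 'b) \<Rightarrow> bool" where
  "spatially_isomorphic G M \<alpha> N \<beta> \<longleftrightarrow>
     (\<exists>X\<^sub>0 \<Phi>. X\<^sub>0 \<in> sets M \<and> emeasure M (space M - X\<^sub>0) = 0 \<and>
        (\<forall>g \<in> carrier G. \<alpha> g ` X\<^sub>0 = X\<^sub>0) \<and>
        \<Phi> \<in> restrict_space M X\<^sub>0 \<rightarrow>\<^sub>M N \<and> inj_on \<Phi> X\<^sub>0 \<and>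
        distr (restrict_space M X\<^sub>0) N \<Phi> = N \<and>
        (\<forall>g \<in> carrier G. \<forall>x \<in> X\<^sub>0. \<Phi> (\<alpha> g x) = \<beta> g (\<Phi> x)))"

section \<open>Radon measures\<close>

definition radon_measure :: "'a topology \<Rightarrow> 'a measure \<Rightarrow> bool" where
  "radon_measure T N \<longleftrightarrow>
     Hausdorff_space T \<and> sets N = sets (borel_of T) \<and>
     (\<forall>K. compactin T K \<longrightarrow> emeasure N K < \<infinity>) \<and>
     (\<forall>U. openin T U \<longrightarrow> emeasure N U = (SUP K \<in> {K. compactin T K \<and> K \<subseteq> U}. emeasure N K)) \<and>
     (\<forall>A \<in> sets N. emeasure N A = (INF U \<in> {U. openin T U \<and> A \<subseteq> U}. emeasure N U))"

end

theory Submission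
  imports Defs
begin

text \<open>
  If \<open>m\<close> is a right Haar measure on \<open>G\<close>, \<open>\<psi>\<close> is continuous with compact support and
  \<open>f : X \<rightarrow> [0, 1]\<close> is Borel, then \<open>F x = \<integral> \<psi>(g) f(g x) dm(g)\<close> satisfies
  \<open>F(h x) = \<integral> \<psi>(g h\<^sup>-\<^sup>1) f(g x) dm(g)\<close>, so that the orbit functions \<open>h \<mapsto> F(h x)\<close> are
  equicontinuous, uniformly in \<open>x\<close>. A countable family \<open>F\<^sub>i\<close> of such functions separates the points
  of \<open>X\<close>, and \<open>F\<^sub>0\<close> can be taken strictly positive and integrable. The map sending \<open>x\<close> to
  \<open>(i, h) \<mapsto> F\<^sub>i(h x)\<close> then intertwines \<open>\<alpha>\<close> with the action of \<open>G\<close> by translation of \<open>h\<close>, which is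
  jointly continuous on the (compact) closure of the image by equicontinuity; restricting \<open>h\<close> to a
  countable dense set embeds this closure in a countable product. The open invariant subset where the
  coordinate of index \<open>0\<close> does not vanish identically is locally compact and contains the image, and
  the push-forward of \<open>\<lambda>\<close> is locally finite there by Markov's inequality. In particular no null set
  has to be removed.
\<close>

section \<open>Covering numbers on locally compact groups\<close>

text \<open>The orbit functions of a Borel \<open>f\<close> are merely Borel. Averaging over
  \<open>G\<close> moves \<open>h\<close> from the argument of \<open>f\<close> to that of
  \<open>\<psi>\<close>; this substitution requires invariance under right translation. Then |F(h x)
  - F(h0 x)| is at most the L1 distance of two translates of \<open>\<psi>\<close>, a bound free of
  both \<open>x\<close> and \<open>f\<close>. Separation: if all F_i agree at x and y, then for
  almost every g near the identity the points g x and g y lie in the same members of a separating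
  sequence of Borel sets; a single such g is enough, because it acts injectively. The compact
  closure itself cannot carry the measure in general: mass may accumulate where the coordinate of
  index 0 vanishes. Positivity of F_0 keeps the image away from there, and F_0 composed with any
  group element has the same finite integral as F_0, so each set where F_0(h x) exceeds a positive
  constant has finite mass. The product over all of \<open>G\<close> is compact but possibly not
  metrizable; equicontinuity is what makes a dense sequence of values of h determine the whole
  function.\<close>

locale locally_compact_group =
  fixes G :: "('g, 'm) monoid_scheme" (structure) and T :: "'g topology"
  assumes topological_group: "topological_group G T"
    and Hausdorff: "Hausdorff_space T"
    and locally_compact: "locally_compact_space T"
begin

sublocale group G
  using topological_group by (simp add: topological_group_def)

lemma topspace_eq [simp]: "topspace T = carrier G"
  using topological_group by (simp add: topological_group_def)

lemma continuous_mult: "continuous_map (prod_topology T T) T (\<lambda>(g, h). g \<otimes> h)"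
  using topological_group by (simp add: topological_group_def)

lemma continuous_inv: "continuous_map T T (\<lambda>g. inv g)"
  using topological_group by (simp add: topological_group_def)

lemma continuous_mult_compose:
  assumes "continuous_map X T f" "continuous_map X T g"
  shows "continuous_map X T (\<lambda>x. f x \<otimes> g x)"
  using continuous_map_compose[OF continuous_map_pairedI[OF assms] continuous_mult]
  by (simp add: o_def)

lemma continuous_inv_compose:
  assumes "continuous_map X T f"
  shows "continuous_map X T (\<lambda>x. inv (f x))"
  using continuous_map_compose[OF assms continuous_inv] by (simp add: o_def)

lemma openin_carrier: "openin T U \<Longrightarrow> U \<subseteq> carrier G"
  using openin_subset by force

lemma compactin_carrier: "compactin T K \<Longrightarrow> K \<subseteq> carrier G"
  using compactin_subset_topspace by force

definition right_translate :: "'g \<Rightarrow> 'g set \<Rightarrow> 'g set" where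
  "right_translate g A = (\<lambda>a. a \<otimes> g) ` A"

text \<open>Written as a preimage under right multiplication by \<open>inv g\<close>, a translate
  inherits openness and measurability from continuity of the group operations.\<close>

lemma right_translate_eq:
  assumes "g \<in> carrier G" "A \<subseteq> carrier G"
  shows "right_translate g A = {x \<in> carrier G. x \<otimes> inv g \<in> A}"
proof -
  have "x \<in> right_translate g A" if "x \<in> carrier G" "x \<otimes> inv g \<in> A" for x
    unfolding right_translate_def using that assms
    by (intro image_eqI[of _ _ "x \<otimes> inv g"]) (auto simp: m_assoc)
  moreover have "x \<in> carrier G \<and> x \<otimes> inv g \<in> A" if "x \<in> right_translate g A" for x
    using that assms unfolding right_translate_def by (auto simp: m_assoc subset_iff)
  ultimately show ?thesis by blast
qed

lemma right_translate_carrier: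
  "g \<in> carrier G \<Longrightarrow> A \<subseteq> carrier G \<Longrightarrow> right_translate g A \<subseteq> carrier G"
  by (auto simp: right_translate_eq)

lemma right_translate_mult:
  assumes "g \<in> carrier G" "h \<in> carrier G" "A \<subseteq> carrier G"
  shows "right_translate h (right_translate g A) = right_translate (g \<otimes> h) A"
  using assms unfolding right_translate_def image_image
  by (intro image_cong refl) (auto simp: m_assoc)

lemma right_translate_one: "A \<subseteq> carrier G \<Longrightarrow> right_translate \<one> A = A"
  unfolding right_translate_def by (force simp: subset_iff image_iff)

lemma right_translate_inv:
  assumes "g \<in> carrier G" "A \<subseteq> carrier G"
  shows "right_translate (inv g) (right_translate g A) = A"
    "right_translate g (right_translate (inv g) A) = A"
  using assms by (simp_all add: right_translate_mult right_translate_one)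

lemma right_translate_mono: "A \<subseteq> B \<Longrightarrow> right_translate g A \<subseteq> right_translate g B"
  by (auto simp: right_translate_def)

lemma openin_right_translate:
  assumes "g \<in> carrier G" "openin T U"
  shows "openin T (right_translate g U)"
proof -
  have "continuous_map T T (\<lambda>x. x \<otimes> inv g)"
    using assms by (intro continuous_mult_compose) auto
  from openin_continuous_map_preimage[OF this assms(2)] show ?thesis
    using assms by (simp add: right_translate_eq openin_carrier)
qed

lemma compactin_right_translate:
  assumes "g \<in> carrier G" "compactin T K"
  shows "compactin T (right_translate g K)"
  unfolding right_translate_def
  using assms by (intro image_compactin[of T] continuous_mult_compose) auto

definition is_cover :: "'g set \<Rightarrow> 'g set \<Rightarrow> 'g set \<Rightarrow> bool" where
  "is_cover K U S \<longleftrightarrow> finite S \<and> S \<subseteq> carrier G \<and> K \<subseteq> (\<Union>g\<in>S. right_translate g U)"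

text \<open>Haar's index (K : U). The \<open>LEAST\<close> is meaningful once some finite cover
  exists, which \<open>ex_cover\<close> provides for compact \<open>K\<close> and nonempty open
  \<open>U\<close>.\<close>

definition covering_number :: "'g set \<Rightarrow> 'g set \<Rightarrow> nat" where
  "covering_number K U = (LEAST n. \<exists>S. is_cover K U S \<and> card S = n)"

definition unit_nhd :: "'g set \<Rightarrow> bool" where
  "unit_nhd U \<longleftrightarrow> openin T U \<and> \<one> \<in> U"

lemma ex_cover:
  assumes "compactin T K" "openin T U" "U \<noteq> {}"
  obtains S where "is_cover K U S"
proof -
  obtain u where u: "u \<in> U" using assms by auto
  have uc: "u \<in> carrier G" using u assms openin_carrier by auto
  have "K \<subseteq> \<Union> ((\<lambda>g. right_translate g U) ` carrier G)"
  proof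
    fix x assume "x \<in> K"
    then have x: "x \<in> carrier G" using assms compactin_carrier by auto
    have "x = u \<otimes> (inv u \<otimes> x)" using x uc by (simp flip: m_assoc)
    then have "x \<in> right_translate (inv u \<otimes> x) U"
      unfolding right_translate_def using u by blast
    then show "x \<in> \<Union> ((\<lambda>g. right_translate g U) ` carrier G)" using x uc by auto
  qed
  moreover have "openin T V" if "V \<in> (\<lambda>g. right_translate g U) ` carrier G" for V
    using that assms openin_right_translate by auto
  ultimately obtain F where F: "finite F" "F \<subseteq> (\<lambda>g. right_translate g U) ` carrier G" "K \<subseteq> \<Union>F"
    using compactinD[OF assms(1)] by metis
  then obtain S where "S \<subseteq> carrier G" "finite S" "F = (\<lambda>g. right_translate g U) ` S"
    by (meson finite_subset_image)
  then show thesis using F that unfolding is_cover_def by auto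
qed

lemma covering_number_le: "is_cover K U S \<Longrightarrow> covering_number K U \<le> card S"
  unfolding covering_number_def by (rule Least_le) auto

lemma ex_minimal_cover:
  assumes "compactin T K" "openin T U" "U \<noteq> {}"
  obtains S where "is_cover K U S" "card S = covering_number K U"
proof -
  from ex_cover[OF assms] obtain S where "is_cover K U S" .
  then have "\<exists>n S. is_cover K U S \<and> card S = n" by blast
  from LeastI_ex[OF this] show thesis
    using that unfolding covering_number_def by blast
qed

lemma covering_number_mono:
  assumes "compactin T L" "openin T U" "U \<noteq> {}" "K \<subseteq> L"
  shows "covering_number K U \<le> covering_number L U"
proof -
  obtain S where S: "is_cover L U S" "card S = covering_number L U"
    using ex_minimal_cover assms by metis
  then have "is_cover K U S" using assms(4) by (auto simp: is_cover_def)
  then show ?thesis using covering_number_le S by metis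
qed

lemma covering_number_Un_le:
  assumes "compactin T K" "compactin T L" "openin T U" "U \<noteq> {}"
  shows "covering_number (K \<union> L) U \<le> covering_number K U + covering_number L U"
proof -
  obtain R where R: "is_cover K U R" "card R = covering_number K U"
    using ex_minimal_cover assms by metis
  obtain S where S: "is_cover L U S" "card S = covering_number L U"
    using ex_minimal_cover assms by metis
  have "is_cover (K \<union> L) U (R \<union> S)" using R S unfolding is_cover_def by blast
  then show ?thesis using covering_number_le card_Un_le[of R S] R S by (metis order_trans)
qed

text \<open>No translate of \<open>U\<close> can serve both sets, so an optimal cover of the union
  contains two disjoint families, one covering each set.\<close>

lemma covering_number_Un_eq:
  assumes "compactin T K" "compactin T L" "openin T U" "U \<noteq> {}"
    and disj: "\<And>g. g \<in> carrier G \<Longrightarrow> right_translate g U \<inter> K = {} \<or> right_translate g U \<inter> L = {}"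
  shows "covering_number (K \<union> L) U = covering_number K U + covering_number L U"
proof (rule antisym[OF covering_number_Un_le[OF assms(1-4)]])
  obtain S where S: "is_cover (K \<union> L) U S" "card S = covering_number (K \<union> L) U"
    using ex_minimal_cover[OF compactin_Un[OF assms(1,2)] assms(3,4)] by metis
  define S1 where "S1 = {g \<in> S. right_translate g U \<inter> K \<noteq> {}}"
  define S2 where "S2 = {g \<in> S. right_translate g U \<inter> L \<noteq> {}}"
  have "is_cover K U S1" "is_cover L U S2"
    using S(1) unfolding is_cover_def S1_def S2_def by fastforce+
  then have "covering_number K U + covering_number L U \<le> card S1 + card S2"
    by (simp add: add_mono covering_number_le)
  also have "\<dots> = card (S1 \<union> S2)"
    using S(1) disj unfolding S1_def S2_def is_cover_def
    by (subst card_Un_disjoint) auto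
  also have "\<dots> \<le> card S"
    using S(1) unfolding S1_def S2_def is_cover_def by (intro card_mono) auto
  finally show "covering_number K U + covering_number L U \<le> covering_number (K \<union> L) U"
    using S(2) by simp
qed

lemma covering_number_right_translate_le:
  assumes "compactin T K" "openin T U" "U \<noteq> {}" "h \<in> carrier G"
  shows "covering_number (right_translate h K) U \<le> covering_number K U"
proof -
  obtain S where S: "is_cover K U S" "card S = covering_number K U"
    using ex_minimal_cover assms by metis
  have "is_cover (right_translate h K) U ((\<lambda>g. g \<otimes> h) ` S)"
  proof -
    have "right_translate h K \<subseteq> right_translate h (\<Union>g\<in>S. right_translate g U)"
      using S(1) by (intro right_translate_mono) (auto simp: is_cover_def)
    also have "\<dots> = (\<Union>g\<in>S. right_translate h (right_translate g U))"
      by (auto simp: right_translate_def)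
    also have "\<dots> = (\<Union>g\<in>S. right_translate (g \<otimes> h) U)"
      using S(1) assms openin_carrier
      by (intro SUP_cong refl) (auto simp: right_translate_mult is_cover_def subset_iff)
    finally show ?thesis using S(1) assms(4) unfolding is_cover_def by auto
  qed
  then have "covering_number (right_translate h K) U \<le> card ((\<lambda>g. g \<otimes> h) ` S)"
    by (rule covering_number_le)
  also have "\<dots> \<le> card S" using S(1) by (intro card_image_le) (simp add: is_cover_def)
  finally show ?thesis using S(2) by simp
qed

lemma covering_number_right_translate:
  assumes "compactin T K" "openin T U" "U \<noteq> {}" "h \<in> carrier G"
  shows "covering_number (right_translate h K) U = covering_number K U"
  using covering_number_right_translate_le[OF assms]
    covering_number_right_translate_le[OF compactin_right_translate[OF assms(4,1)] assms(2,3), of "inv h"]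
    right_translate_inv[OF assms(4) compactin_carrier[OF assms(1)]] assms(4)
  by simp

lemma covering_number_empty: "covering_number {} U = 0"
  using covering_number_le[of "{}" U "{}"] by (simp add: is_cover_def)

lemma covering_number_pos:
  assumes "compactin T K" "openin T U" "U \<noteq> {}" "K \<noteq> {}"
  shows "covering_number K U > 0"
proof -
  obtain S where S: "is_cover K U S" "card S = covering_number K U"
    using ex_minimal_cover assms by metis
  then have "S \<noteq> {}" using assms(4) by (auto simp: is_cover_def)
  then show ?thesis using S by (metis card_gt_0_iff is_cover_def)
qed

text \<open>Cover \<open>K\<close> by translates of \<open>V\<close>, then replace each of them by
  translates of the sets covering \<open>A\<close>. This bounds the normalised index (K : U) / (A :
  U) by a number that does not depend on \<open>U\<close>.\<close>

lemma covering_number_submult: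
  assumes "compactin T K" "compactin T A" "openin T V" "V \<subseteq> A" "V \<noteq> {}" "openin T U" "U \<noteq> {}"
  shows "covering_number K U \<le> covering_number K V * covering_number A U"
proof -
  obtain R where R: "is_cover K V R" "card R = covering_number K V"
    using ex_minimal_cover assms by metis
  obtain S where S: "is_cover A U S" "card S = covering_number A U"
    using ex_minimal_cover assms by metis
  have "is_cover K U ((\<lambda>(s, r). s \<otimes> r) ` (S \<times> R))"
  proof -
    have "K \<subseteq> (\<Union>r\<in>R. right_translate r (\<Union>s\<in>S. right_translate s U))"
    proof
      fix x assume "x \<in> K"
      then obtain r where r: "r \<in> R" "x \<in> right_translate r V" using R by (auto simp: is_cover_def)
      have "V \<subseteq> (\<Union>s\<in>S. right_translate s U)" using S assms(4) by (auto simp: is_cover_def)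
      with r show "x \<in> (\<Union>r\<in>R. right_translate r (\<Union>s\<in>S. right_translate s U))"
        using right_translate_mono by blast
    qed
    also have "\<dots> = (\<Union>r\<in>R. \<Union>s\<in>S. right_translate r (right_translate s U))"
      by (auto simp: right_translate_def)
    also have "\<dots> = (\<Union>r\<in>R. \<Union>s\<in>S. right_translate (s \<otimes> r) U)"
      using R(1) S(1) assms openin_carrier
      by (intro SUP_cong refl) (auto simp: right_translate_mult is_cover_def subset_iff)
    finally have "K \<subseteq> (\<Union>r\<in>R. \<Union>s\<in>S. right_translate (s \<otimes> r) U)" .
    then show ?thesis using R(1) S(1) unfolding is_cover_def by fastforce
  qed
  then have "covering_number K U \<le> card ((\<lambda>(s, r). s \<otimes> r) ` (S \<times> R))"
    by (rule covering_number_le)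
  also have "\<dots> \<le> card (S \<times> R)" using R S by (intro card_image_le) (auto simp: is_cover_def)
  also have "\<dots> = covering_number K V * covering_number A U"
    using R S by (simp add: card_cartesian_product)
  finally show ?thesis .
qed

text \<open>The set \<open>L K^-1\<close> is compact, hence closed, and misses the identity, so
  \<open>u v^-1\<close> avoids it for all \<open>u\<close>, \<open>v\<close> in some unit
  neighbourhood. If \<open>u g\<close> were in \<open>L\<close> and \<open>v g\<close> in
  \<open>K\<close>, the factor \<open>g\<close> would cancel in their quotient and put
  \<open>u v^-1\<close> into \<open>L K^-1\<close>.\<close>

lemma disjoint_compact_separation:
  assumes "compactin T K" "compactin T L" "K \<inter> L = {}"
  obtains V where "unit_nhd V"
    "\<And>U g. U \<subseteq> V \<Longrightarrow> g \<in> carrier G \<Longrightarrow> right_translate g U \<inter> K = {} \<or> right_translate g U \<inter> L = {}"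
proof -
  have cK: "K \<subseteq> carrier G" "L \<subseteq> carrier G" using assms compactin_carrier by auto
  define C where "C = (\<lambda>(l, k). l \<otimes> inv k) ` (L \<times> K)"
  have "continuous_map (prod_topology T T) T (\<lambda>(l, k). l \<otimes> inv k)"
    unfolding case_prod_unfold
    by (intro continuous_mult_compose continuous_inv_compose continuous_map_fst continuous_map_snd)
  then have "compactin T C"
    unfolding C_def using assms by (intro image_compactin) (auto simp: compactin_Times)
  then have "closedin T C" using Hausdorff compactin_imp_closedin by blast
  then have op: "openin T (carrier G - C)"
    by (metis openin_diff openin_topspace topspace_eq)
  have one: "\<one> \<notin> C"
  proof
    assume "\<one> \<in> C"
    then obtain l k where lk: "l \<in> L" "k \<in> K" "\<one> = l \<otimes> inv k" by (auto simp: C_def)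
    then have "l = k" using cK by (metis inv_closed inv_equality inv_inv subsetD)
    then show False using lk assms(3) by auto
  qed
  have cm: "continuous_map (prod_topology T T) T (\<lambda>(u, v). u \<otimes> inv v)"
    unfolding case_prod_unfold
    by (intro continuous_mult_compose continuous_inv_compose continuous_map_fst continuous_map_snd)
  define P where
    "P = {p \<in> topspace (prod_topology T T). (\<lambda>(u, v). u \<otimes> inv v) p \<in> carrier G - C}"
  have "openin (prod_topology T T) P"
    unfolding P_def using openin_continuous_map_preimage[OF cm op] .
  moreover have "(\<one>, \<one>) \<in> P" using one by (auto simp: P_def)
  ultimately obtain V1 V2 where V: "openin T V1" "openin T V2" "\<one> \<in> V1" "\<one> \<in> V2" "V1 \<times> V2 \<subseteq> P"
    unfolding openin_prod_topology_alt by meson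
  show thesis
  proof (rule that[of "V1 \<inter> V2"])
    show "unit_nhd (V1 \<inter> V2)" using V by (auto simp: unit_nhd_def)
    fix U g assume U: "U \<subseteq> V1 \<inter> V2" and g: "g \<in> carrier G"
    show "right_translate g U \<inter> K = {} \<or> right_translate g U \<inter> L = {}"
    proof (rule ccontr)
      assume "\<not> ?thesis"
      then obtain u v where uv: "u \<in> U" "v \<in> U" "u \<otimes> g \<in> L" "v \<otimes> g \<in> K"
        unfolding right_translate_def by blast
      have uc: "u \<in> carrier G" "v \<in> carrier G" using uv U V openin_carrier by auto
      have "(u \<otimes> g) \<otimes> inv (v \<otimes> g) = u \<otimes> inv v"
        using uc g by (simp add: inv_mult_group m_assoc) (simp flip: m_assoc)
      with uv have "u \<otimes> inv v \<in> C" unfolding C_def by (intro image_eqI[of _ _ "(u \<otimes> g, v \<otimes> g)"]) auto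
      moreover have "(u, v) \<in> P" using uv U V(5) by blast
      then have "u \<otimes> inv v \<notin> C" by (simp add: P_def)
      ultimately show False by simp
    qed
  qed
qed

end

text \<open>An error budget \<open>e\<close> is spread as \<open>e / 2 ^ (i + 1)\<close> over the
  terms. It serves countable subadditivity of the outer content and, with \<open>g = 0\<close>,
  outer regularity of locally finite measures.\<close>

lemma suminf_le_add_half_powers:
  fixes f g :: "nat \<Rightarrow> ennreal"
  assumes "\<And>i. f i \<le> g i + ennreal (e * (1/2) ^ Suc i)" "0 < e"
  shows "(\<Sum>i. f i) \<le> (\<Sum>i. g i) + ennreal e"
proof -
  have "(\<Sum>i. f i) \<le> (\<Sum>i. g i + ennreal (e * (1/2) ^ Suc i))"
    using assms by (intro suminf_le) auto
  also have "\<dots> = (\<Sum>i. g i) + (\<Sum>i. ennreal (e * (1/2) ^ Suc i))"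
    by (rule suminf_add[symmetric]) auto
  also have "(\<Sum>i. ennreal (e * (1/2) ^ Suc i)) = ennreal e"
  proof -
    have "(\<lambda>i. e * (1/2) ^ Suc i) sums (e * 1)"
      by (intro sums_mult power_half_series)
    then show ?thesis using assms(2) by (intro suminf_ennreal_eq) auto
  qed
  finally show ?thesis .
qed

section \<open>A right-invariant content on the compact sets\<close>

context locally_compact_group
begin

text \<open>The last clause fixes the scale. It excludes the zero content; later it gives
  \<open>V\<close> finite measure and every nonempty open set positive measure.\<close>

definition content :: "('g set \<Rightarrow> real) \<Rightarrow> bool" where
  "content c \<longleftrightarrow>
     (\<forall>K. compactin T K \<longrightarrow> 0 \<le> c K) \<and>
     (\<forall>K L. compactin T K \<and> compactin T L \<and> K \<subseteq> L \<longrightarrow> c K \<le> c L) \<and>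
     (\<forall>K L. compactin T K \<and> compactin T L \<longrightarrow> c (K \<union> L) \<le> c K + c L) \<and>
     (\<forall>K L. compactin T K \<and> compactin T L \<and> K \<inter> L = {} \<longrightarrow> c (K \<union> L) = c K + c L) \<and>
     (\<forall>K h. compactin T K \<and> h \<in> carrier G \<longrightarrow> c (right_translate h K) = c K) \<and>
     c {} = 0 \<and>
     (\<exists>A V. compactin T A \<and> unit_nhd V \<and> V \<subseteq> A \<and> c A = 1)"

lemma unit_nhdD: "unit_nhd U \<Longrightarrow> openin T U" "unit_nhd U \<Longrightarrow> U \<noteq> {}"
  by (auto simp: unit_nhd_def)

lemma ex_compact_unit_nhd:
  obtains A V where "compactin T A" "unit_nhd V" "V \<subseteq> A"
  using locally_compact unfolding locally_compact_space_def unit_nhd_def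
  by (metis one_closed topspace_eq)

text \<open>
  The content is a cluster point, in a product of compact intervals, of the normalised covering
  numbers \<open>(K : U) / (A : U)\<close> as the unit neighbourhood \<open>U\<close> shrinks.
\<close>

lemma ex_content: "\<exists>c. content c"
proof -
  obtain A V0 where A: "compactin T A" "unit_nhd V0" "V0 \<subseteq> A"
    using ex_compact_unit_nhd .
  have Ane: "A \<noteq> {}" using A by (auto simp: unit_nhd_def)
  \<comment> \<open>The value 0 at non-compact \<open>K\<close> keeps every coordinate of
    \<open>r U\<close> inside the box below, so that \<open>r U\<close> is one point of a product
    over all sets \<open>K\<close>.\<close>
  define r where "r U K = (if compactin T K
      then real (covering_number K U) / real (covering_number A U) else 0)" for U K
  define b where "b K = real (covering_number K V0)" for K
  \<comment> \<open>The filter of ever smaller unit neighbourhoods: by \<open>ev\<close>, a property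
    holds eventually iff it holds for all sufficiently small \<open>U\<close>.\<close>
  define F where "F = (INF V\<in>Collect unit_nhd. principal {U. unit_nhd U \<and> U \<subseteq> V})"
  have ev: "eventually P F \<longleftrightarrow> (\<exists>V. unit_nhd V \<and> (\<forall>U. unit_nhd U \<and> U \<subseteq> V \<longrightarrow> P U))" for P
    unfolding F_def
  proof (subst eventually_INF_base)
    show "Collect unit_nhd \<noteq> {}" using A by auto
    show "\<exists>x\<in>Collect unit_nhd. principal {U. unit_nhd U \<and> U \<subseteq> x}
        \<le> inf (principal {U. unit_nhd U \<and> U \<subseteq> a}) (principal {U. unit_nhd U \<and> U \<subseteq> b})"
      if "a \<in> Collect unit_nhd" "b \<in> Collect unit_nhd" for a b
      using that by (intro bexI[of _ "a \<inter> b"]) (auto simp: unit_nhd_def)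
  qed (auto simp: eventually_principal)
  have Fb: "F \<noteq> bot"
    unfolding trivial_limit_def ev by auto
  have pos: "covering_number A U > 0" if "unit_nhd U" for U
    using covering_number_pos[OF A(1) unit_nhdD[OF that] Ane] .
  have rb: "r U K \<in> {0..b K}" if U: "unit_nhd U" for U K
  proof (cases "compactin T K")
    case True
    have "real (covering_number K U) \<le> b K * real (covering_number A U)"
      unfolding b_def of_nat_mult[symmetric] of_nat_le_iff
      using covering_number_submult[OF True A(1) _ A(3)] A(2) U by (auto simp: unit_nhd_def)
    then show ?thesis using True pos[OF U] by (simp add: r_def field_simps)
  qed (simp add: r_def b_def)
  define Box where "Box = PiE UNIV (\<lambda>K. {0..b K})"
  have "compactin (product_topology (\<lambda>_. euclidean) UNIV) Box"
    unfolding Box_def compactin_PiE by auto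
  then have cBox: "compact Box" by (simp add: euclidean_product_topology)
  have "eventually (\<lambda>x. x \<in> Box) (filtermap r F)"
    unfolding eventually_filtermap ev Box_def
    using A(2) rb by (auto intro!: exI[of _ V0])
  moreover have "filtermap r F \<noteq> bot" using Fb by (simp add: filtermap_bot_iff)
  ultimately obtain c where c: "c \<in> Box" "inf (nhds c) (filtermap r F) \<noteq> bot"
    using cBox unfolding compact_filter by blast
  \<comment> \<open>A closed condition satisfied by the normalised indices of all small
    \<open>U\<close> survives at the cluster point. Every clause of \<open>content\<close> other
    than nonnegativity is such a condition on finitely many coordinates.\<close>
  have cl: "c \<in> S" if "closed S" and "\<exists>V. unit_nhd V \<and> (\<forall>U. unit_nhd U \<and> U \<subseteq> V \<longrightarrow> r U \<in> S)" for S
  proof (rule ccontr)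
    assume "c \<notin> S"
    then have "eventually (\<lambda>x. x \<in> - S) (nhds c)"
      using that(1) by (intro eventually_nhds_in_open) auto
    moreover have "eventually (\<lambda>x. x \<in> S) (filtermap r F)"
      using that(2) unfolding eventually_filtermap ev .
    ultimately have "eventually (\<lambda>x. False) (inf (nhds c) (filtermap r F))"
      unfolding eventually_inf by (metis ComplD)
    then show False using c(2) by (simp add: trivial_limit_def)
  qed
  have cont: "continuous_on UNIV (\<lambda>x :: 'g set \<Rightarrow> real. x K)" for K
    by (rule continuous_on_product_coordinates)
  have ne: "U \<noteq> {}" "openin T U" if "unit_nhd U" for U using that by (auto simp: unit_nhd_def)
  have "content c"
    unfolding content_def
  proof (intro conjI allI impI)
    fix K show "0 \<le> c K" using c(1) by (auto simp: Box_def)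
  next
    fix K L assume KL: "compactin T K \<and> compactin T L \<and> K \<subseteq> L"
    have "c \<in> {x. x K \<le> x L}"
    proof (rule cl)
      show "closed {x :: 'g set \<Rightarrow> real. x K \<le> x L}"
        by (intro closed_Collect_le cont)
      show "\<exists>V. unit_nhd V \<and> (\<forall>U. unit_nhd U \<and> U \<subseteq> V \<longrightarrow> r U \<in> {x. x K \<le> x L})"
        using A(2) KL covering_number_mono[of L _ K] ne
        by (auto intro!: exI[of _ V0] divide_right_mono simp: r_def)
    qed
    then show "c K \<le> c L" by simp
  next
    fix K L assume KL: "compactin T K \<and> compactin T L"
    have "c \<in> {x. x (K \<union> L) \<le> x K + x L}"
    proof (rule cl)
      show "closed {x :: 'g set \<Rightarrow> real. x (K \<union> L) \<le> x K + x L}"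
        by (intro closed_Collect_le cont continuous_on_add)
      show "\<exists>V. unit_nhd V \<and> (\<forall>U. unit_nhd U \<and> U \<subseteq> V \<longrightarrow> r U \<in> {x. x (K \<union> L) \<le> x K + x L})"
      proof (intro exI[of _ V0] conjI allI impI CollectI A(2))
        fix U assume U: "unit_nhd U \<and> U \<subseteq> V0"
        have "real (covering_number (K \<union> L) U) \<le> real (covering_number K U) + real (covering_number L U)"
          unfolding of_nat_add[symmetric] of_nat_le_iff
          using U KL ne by (intro covering_number_Un_le) auto
        then show "r U (K \<union> L) \<le> r U K + r U L"
          using KL by (simp add: r_def compactin_Un divide_right_mono flip: add_divide_distrib)
      qed
    qed
    then show "c (K \<union> L) \<le> c K + c L" by simp
  next
    fix K L assume KL: "compactin T K \<and> compactin T L \<and> K \<inter> L = {}"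
    have "c \<in> {x. x (K \<union> L) = x K + x L}"
    proof (rule cl)
      show "closed {x :: 'g set \<Rightarrow> real. x (K \<union> L) = x K + x L}"
        by (intro closed_Collect_eq cont continuous_on_add)
      \<comment> \<open>Additivity is the clause that depends on how small \<open>U\<close> is:
        inside this \<open>V\<close>, no translate of \<open>U\<close> meets both compact
        sets.\<close>
      obtain V where V: "unit_nhd V"
        "\<And>U g. U \<subseteq> V \<Longrightarrow> g \<in> carrier G \<Longrightarrow> right_translate g U \<inter> K = {} \<or> right_translate g U \<inter> L = {}"
        using disjoint_compact_separation[of K L] KL by blast
      show "\<exists>V. unit_nhd V \<and> (\<forall>U. unit_nhd U \<and> U \<subseteq> V \<longrightarrow> r U \<in> {x. x (K \<union> L) = x K + x L})"
      proof (intro exI[of _ V] conjI allI impI CollectI V(1))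
        fix U assume U: "unit_nhd U \<and> U \<subseteq> V"
        have "covering_number (K \<union> L) U = covering_number K U + covering_number L U"
          using U KL ne V(2) by (intro covering_number_Un_eq) auto
        then show "r U (K \<union> L) = r U K + r U L"
          using KL by (simp add: r_def compactin_Un flip: add_divide_distrib)
      qed
    qed
    then show "c (K \<union> L) = c K + c L" by simp
  next
    fix K h assume Kh: "compactin T K \<and> h \<in> carrier G"
    have "c \<in> {x. x (right_translate h K) = x K}"
    proof (rule cl)
      show "closed {x :: 'g set \<Rightarrow> real. x (right_translate h K) = x K}"
        by (intro closed_Collect_eq cont)
      show "\<exists>V. unit_nhd V \<and> (\<forall>U. unit_nhd U \<and> U \<subseteq> V \<longrightarrow> r U \<in> {x. x (right_translate h K) = x K})"
        using A(2) Kh covering_number_right_translate[of K _ h] ne compactin_right_translate[of h K]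
        by (auto intro!: exI[of _ V0] simp: r_def)
    qed
    then show "c (right_translate h K) = c K" by simp
  next
    have "c \<in> {x. x {} = 0}"
    proof (rule cl)
      show "closed {x :: 'g set \<Rightarrow> real. x {} = 0}"
        by (intro closed_Collect_eq cont continuous_on_const)
    qed (use A(2) in \<open>auto simp: r_def covering_number_empty\<close>)
    then show "c {} = 0" by simp
  next
    have "c \<in> {x. x A = 1}"
    proof (rule cl)
      show "closed {x :: 'g set \<Rightarrow> real. x A = 1}"
        by (intro closed_Collect_eq cont continuous_on_const)
    qed (use A pos in \<open>fastforce simp: r_def\<close>)
    then show "\<exists>A V. compactin T A \<and> unit_nhd V \<and> V \<subseteq> A \<and> c A = 1" using A by auto
  qed
  then show ?thesis by blast
qed

text \<open>The disjoint compact sets \<open>K - V\<close> and \<open>K - U\<close> have disjoint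
  open neighbourhoods \<open>P\<close> and \<open>Q\<close>; removing \<open>Q\<close> from
  \<open>K\<close> leaves a compact subset of \<open>U\<close>, removing \<open>P\<close> one of
  \<open>V\<close>.\<close>

lemma compactin_subset_Un_split:
  assumes "compactin T K" "openin T U" "openin T V" "K \<subseteq> U \<union> V"
  obtains K1 K2 where "compactin T K1" "compactin T K2" "K1 \<subseteq> U" "K2 \<subseteq> V" "K = K1 \<union> K2"
proof -
  have cd: "compactin T (K - W)" if "openin T W" for W
  proof -
    have "closedin T (topspace T - W)" using that by blast
    then have "compactin T ((topspace T - W) \<inter> K)" using assms(1) closed_Int_compactin by blast
    moreover have "(topspace T - W) \<inter> K = K - W" using compactin_carrier[OF assms(1)] by auto
    ultimately show ?thesis by simp
  qed
  have "disjnt (K - V) (K - U)" using assms(4) by (auto simp: disjnt_def)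
  then obtain P Q where PQ: "openin T P" "openin T Q" "K - V \<subseteq> P" "K - U \<subseteq> Q" "disjnt P Q"
    using Hausdorff_space_compact_sets Hausdorff cd assms(2,3) by metis
  show thesis
    by (rule that[of "K - Q" "K - P"]) (use PQ cd in \<open>auto simp: disjnt_def\<close>)
qed

end

section \<open>Right Haar measure\<close>

context locally_compact_group
begin

text \<open>A content need not be the restriction of a measure to the compact sets, so the measure
  is not read off from \<open>c\<close> directly: open sets are approximated from inside, then
  arbitrary sets by open sets from outside.\<close>

definition open_content :: "('g set \<Rightarrow> real) \<Rightarrow> 'g set \<Rightarrow> ennreal" where
  "open_content c U = (SUP K\<in>{K. compactin T K \<and> K \<subseteq> U}. ennreal (c K))"

definition outer_content :: "('g set \<Rightarrow> real) \<Rightarrow> 'g set \<Rightarrow> ennreal" where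
  "outer_content c E = (INF U\<in>{U. openin T U \<and> E \<subseteq> U}. open_content c U)"

lemma open_content_upper: "compactin T K \<Longrightarrow> K \<subseteq> U \<Longrightarrow> ennreal (c K) \<le> open_content c U"
  unfolding open_content_def by (rule SUP_upper) auto

lemma open_content_mono: "U \<subseteq> V \<Longrightarrow> open_content c U \<le> open_content c V"
  unfolding open_content_def by (rule SUP_subset_mono) auto

lemma outer_content_lower: "openin T U \<Longrightarrow> E \<subseteq> U \<Longrightarrow> outer_content c E \<le> open_content c U"
  unfolding outer_content_def by (rule INF_lower) auto

lemma outer_content_mono: "E \<subseteq> F \<Longrightarrow> outer_content c E \<le> outer_content c F"
  unfolding outer_content_def by (rule INF_superset_mono) auto

lemma outer_content_open: "openin T U \<Longrightarrow> outer_content c U = open_content c U"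
  unfolding outer_content_def
  by (intro antisym INF_lower INF_greatest) (auto intro: open_content_mono)

context
  fixes c assumes c: "content c"
begin

lemma content_nonneg: "compactin T K \<Longrightarrow> 0 \<le> c K"
  and content_mono: "compactin T K \<Longrightarrow> compactin T L \<Longrightarrow> K \<subseteq> L \<Longrightarrow> c K \<le> c L"
  and content_Un_le: "compactin T K \<Longrightarrow> compactin T L \<Longrightarrow> c (K \<union> L) \<le> c K + c L"
  and content_Un_eq: "compactin T K \<Longrightarrow> compactin T L \<Longrightarrow> K \<inter> L = {} \<Longrightarrow> c (K \<union> L) = c K + c L"
  and content_right_translate: "compactin T K \<Longrightarrow> h \<in> carrier G \<Longrightarrow> c (right_translate h K) = c K"
  and content_empty: "c {} = 0"
  using c unfolding content_def by (elim conjE; simp)+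

lemma open_content_empty: "open_content c {} = 0"
  unfolding open_content_def by (auto simp: content_empty cong: conj_cong)

lemma open_content_Un_le:
  assumes "openin T U" "openin T V"
  shows "open_content c (U \<union> V) \<le> open_content c U + open_content c V"
  unfolding open_content_def[of c "U \<union> V"]
proof (rule SUP_least)
  fix K assume "K \<in> {K. compactin T K \<and> K \<subseteq> U \<union> V}"
  then obtain K1 K2 where K: "compactin T K1" "compactin T K2" "K1 \<subseteq> U" "K2 \<subseteq> V" "K = K1 \<union> K2"
    using compactin_subset_Un_split[OF _ assms] by (metis mem_Collect_eq)
  have "ennreal (c K) \<le> ennreal (c K1 + c K2)"
    using K content_Un_le by (simp add: ennreal_leI)
  also have "\<dots> = ennreal (c K1) + ennreal (c K2)"
    using K content_nonneg by simp
  also have "\<dots> \<le> open_content c U + open_content c V"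
    using K by (intro add_mono open_content_upper)
  finally show "ennreal (c K) \<le> open_content c U + open_content c V" .
qed

lemma open_content_finite_UN_le:
  fixes U :: "nat \<Rightarrow> 'g set"
  assumes "\<And>i. openin T (U i)"
  shows "open_content c (\<Union>i<n. U i) \<le> (\<Sum>i<n. open_content c (U i))"
proof (induction n)
  case 0
  then show ?case by (simp add: open_content_empty)
next
  case (Suc n)
  have "open_content c (\<Union>i<Suc n. U i) = open_content c ((\<Union>i<n. U i) \<union> U n)"
    by (simp add: lessThan_Suc Un_commute)
  also have "\<dots> \<le> open_content c (\<Union>i<n. U i) + open_content c (U n)"
    using assms by (intro open_content_Un_le) auto
  also have "\<dots> \<le> (\<Sum>i<Suc n. open_content c (U i))"
    using Suc by (simp add: add_right_mono)
  finally show ?case .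
qed

text \<open>A compact subset of the union already lies in finitely many of the open sets, which
  reduces the claim to the finite case.\<close>

lemma open_content_UN_le:
  fixes U :: "nat \<Rightarrow> 'g set"
  assumes "\<And>i. openin T (U i)"
  shows "open_content c (\<Union>i. U i) \<le> (\<Sum>i. open_content c (U i))"
  unfolding open_content_def[of c "\<Union>i. U i"]
proof (rule SUP_least)
  fix K assume K: "K \<in> {K. compactin T K \<and> K \<subseteq> (\<Union>i. U i)}"
  then obtain F where F: "finite F" "F \<subseteq> range U" "K \<subseteq> \<Union>F"
    using compactinD[of T K "range U"] assms by auto
  then obtain I where I: "finite I" "F = U ` I" by (meson finite_subset_image)
  then obtain n where n: "I \<subseteq> {..<n}" using finite_nat_bounded by blast
  have "ennreal (c K) \<le> open_content c (\<Union>i<n. U i)"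
    using K F I n by (intro open_content_upper) (auto, blast)
  also have "\<dots> \<le> (\<Sum>i<n. open_content c (U i))"
    using assms by (rule open_content_finite_UN_le)
  also have "\<dots> \<le> (\<Sum>i. open_content c (U i))"
    by (intro sum_le_suminf) auto
  finally show "ennreal (c K) \<le> (\<Sum>i. open_content c (U i))" .
qed

lemma outer_content_UN_le:
  fixes E :: "nat \<Rightarrow> 'g set"
  assumes "\<And>i. E i \<subseteq> carrier G"
  shows "outer_content c (\<Union>i. E i) \<le> (\<Sum>i. outer_content c (E i))"
proof (rule ennreal_le_epsilon)
  fix e :: real assume fin: "(\<Sum>i. outer_content c (E i)) < Orderings.top" and e: "0 < e"
  have "\<exists>U. openin T U \<and> E i \<subseteq> U \<and> open_content c U \<le> outer_content c (E i) + ennreal (e * (1/2) ^ Suc i)" for i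
  proof -
    have "outer_content c (E i) < Orderings.top"
      using fin by (metis ennreal_suminf_lessD)
    then have "outer_content c (E i) < outer_content c (E i) + ennreal (e * (1/2) ^ Suc i)"
      using e by (simp add: ennreal_add_left_cancel_less less_top)
    then obtain U where "openin T U" "E i \<subseteq> U"
      "open_content c U < outer_content c (E i) + ennreal (e * (1/2) ^ Suc i)"
      unfolding outer_content_def[of c "E i"] INF_less_iff by auto
    then show ?thesis by (auto intro: less_imp_le)
  qed
  then obtain U where U: "\<And>i. openin T (U i)" "\<And>i. E i \<subseteq> U i"
    "\<And>i. open_content c (U i) \<le> outer_content c (E i) + ennreal (e * (1/2) ^ Suc i)"
    by metis
  have "outer_content c (\<Union>i. E i) \<le> open_content c (\<Union>i. U i)"
    using U by (intro outer_content_lower) auto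
  also have "\<dots> \<le> (\<Sum>i. open_content c (U i))"
    using U(1) by (rule open_content_UN_le)
  also have "\<dots> \<le> (\<Sum>i. outer_content c (E i)) + ennreal e"
    using U(3) e by (rule suminf_le_add_half_powers)
  finally show "outer_content c (\<Union>i. E i) \<le> (\<Sum>i. outer_content c (E i)) + ennreal e" .
qed

lemma outer_content_empty: "outer_content c {} = 0"
  by (simp add: outer_content_open open_content_empty)

text \<open>The order of choice matters: first a compact \<open>K\<close> inside
  \<open>V \<inter> U\<close>, and only then a compact \<open>L\<close> inside the open set
  \<open>V - K\<close>, which contains \<open>V - U\<close>. The two are disjoint, so additivity of
  the content applies to their union inside \<open>V\<close>.\<close>

lemma open_content_split:
  assumes "openin T U" "openin T V"
  shows "open_content c (V \<inter> U) + outer_content c (V - U) \<le> open_content c V"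
proof -
  have "open_content c (V \<inter> U) + outer_content c (V - U) =
     (SUP K\<in>{K. compactin T K \<and> K \<subseteq> V \<inter> U}. ennreal (c K) + outer_content c (V - U))"
    unfolding open_content_def by (subst ennreal_SUP_add_left) auto
  also have "\<dots> \<le> open_content c V"
  proof (rule SUP_least)
    fix K assume "K \<in> {K. compactin T K \<and> K \<subseteq> V \<inter> U}"
    then have K: "compactin T K" "K \<subseteq> V \<inter> U" by auto
    have "closedin T K" using K Hausdorff compactin_imp_closedin by blast
    then have "openin T (V - K)" using assms by blast
    then have "outer_content c (V - U) \<le> open_content c (V - K)"
      using K by (intro outer_content_lower) auto
    then have "ennreal (c K) + outer_content c (V - U) \<le> ennreal (c K) + open_content c (V - K)"
      by (rule add_left_mono)
    also have "\<dots> = (SUP L\<in>{L. compactin T L \<and> L \<subseteq> V - K}. ennreal (c K) + ennreal (c L))"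
      unfolding open_content_def by (subst ennreal_SUP_add_right) auto
    also have "\<dots> \<le> open_content c V"
    proof (rule SUP_least)
      fix L assume L: "L \<in> {L. compactin T L \<and> L \<subseteq> V - K}"
      then have "ennreal (c K) + ennreal (c L) = ennreal (c (K \<union> L))"
        using K content_nonneg by (subst content_Un_eq) auto
      also have "\<dots> \<le> open_content c V"
        using K L by (intro open_content_upper) (auto intro: compactin_Un)
      finally show "ennreal (c K) + ennreal (c L) \<le> open_content c V" .
    qed
    finally show "ennreal (c K) + outer_content c (V - U) \<le> open_content c V" .
  qed
  finally show ?thesis .
qed

lemma outer_content_split:
  assumes "openin T U"
  shows "outer_content c (E \<inter> U) + outer_content c (E - U) \<le> outer_content c E"
  unfolding outer_content_def[of c E]
proof (rule INF_greatest)
  fix V assume "V \<in> {V. openin T V \<and> E \<subseteq> V}"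
  then have V: "openin T V" "E \<subseteq> V" by auto
  have "outer_content c (E \<inter> U) \<le> open_content c (V \<inter> U)"
    using V assms by (intro outer_content_lower) auto
  moreover have "outer_content c (E - U) \<le> outer_content c (V - U)"
    using V by (intro outer_content_mono) auto
  ultimately show "outer_content c (E \<inter> U) + outer_content c (E - U) \<le> open_content c V"
    using open_content_split[OF assms V(1)] by (meson add_mono order_trans)
qed

lemma outer_content_right_translate_le:
  assumes h: "h \<in> carrier G" and E: "E \<subseteq> carrier G"
  shows "outer_content c (right_translate h E) \<le> outer_content c E"
  unfolding outer_content_def[of c E]
proof (rule INF_greatest)
  fix V assume "V \<in> {V. openin T V \<and> E \<subseteq> V}"
  then have V: "openin T V" "E \<subseteq> V" by auto
  have "outer_content c (right_translate h E) \<le> open_content c (right_translate h V)"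
    using V h by (intro outer_content_lower openin_right_translate right_translate_mono)
  also have "\<dots> \<le> open_content c V"
    unfolding open_content_def[of c "right_translate h V"]
  proof (rule SUP_least)
    fix K assume "K \<in> {K. compactin T K \<and> K \<subseteq> right_translate h V}"
    then have K: "compactin T K" "K \<subseteq> right_translate h V" by auto
    have "right_translate (inv h) K \<subseteq> right_translate (inv h) (right_translate h V)"
      using K by (intro right_translate_mono)
    then have "right_translate (inv h) K \<subseteq> V"
      using h V openin_carrier by (simp add: right_translate_inv)
    then have "ennreal (c (right_translate (inv h) K)) \<le> open_content c V"
      using K h by (intro open_content_upper compactin_right_translate) auto
    then show "ennreal (c K) \<le> open_content c V"
      using K h by (simp add: content_right_translate)
  qed
  finally show "outer_content c (right_translate h E) \<le> open_content c V" .
qed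

lemma outer_content_right_translate:
  assumes h: "h \<in> carrier G" and E: "E \<subseteq> carrier G"
  shows "outer_content c (right_translate h E) = outer_content c E"
  using outer_content_right_translate_le[OF assms]
    outer_content_right_translate_le[of "inv h" "right_translate h E"] assms
  by (simp add: right_translate_inv right_translate_carrier)

text \<open>Caratheodory's construction on all subsets of \<open>G\<close>. The split inequality
  puts the open sets among the measurable ones, and with them the sigma-algebra they
  generate.\<close>

lemma measure_space_outer_content:
  "measure_space (carrier G) (sigma_sets (carrier G) {U. openin T U}) (outer_content c)"
proof -
  interpret P: sigma_algebra "carrier G" "Pow (carrier G)" by (rule sigma_algebra_Pow)
  define L where "L = lambda_system (carrier G) (Pow (carrier G)) (outer_content c)"
  have oms: "outer_measure_space (Pow (carrier G)) (outer_content c)"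
    unfolding outer_measure_space_def
  proof (intro conjI)
    show "positive (Pow (carrier G)) (outer_content c)"
      by (simp add: positive_def outer_content_empty)
    show "increasing (Pow (carrier G)) (outer_content c)"
      by (simp add: increasing_def outer_content_mono)
    show "countably_subadditive (Pow (carrier G)) (outer_content c)"
      unfolding countably_subadditive_def by (intro allI impI outer_content_UN_le) auto
  qed
  have ms: "measure_space (carrier G) L (outer_content c)"
    unfolding L_def by (rule P.caratheodory_lemma[OF oms])
  then interpret L: sigma_algebra "carrier G" L by (simp add: measure_space_def)
  have "U \<in> L" if "openin T U" for U
    unfolding L_def P.lambda_system_eq
  proof (intro CollectI conjI ballI antisym)
    show "U \<in> Pow (carrier G)" using that openin_carrier by auto
    fix E assume E: "E \<in> Pow (carrier G)"
    show "outer_content c (E \<inter> U) + outer_content c (E - U) \<le> outer_content c E"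
      using that by (rule outer_content_split)
    \<comment> \<open>Binary subadditivity is the countable one for the sequence
      \<open>E \<inter> U\<close>, \<open>E - U\<close>, {}, {}, and so on.\<close>
    have "outer_content c (\<Union>i. binaryset (E \<inter> U) (E - U) i)
      \<le> (\<Sum>i. outer_content c (binaryset (E \<inter> U) (E - U) i))"
      using E by (intro outer_content_UN_le) (auto simp: binaryset_def)
    moreover have "(\<Union>i. binaryset (E \<inter> U) (E - U) i) = E"
      by (subst UN_binaryset_eq) auto
    moreover have "(\<Sum>i. outer_content c (binaryset (E \<inter> U) (E - U) i))
       = outer_content c (E \<inter> U) + outer_content c (E - U)"
      by (rule suminf_binaryset_eq) (rule outer_content_empty)
    ultimately show "outer_content c E \<le> outer_content c (E \<inter> U) + outer_content c (E - U)"
      by simp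
  qed
  then have sub: "sigma_sets (carrier G) {U. openin T U} \<subseteq> L"
    by (intro L.sigma_sets_subset) auto
  have "sigma_algebra (carrier G) (sigma_sets (carrier G) {U. openin T U})"
    using openin_carrier by (intro sigma_algebra_sigma_sets) auto
  then show ?thesis by (rule measure_down[OF ms _ sub])
qed

end

end

section \<open>Borel sets of a topology and the Haar measure\<close>

lemma space_borel_of [simp]: "space (borel_of T) = topspace T"
  unfolding borel_of_def by (rule space_measure_of) (auto dest: openin_subset)

lemma sets_borel_of: "sets (borel_of T) = sigma_sets (topspace T) {U. openin T U}"
  unfolding borel_of_def by (rule sets_measure_of) (auto dest: openin_subset)

lemma openin_borel_of: "openin T U \<Longrightarrow> U \<in> sets (borel_of T)"
  by (simp add: sets_borel_of sigma_sets.Basic)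

lemma closedin_borel_of: "closedin T C \<Longrightarrow> C \<in> sets (borel_of T)"
  by (metis closedin_def double_diff openin_borel_of sets.Diff sets.top space_borel_of subset_refl)

lemma continuous_map_measurable:
  assumes "continuous_map X Y f"
  shows "f \<in> borel_of X \<rightarrow>\<^sub>M borel_of Y"
  unfolding borel_of_def[of Y]
proof (rule measurable_measure_of)
  show "f \<in> space (borel_of X) \<rightarrow> topspace Y"
    using assms by (auto simp: continuous_map_def)
  fix U assume "U \<in> {U. openin Y U}"
  then have "openin X {x \<in> topspace X. f x \<in> U}"
    using assms openin_continuous_map_preimage by auto
  moreover have "f -` U \<inter> space (borel_of X) = {x \<in> topspace X. f x \<in> U}" by auto
  ultimately show "f -` U \<inter> space (borel_of X) \<in> sets (borel_of X)"
    using openin_borel_of by metis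
qed (auto dest: openin_subset)

text \<open>Finiteness and positivity both come from covering by translates: a compact set is
  covered by finitely many translates of \<open>V\<close>, which has finite measure, and
  \<open>A\<close>, of content 1, by finitely many translates of any nonempty open set.\<close>

theorem (in locally_compact_group) ex_right_Haar_measure:
  obtains m where "sets m = sets (borel_of T)"
    "\<forall>h\<in>carrier G. \<forall>A\<in>sets m. emeasure m (right_translate h A) = emeasure m A"
    "\<forall>K. compactin T K \<longrightarrow> emeasure m K < \<infinity>"
    "\<forall>U. openin T U \<longrightarrow> U \<noteq> {} \<longrightarrow> emeasure m U > 0"
proof -
  obtain c where c: "content c" using ex_content by blast
  have "\<exists>A V. compactin T A \<and> unit_nhd V \<and> V \<subseteq> A \<and> c A = 1"
    using c unfolding content_def by (elim conjE)
  then obtain A V where A: "compactin T A" "unit_nhd V" "V \<subseteq> A" "c A = 1"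
    by (elim exE conjE)
  define m where "m = measure_of (carrier G) {U. openin T U} (outer_content c)"
  have sets: "sets m = sigma_sets (carrier G) {U. openin T U}"
    unfolding m_def using openin_carrier by (intro sets_measure_of) auto
  then have sets': "sets m = sets (borel_of T)" by (simp add: sets_borel_of)
  have em: "emeasure m E = outer_content c E" if "E \<in> sets m" for E
  proof (rule emeasure_measure_of[OF m_def])
    show "{U. openin T U} \<subseteq> Pow (carrier G)" using openin_carrier by auto
    show "positive (sets m) (outer_content c)" "countably_additive (sets m) (outer_content c)"
      using measure_space_outer_content[OF c] sets by (auto simp: measure_space_def)
  qed (fact that)
  have sub: "E \<subseteq> carrier G" if "E \<in> sets m" for E
    using that sets.sets_into_space[of E m] sets_eq_imp_space_eq[OF sets'] by auto
  have op: "openin T U \<Longrightarrow> U \<in> sets m" for U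
    using sets' openin_borel_of by blast
  have tr: "right_translate h E \<in> sets m" if "h \<in> carrier G" "E \<in> sets m" for h E
  proof -
    have "continuous_map T T (\<lambda>x. x \<otimes> inv h)"
      using that by (intro continuous_mult_compose) auto
    then have "(\<lambda>x. x \<otimes> inv h) -` E \<inter> carrier G \<in> sets m"
      using measurable_sets[OF continuous_map_measurable, of T T _ E] that sets' by simp
    moreover have "(\<lambda>x. x \<otimes> inv h) -` E \<inter> carrier G = right_translate h E"
      using that sub by (auto simp: right_translate_eq)
    ultimately show ?thesis by simp
  qed
  have inv: "emeasure m (right_translate h E) = emeasure m E"
    if "h \<in> carrier G" "E \<in> sets m" for h E
    using that tr em outer_content_right_translate[OF c _ sub] by simp
  have finite_cover: "emeasure m K \<le> real (card S) * emeasure m U"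
    if "is_cover K U S" "openin T U" for K U S
  proof -
    have S: "finite S" "S \<subseteq> carrier G" "K \<subseteq> (\<Union>g\<in>S. right_translate g U)"
      using that by (auto simp: is_cover_def)
    have "emeasure m K \<le> emeasure m (\<Union>g\<in>S. right_translate g U)"
      using S tr op that(2) by (intro emeasure_mono sets.finite_UN) auto
    also have "\<dots> \<le> (\<Sum>g\<in>S. emeasure m (right_translate g U))"
      using S tr op that(2) by (intro emeasure_subadditive_finite) auto
    also have "\<dots> = (\<Sum>g\<in>S. emeasure m U)"
      using S inv op that(2) by (intro sum.cong) auto
    finally show ?thesis by (simp add: ennreal_of_nat_eq_real_of_nat)
  qed
  \<comment> \<open>\<open>V\<close> is open, so its measure is a supremum over compact subsets;
    these lie in \<open>A\<close> and have content at most \<open>c A\<close>.\<close>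
  have Vfin: "emeasure m V < \<infinity>"
  proof -
    have "emeasure m V = open_content c V"
      using A unit_nhdD em op outer_content_open by metis
    also have "\<dots> \<le> ennreal (c A)"
      unfolding open_content_def
    proof (rule SUP_least)
      fix K assume "K \<in> {K. compactin T K \<and> K \<subseteq> V}"
      then show "ennreal (c K) \<le> ennreal (c A)"
        using A content_mono[OF c, of K A] by (auto intro: ennreal_leI)
    qed
    also have "\<dots> < \<infinity>" by simp
    finally show ?thesis .
  qed
  show thesis
  proof (rule that[OF sets']; intro ballI allI impI)
    show "emeasure m (right_translate h A) = emeasure m A" if "h \<in> carrier G" "A \<in> sets m" for h A
      using that by (rule inv)
  next
    fix K assume K: "compactin T K"
    obtain S where "is_cover K V S" using ex_cover[OF K unit_nhdD[OF A(2)]] .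
    from finite_cover[OF this unit_nhdD(1)[OF A(2)]] Vfin
    show "emeasure m K < \<infinity>"
      by (metis ennreal_less_top ennreal_mult_less_top infinity_ennreal_def order_le_less_trans)
  next
    fix U assume U: "openin T U" "U \<noteq> {}"
    obtain S where S: "is_cover A U S" using ex_cover[OF A(1) U] .
    \<comment> \<open>The content of \<open>A\<close> is a lower bound for the inner content of an
      open superset, hence the open union takes the place of \<open>A\<close>.\<close>
    let ?W = "\<Union>g\<in>S. right_translate g U"
    have W: "is_cover ?W U S" "openin T ?W" "A \<subseteq> ?W"
      using S openin_right_translate U by (auto simp: is_cover_def subset_iff)
    have "ennreal 1 \<le> open_content c ?W"
      using A W(3) open_content_upper[of A ?W c] by simp
    also have "\<dots> = emeasure m ?W"
      using em op W(2) outer_content_open by metis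
    also have "\<dots> \<le> real (card S) * emeasure m U"
      by (rule finite_cover[OF W(1) U(1)])
    finally show "emeasure m U > 0"
      by (cases "emeasure m U = 0") (auto simp: zero_less_iff_neq_zero)
  qed
qed

section \<open>Smoothing along a measure-preserving action\<close>

lemma borel_of_euclidean: "borel_of euclidean = borel"
  by (simp add: borel_of_def borel_def)

text \<open>Countability of the base makes every open set a countable union of base members.\<close>

lemma sigma_sets_eq_borel_of:
  assumes "countable \<B>" "\<And>V. V \<in> \<B> \<Longrightarrow> openin T V"
    and "\<And>U x. openin T U \<Longrightarrow> x \<in> U \<Longrightarrow> \<exists>V\<in>\<B>. x \<in> V \<and> V \<subseteq> U"
  shows "sets (borel_of T) = sigma_sets (topspace T) \<B>"
proof
  have "U \<in> sigma_sets (topspace T) \<B>" if "openin T U" for U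
  proof -
    have "U = \<Union>{V \<in> \<B>. V \<subseteq> U}" using assms(3)[OF that] by blast
    moreover have "\<Union>{V \<in> \<B>. V \<subseteq> U} \<in> sigma_sets (topspace T) \<B>"
      using assms(1) by (intro sigma_sets_UNION) (auto intro: countable_subset)
    ultimately show ?thesis by simp
  qed
  then show "sets (borel_of T) \<subseteq> sigma_sets (topspace T) \<B>"
    unfolding sets_borel_of by (intro sigma_sets_mono) auto
  show "sigma_sets (topspace T) \<B> \<subseteq> sets (borel_of T)"
    unfolding sets_borel_of using assms(2) by (intro sigma_sets_mono') auto
qed

lemma polish_dense_sequence:
  assumes "polish_topology T" "topspace T \<noteq> {}"
  obtains q :: "nat \<Rightarrow> 'a" where "range q \<subseteq> topspace T" "T closure_of (range q) = topspace T"
proof -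
  obtain D where D: "countable D" "D \<subseteq> topspace T" "T closure_of D = topspace T"
    using assms unfolding polish_topology_def separable_space_def by auto
  have "D \<noteq> {}" using D(3) assms(2) by (metis closure_of_empty)
  then show thesis using that[of "from_nat_into D"] D by (simp add: range_from_nat_into)
qed

lemma (in Metric_space) dense_ball_refine:
  assumes "range q \<subseteq> M" "mtopology closure_of (range q) = M" "openin mtopology U" "x \<in> U"
  obtains i n :: nat where "x \<in> mball (q i) (1 / Suc n)" "mball (q i) (1 / Suc n) \<subseteq> U"
proof -
  obtain r where r: "r > 0" "mball x r \<subseteq> U" and x: "x \<in> M"
    using assms(3,4) unfolding openin_mtopology by blast
  \<comment> \<open>One half of \<open>r\<close> pays for the step from \<open>x\<close> to the
    centre \<open>q i\<close>, the other half for the step from there to any point of the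
    ball.\<close>
  obtain n where n: "1 / Suc n < r / 2"
    using nat_approx_posE[of "r / 2"] r(1) by (metis half_gt_zero)
  have "x \<in> mtopology closure_of (range q)" using assms(2) x by simp
  then obtain i where i: "q i \<in> mball x (1 / Suc n)"
    unfolding metric_closure_of by (force simp del: of_nat_Suc)
  show thesis
  proof (rule that[of i n])
    show "x \<in> mball (q i) (1 / Suc n)" using i by (simp add: commute)
    show "mball (q i) (1 / Suc n) \<subseteq> U"
    proof
      fix y assume y: "y \<in> mball (q i) (1 / Suc n)"
      have "d x y \<le> d x (q i) + d (q i) y" using i y by (intro triangle) auto
      also have "\<dots> < r" using i y n by (auto simp del: of_nat_Suc)
      finally show "y \<in> U" using r(2) y x by auto
    qed
  qed
qed

lemma polish_imp_second_countable:
  assumes "polish_topology (T :: 'a topology)"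
  shows "second_countable T"
proof (cases "topspace T = {}")
  case True
  then show ?thesis unfolding second_countable_def
    by (intro exI[of _ "{}"]) (auto dest: openin_subset)
next
  case False
  obtain q :: "nat \<Rightarrow> 'a" where q: "range q \<subseteq> topspace T" "T closure_of (range q) = topspace T"
    by (rule polish_dense_sequence[OF assms False])
  obtain M d where Md: "Metric_space M d" "T = Metric_space.mtopology M d"
    using assms unfolding polish_topology_def completely_metrizable_space_def by auto
  interpret Metric_space M d by fact
  show ?thesis unfolding second_countable_def
  proof (intro exI[of _ "range (\<lambda>(i, n). mball (q i) (1 / Suc n))"] conjI ballI allI impI)
    fix U x assume U: "openin T U \<and> x \<in> U"
    obtain i n where "x \<in> mball (q i) (1 / Suc n)" "mball (q i) (1 / Suc n) \<subseteq> U"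
    proof (rule dense_ball_refine)
      show "range q \<subseteq> M" "mtopology closure_of range q = M" "openin mtopology U" "x \<in> U"
        using q U by (simp_all add: Md(2))
    qed
    then show "\<exists>V\<in>range (\<lambda>(i, n). mball (q i) (1 / Suc n)). x \<in> V \<and> V \<subseteq> U" by blast
  qed (use Md in auto)
qed

section \<open>Smoothing against a right Haar measure\<close>

locale Haar_action = locally_compact_group G T
  for G :: "('g, 'm) monoid_scheme" (structure) and T :: "'g topology" +
  fixes m :: "'g measure" and M :: "'a measure" and \<alpha> :: "'g \<Rightarrow> 'a \<Rightarrow> 'a"
  assumes polish: "polish_topology T"
    and sets_m: "sets m = sets (borel_of T)"
    and emeasure_right_translate:
      "\<And>h A. h \<in> carrier G \<Longrightarrow> A \<in> sets m \<Longrightarrow> emeasure m (right_translate h A) = emeasure m A"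
    and emeasure_compact: "\<And>K. compactin T K \<Longrightarrow> emeasure m K < \<infinity>"
    and emeasure_open_pos: "\<And>U. openin T U \<Longrightarrow> U \<noteq> {} \<Longrightarrow> emeasure m U > 0"
    and action: "measure_preserving_action G T M \<alpha>"
    and sigma_finite_M: "sigma_finite_measure M"
begin

sublocale act: group_action G "space M" \<alpha>
  using action by (simp add: measure_preserving_action_def)

sublocale M: sigma_finite_measure M
  by (rule sigma_finite_M)

lemma space_m [simp]: "space m = carrier G"
  using sets_eq_imp_space_eq[OF sets_m] by simp

lemma openin_sets: "openin T U \<Longrightarrow> U \<in> sets m"
  using sets_m openin_borel_of by blast

lemma compactin_sets: "compactin T K \<Longrightarrow> K \<in> sets m"
  using sets_m closedin_borel_of compactin_imp_closedin Hausdorff by blast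

lemma continuous_map_measurable_m: "continuous_map T T f \<Longrightarrow> f \<in> m \<rightarrow>\<^sub>M m"
  using continuous_map_measurable[of T T f] measurable_cong_sets[OF sets_m sets_m] by auto

lemma continuous_map_borel_measurable: "continuous_map T euclideanreal f \<Longrightarrow> f \<in> borel_measurable m"
  using continuous_map_measurable[of T euclideanreal f] measurable_cong_sets[OF sets_m refl]
  by (auto simp: borel_of_euclidean)

lemma act_closed [simp]: "g \<in> carrier G \<Longrightarrow> x \<in> space M \<Longrightarrow> \<alpha> g x \<in> space M"
  using act.element_image by blast

lemma act_mult: "g \<in> carrier G \<Longrightarrow> h \<in> carrier G \<Longrightarrow> x \<in> space M \<Longrightarrow> \<alpha> (g \<otimes> h) x = \<alpha> g (\<alpha> h x)"
  by (rule act.composition_rule)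

lemma act_one: "x \<in> space M \<Longrightarrow> \<alpha> \<one> x = x"
  by (metis act.id_eq_one restrict_apply')

lemma act_inj: "g \<in> carrier G \<Longrightarrow> x \<in> space M \<Longrightarrow> y \<in> space M \<Longrightarrow> \<alpha> g x = \<alpha> g y \<Longrightarrow> x = y"
  using act.inj_prop by (meson inj_on_eq_iff)

lemma measurable_act: "g \<in> carrier G \<Longrightarrow> \<alpha> g \<in> M \<rightarrow>\<^sub>M M"
  using action by (simp add: measure_preserving_action_def measure_preserving_bijection_def)

lemma distr_act: "g \<in> carrier G \<Longrightarrow> distr M M (\<alpha> g) = M"
  using action measurable_act
  by (intro measure_eqI) (auto simp: emeasure_distr measure_preserving_action_def measure_preserving_bijection_def)

lemma measurable_action: "(\<lambda>(g, x). \<alpha> g x) \<in> m \<Otimes>\<^sub>M M \<rightarrow>\<^sub>M M"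
  using action measurable_cong_sets[OF sets_pair_measure_cong[OF sets_m refl, of M] refl]
  by (auto simp: measure_preserving_action_def)

lemma measurable_action_fst: "x \<in> space M \<Longrightarrow> (\<lambda>g. \<alpha> g x) \<in> m \<rightarrow>\<^sub>M M"
  using measurable_compose[OF measurable_Pair2'[of x M m] measurable_action] by simp

text \<open>The preimage of \<open>A\<close> under right multiplication by \<open>h\<close> is the
  translate of \<open>A\<close> by \<open>inv h\<close>; invariance of sets thus becomes a change of
  variables for integrals.\<close>

lemma distr_right_mult:
  assumes h: "h \<in> carrier G"
  shows "distr m m (\<lambda>g. g \<otimes> h) = m"
proof (rule measure_eqI)
  have meas: "(\<lambda>g. g \<otimes> h) \<in> m \<rightarrow>\<^sub>M m"
    using h by (intro continuous_map_measurable_m continuous_mult_compose) auto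
  fix A assume "A \<in> sets (distr m m (\<lambda>g. g \<otimes> h))"
  then have A: "A \<in> sets m" by simp
  then have "A \<subseteq> carrier G" using sets.sets_into_space by force
  then have "(\<lambda>g. g \<otimes> h) -` A \<inter> space m = right_translate (inv h) A"
    using h by (auto simp: right_translate_eq)
  then show "emeasure (distr m m (\<lambda>g. g \<otimes> h)) A = emeasure m A"
    using emeasure_distr[OF meas A] emeasure_right_translate[of "inv h" A] h A by simp
qed simp

text \<open>Every point has an open neighbourhood inside a compact set, hence of finite measure, and
  by the Lindelof property countably many of these cover \<open>G\<close>.\<close>

sublocale m: sigma_finite_measure m
proof
  have "\<exists>U. openin T U \<and> x \<in> U \<and> emeasure m U \<noteq> \<infinity>" if x: "x \<in> carrier G" for x
  proof -
    obtain U K where "openin T U" "compactin T K" "x \<in> U" "U \<subseteq> K"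
      using locally_compact x unfolding locally_compact_space_def by auto
    moreover from this have "emeasure m U \<le> emeasure m K"
      by (intro emeasure_mono compactin_sets)
    ultimately show ?thesis using emeasure_compact[of K] by (auto simp: top_unique)
  qed
  then obtain U where U: "\<And>x. x \<in> carrier G \<Longrightarrow> openin T (U x) \<and> x \<in> U x \<and> emeasure m (U x) \<noteq> \<infinity>"
    by metis
  then have "\<Union>(U ` carrier G) = topspace T" using openin_subset by fastforce
  moreover have "Lindelof_space T"
    by (intro second_countable_imp_Lindelof_space polish_imp_second_countable polish)
  ultimately obtain V where "countable V" "V \<subseteq> U ` carrier G" "\<Union>V = topspace T"
    unfolding Lindelof_space_def using U by (metis (no_types, lifting) imageE)
  then show "\<exists>A. countable A \<and> A \<subseteq> sets m \<and> \<Union> A = space m \<and> (\<forall>a\<in>A. emeasure m a \<noteq> \<infinity>)"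
    using U openin_sets by (intro exI[of _ V]) auto
qed

definition test_function :: "('g \<Rightarrow> real) \<Rightarrow> bool" where
  "test_function \<psi> \<longleftrightarrow> continuous_map T euclideanreal \<psi> \<and>
     (\<exists>B. \<forall>g\<in>carrier G. \<bar>\<psi> g\<bar> \<le> B) \<and>
     (\<exists>C. compactin T C \<and> (\<forall>g\<in>carrier G. g \<notin> C \<longrightarrow> \<psi> g = 0))"

definition smoothing :: "('g \<Rightarrow> real) \<Rightarrow> ('a \<Rightarrow> real) \<Rightarrow> 'a \<Rightarrow> real" where
  "smoothing \<psi> f x = (\<integral>g. \<psi> g * f (\<alpha> g x) \<partial>m)"

definition unit_valued :: "('a \<Rightarrow> real) \<Rightarrow> bool" where
  "unit_valued f \<longleftrightarrow> f \<in> borel_measurable M \<and> (\<forall>x\<in>space M. 0 \<le> f x \<and> f x \<le> 1)"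

lemma integrable_compact_support:
  assumes "f \<in> borel_measurable m" "compactin T C" "\<And>g. g \<in> carrier G \<Longrightarrow> \<bar>f g\<bar> \<le> B"
    "\<And>g. g \<in> carrier G \<Longrightarrow> g \<notin> C \<Longrightarrow> f g = 0"
  shows "integrable m (f :: 'g \<Rightarrow> real)"
  using assms by (intro integrableI_bounded_set[of C _ _ B] compactin_sets emeasure_compact AE_I2) auto

lemma test_function_measurable: "test_function \<psi> \<Longrightarrow> \<psi> \<in> borel_measurable m"
  by (simp add: test_function_def continuous_map_borel_measurable)

lemma measurable_orbit: "unit_valued f \<Longrightarrow> x \<in> space M \<Longrightarrow> (\<lambda>g. f (\<alpha> g x)) \<in> borel_measurable m"
  using measurable_compose[OF measurable_action_fst, of x f borel] by (simp add: unit_valued_def)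

lemma integrable_test_function:
  assumes "test_function \<psi>"
  shows "integrable m \<psi>"
proof -
  obtain B C where "\<forall>g\<in>carrier G. \<bar>\<psi> g\<bar> \<le> B" "compactin T C" "\<forall>g\<in>carrier G. g \<notin> C \<longrightarrow> \<psi> g = 0"
    using assms unfolding test_function_def by blast
  then show ?thesis using test_function_measurable[OF assms] by (intro integrable_compact_support) auto
qed

lemma integrable_test_mult:
  assumes "test_function \<psi>" "a \<in> borel_measurable m" "\<And>g. g \<in> carrier G \<Longrightarrow> 0 \<le> a g \<and> a g \<le> 1"
  shows "integrable m (\<lambda>g. \<psi> g * a g)"
proof (rule Bochner_Integration.integrable_bound[OF integrable_test_function[OF assms(1)]])
  show "(\<lambda>g. \<psi> g * a g) \<in> borel_measurable m"
    using assms test_function_measurable by auto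
  show "AE g in m. norm (\<psi> g * a g) \<le> norm (\<psi> g)"
    using assms(3) by (intro AE_I2) (auto simp: abs_mult intro: mult_right_le_one_le)
qed

lemma integrable_smoothing:
  assumes "test_function \<psi>" "unit_valued f" "x \<in> space M"
  shows "integrable m (\<lambda>g. \<psi> g * f (\<alpha> g x))"
  using assms measurable_orbit by (intro integrable_test_mult) (auto simp: unit_valued_def)

lemma smoothing_bounded:
  assumes "test_function \<psi>" "unit_valued f" "x \<in> space M"
  shows "\<bar>smoothing \<psi> f x\<bar> \<le> (\<integral>g. \<bar>\<psi> g\<bar> \<partial>m)"
proof -
  have "\<bar>smoothing \<psi> f x\<bar> \<le> (\<integral>g. \<bar>\<psi> g * f (\<alpha> g x)\<bar> \<partial>m)"
    unfolding smoothing_def by (rule integral_abs_bound)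
  also have "\<dots> \<le> (\<integral>g. \<bar>\<psi> g\<bar> \<partial>m)"
    using assms integrable_test_function
    by (intro integral_mono integrable_abs integrable_smoothing)
      (auto simp: abs_mult unit_valued_def intro!: mult_right_le_one_le)
  finally show ?thesis .
qed

lemma smoothing_measurable:
  assumes "test_function \<psi>" "unit_valued f"
  shows "smoothing \<psi> f \<in> borel_measurable M"
proof -
  have [measurable]: "(\<lambda>p. \<alpha> (snd p) (fst p)) \<in> M \<Otimes>\<^sub>M m \<rightarrow>\<^sub>M M"
    using measurable_compose[OF measurable_pair_swap'[of M m] measurable_action]
    by (simp add: case_prod_unfold)
  have [measurable]: "\<psi> \<in> borel_measurable m" "f \<in> borel_measurable M"
    using assms test_function_measurable by (auto simp: unit_valued_def)
  have "(\<lambda>(x, g). \<psi> g * f (\<alpha> g x)) \<in> borel_measurable (M \<Otimes>\<^sub>M m)"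
    unfolding case_prod_unfold by measurable
  then show ?thesis unfolding smoothing_def[abs_def]
    by (rule m.borel_measurable_lebesgue_integral)
qed

text \<open>Right invariance enters here: substituting \<open>g \<otimes> h\<close> for
  \<open>g\<close> transfers the dependence on \<open>h\<close> from the merely Borel
  \<open>f\<close> to the continuous \<open>\<psi>\<close>.\<close>

lemma smoothing_act:
  assumes "test_function \<psi>" "unit_valued f" "x \<in> space M" "h \<in> carrier G"
  shows "smoothing \<psi> f (\<alpha> h x) = (\<integral>g. \<psi> (g \<otimes> inv h) * f (\<alpha> g x) \<partial>m)"
    and "integrable m (\<lambda>g. \<psi> (g \<otimes> inv h) * f (\<alpha> g x))"
proof -
  have meas: "(\<lambda>g. g \<otimes> k) \<in> m \<rightarrow>\<^sub>M m" if "k \<in> carrier G" for k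
    using that by (intro continuous_map_measurable_m continuous_mult_compose) auto
  have m2: "(\<lambda>g. \<psi> (g \<otimes> inv h) * f (\<alpha> g x)) \<in> borel_measurable m"
    using measurable_compose[OF meas[of "inv h"] test_function_measurable[OF assms(1)]]
      measurable_orbit[OF assms(2,3)] assms(4) by auto
  have eq: "\<psi> g * f (\<alpha> g (\<alpha> h x)) = \<psi> ((g \<otimes> h) \<otimes> inv h) * f (\<alpha> (g \<otimes> h) x)"
    if "g \<in> space m" for g
    using that assms by (simp add: m_assoc act_mult)
  have "smoothing \<psi> f (\<alpha> h x) = (\<integral>g. \<psi> ((g \<otimes> h) \<otimes> inv h) * f (\<alpha> (g \<otimes> h) x) \<partial>m)"
    unfolding smoothing_def by (intro Bochner_Integration.integral_cong eq refl)
  also have "\<dots> = (\<integral>g. \<psi> (g \<otimes> inv h) * f (\<alpha> g x) \<partial>distr m m (\<lambda>g. g \<otimes> h))"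
    by (rule integral_distr[symmetric, OF meas[OF assms(4)] m2])
  finally show "smoothing \<psi> f (\<alpha> h x) = (\<integral>g. \<psi> (g \<otimes> inv h) * f (\<alpha> g x) \<partial>m)"
    by (simp add: distr_right_mult[OF assms(4)])
  have "integrable m (\<lambda>g. \<psi> ((g \<otimes> h) \<otimes> inv h) * f (\<alpha> (g \<otimes> h) x))"
    by (rule Bochner_Integration.integrable_cong[THEN iffD1, OF refl eq
          integrable_smoothing[OF assms(1,2) act_closed[OF assms(4,3)]]])
  then have "integrable (distr m m (\<lambda>g. g \<otimes> h)) (\<lambda>g. \<psi> (g \<otimes> inv h) * f (\<alpha> g x))"
    using integrable_distr_eq[OF meas[OF assms(4)] m2] by simp
  then show "integrable m (\<lambda>g. \<psi> (g \<otimes> inv h) * f (\<alpha> g x))"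
    by (simp add: distr_right_mult[OF assms(4)])
qed

lemma translate_measurable:
  assumes "test_function \<psi>" "k \<in> carrier G"
  shows "(\<lambda>g. \<psi> (g \<otimes> inv k)) \<in> borel_measurable m"
proof -
  have "continuous_map T T (\<lambda>g. g \<otimes> inv k)"
    using assms(2) by (intro continuous_mult_compose) auto
  from measurable_compose[OF continuous_map_measurable_m[OF this] test_function_measurable[OF assms(1)]]
  show ?thesis .
qed

text \<open>If \<open>g h^-1\<close> lies in the support \<open>C\<close> for some \<open>h\<close>
  in \<open>N\<close>, then \<open>g\<close> lies in the compact product \<open>C N\<close>. Off
  this set all the translates vanish; on it two values bounded by \<open>B\<close> differ by at most
  \<open>2 * B\<close>. The resulting majorant is the one used for dominated convergence.\<close>

lemma translation_dominated:
  assumes \<psi>: "test_function \<psi>" and N: "compactin T N"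
  shows "\<exists>w :: 'g \<Rightarrow> real. integrable m w \<and>
    (\<forall>g\<in>carrier G. \<forall>h\<in>N. \<forall>k\<in>N. \<bar>\<psi> (g \<otimes> inv h) - \<psi> (g \<otimes> inv k)\<bar> \<le> w g)"
proof -
  obtain B C where B: "\<And>g. g \<in> carrier G \<Longrightarrow> \<bar>\<psi> g\<bar> \<le> B"
    and C: "compactin T C" "\<And>g. g \<in> carrier G \<Longrightarrow> g \<notin> C \<Longrightarrow> \<psi> g = 0"
    using \<psi> unfolding test_function_def by blast
  define D where "D = (\<lambda>(a, b). a \<otimes> b) ` (C \<times> N)"
  have D: "compactin T D" unfolding D_def
    using C(1) N by (intro image_compactin[OF _ continuous_mult]) (simp add: compactin_Times)
  have Nc: "N \<subseteq> carrier G" using N compactin_carrier by auto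
  have zero: "\<psi> (g \<otimes> inv k) = 0" if "k \<in> N" "g \<in> carrier G" "g \<notin> D" for k g
  proof (rule C(2))
    show "g \<otimes> inv k \<in> carrier G" using that Nc by auto
    show "g \<otimes> inv k \<notin> C"
    proof
      assume "g \<otimes> inv k \<in> C"
      moreover have "(g \<otimes> inv k) \<otimes> k = g" using that Nc by (simp add: m_assoc subset_iff)
      ultimately have "g \<in> D" unfolding D_def using that(1) by force
      then show False using that by simp
    qed
  qed
  show ?thesis
  proof (intro exI[of _ "\<lambda>g. 2 * B * indicator D g"] conjI ballI)
    show "integrable m (\<lambda>g. 2 * B * indicator D g)"
      using D emeasure_compact[OF D] compactin_sets[OF D] by (intro integrable_mult_right) auto
    fix g h k assume ghk: "g \<in> carrier G" "h \<in> N" "k \<in> N"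
    show "\<bar>\<psi> (g \<otimes> inv h) - \<psi> (g \<otimes> inv k)\<bar> \<le> 2 * B * indicator D g"
    proof (cases "g \<in> D")
      case True
      have "\<bar>\<psi> (g \<otimes> inv h)\<bar> \<le> B" "\<bar>\<psi> (g \<otimes> inv k)\<bar> \<le> B"
        using ghk Nc by (auto intro!: B)
      then show ?thesis using True by (auto simp: indicator_def)
    qed (use ghk zero in simp)
  qed
qed

lemma integrable_translation_diff:
  assumes \<psi>: "test_function \<psi>" and hk: "h \<in> carrier G" "k \<in> carrier G"
  shows "integrable m (\<lambda>g. \<bar>\<psi> (g \<otimes> inv h) - \<psi> (g \<otimes> inv k)\<bar>)"
proof -
  have "compactin T {h, k}" using hk by (intro finite_imp_compactin) auto
  then obtain w where w: "integrable m w"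
    "\<And>g. g \<in> carrier G \<Longrightarrow> \<bar>\<psi> (g \<otimes> inv h) - \<psi> (g \<otimes> inv k)\<bar> \<le> w g"
    using translation_dominated[OF \<psi>, of "{h, k}"] by auto
  show ?thesis
  proof (rule Bochner_Integration.integrable_bound[OF w(1)])
    show "AE g in m. norm \<bar>\<psi> (g \<otimes> inv h) - \<psi> (g \<otimes> inv k)\<bar> \<le> norm (w g)"
      using w(2) by (intro AE_I2) (force intro: order_trans)
  qed (use translate_measurable[OF \<psi>] hk in auto)
qed

text \<open>For fixed \<open>g\<close> the integrand tends to 0 by continuity of
  \<open>\<psi>\<close> and of the group operations; the compact set \<open>N\<close> supplies a
  common integrable majorant.\<close>

lemma translation_tendsto_L1:
  assumes \<psi>: "test_function \<psi>" and h: "\<And>n. h n \<in> N" and N: "compactin T N"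
    and h0: "h0 \<in> N" and lim: "limitin T h h0 sequentially"
  shows "(\<lambda>n. \<integral>g. \<bar>\<psi> (g \<otimes> inv (h n)) - \<psi> (g \<otimes> inv h0)\<bar> \<partial>m) \<longlonglongrightarrow> 0"
proof -
  obtain w where w: "integrable m w"
    "\<And>g h k. g \<in> carrier G \<Longrightarrow> h \<in> N \<Longrightarrow> k \<in> N \<Longrightarrow> \<bar>\<psi> (g \<otimes> inv h) - \<psi> (g \<otimes> inv k)\<bar> \<le> w g"
    using translation_dominated[OF \<psi> N] by auto
  have cont: "continuous_map T euclideanreal \<psi>" using \<psi> by (simp add: test_function_def)
  have hc: "h n \<in> carrier G" "h0 \<in> carrier G" for n using h h0 N compactin_carrier by auto
  have md: "(\<lambda>g. \<bar>\<psi> (g \<otimes> inv (h n)) - \<psi> (g \<otimes> inv h0)\<bar>) \<in> borel_measurable m" for n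
    using integrable_translation_diff[OF \<psi> hc] by auto
  have pw: "(\<lambda>n. \<bar>\<psi> (g \<otimes> inv (h n)) - \<psi> (g \<otimes> inv h0)\<bar>) \<longlonglongrightarrow> 0" if g: "g \<in> carrier G" for g
  proof -
    have "continuous_map T T (\<lambda>k. g \<otimes> inv k)"
      using g by (intro continuous_mult_compose continuous_inv_compose) auto
    then have "continuous_map T euclideanreal (\<lambda>k. \<psi> (g \<otimes> inv k))"
      using continuous_map_compose[OF _ cont] by (fastforce simp: o_def)
    from continuous_map_limit[OF this lim]
    have "(\<lambda>n. \<psi> (g \<otimes> inv (h n))) \<longlonglongrightarrow> \<psi> (g \<otimes> inv h0)" by (simp add: o_def)
    then show ?thesis by (simp add: LIM_zero tendsto_rabs_zero)
  qed
  have "(\<lambda>n. \<integral>g. \<bar>\<psi> (g \<otimes> inv (h n)) - \<psi> (g \<otimes> inv h0)\<bar> \<partial>m) \<longlonglongrightarrow> (\<integral>g. 0 \<partial>m)"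
    using w(2) h h0 pw by (intro integral_dominated_convergence[OF _ md w(1)] AE_I2) auto
  then show ?thesis by simp
qed

text \<open>Since \<open>0 \<le> f \<le> 1\<close>, the difference of the two smoothings is at most
  the L1 distance \<open>\<delta> h\<close> of two translates of \<open>\<psi>\<close>, in which
  \<open>x\<close> no longer occurs.\<close>

lemma smoothing_equicontinuous:
  assumes \<psi>: "test_function \<psi>" and f: "unit_valued f" and h0: "h0 \<in> carrier G" and e: "e > 0"
  shows "\<exists>W. openin T W \<and> h0 \<in> W \<and>
    (\<forall>h\<in>W. \<forall>x\<in>space M. \<bar>smoothing \<psi> f (\<alpha> h x) - smoothing \<psi> f (\<alpha> h0 x)\<bar> \<le> e)"
proof -
  obtain U N where UN: "openin T U" "compactin T N" "h0 \<in> U" "U \<subseteq> N"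
    using locally_compact h0 unfolding locally_compact_space_def by auto
  obtain X d where Md: "Metric_space X d" "T = Metric_space.mtopology X d"
    using polish unfolding polish_topology_def completely_metrizable_space_def by auto
  interpret X: Metric_space X d by fact
  have h0': "h0 \<in> X" using Md(2) topspace_eq h0 by simp
  define \<delta> where "\<delta> h = (\<integral>g. \<bar>\<psi> (g \<otimes> inv h) - \<psi> (g \<otimes> inv h0)\<bar> \<partial>m)" for h
  \<comment> \<open>Dominated convergence concerns sequences, so failure on every ball of radius
    \<open>1 / Suc n\<close> is turned into a sequence tending to \<open>h0\<close>. Intersecting
    with \<open>U\<close> keeps that sequence in the compact set \<open>N\<close>.\<close>
  have "\<exists>n. \<forall>h \<in> X.mball h0 (1 / Suc n) \<inter> U. \<delta> h \<le> e"
  proof (rule ccontr)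
    assume "\<nexists>n. \<forall>h \<in> X.mball h0 (1 / Suc n) \<inter> U. \<delta> h \<le> e"
    then obtain h where h: "\<And>n. h n \<in> X.mball h0 (1 / Suc n) \<inter> U" "\<And>n. \<delta> (h n) > e"
      by (metis not_le)
    have "limitin T h h0 sequentially"
      unfolding Md(2) X.limitin_metric
    proof (intro conjI allI impI)
      show "h0 \<in> X" by (rule h0')
      fix \<epsilon> :: real assume "0 < \<epsilon>"
      then obtain n0 where n0: "1 / Suc n0 < \<epsilon>" using nat_approx_posE by blast
      show "\<forall>\<^sub>F n in sequentially. h n \<in> X \<and> d (h n) h0 < \<epsilon>"
        unfolding eventually_sequentially
      proof (intro exI allI impI)
        fix n assume "n0 \<le> n"
        then have "1 / real (Suc n) \<le> 1 / Suc n0" by (intro divide_left_mono) auto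
        then show "h n \<in> X \<and> d (h n) h0 < \<epsilon>"
          using h(1)[of n] n0 by (auto simp: X.commute simp del: of_nat_Suc)
      qed
    qed
    then have "(\<lambda>n. \<delta> (h n)) \<longlonglongrightarrow> 0"
      unfolding \<delta>_def using h(1) UN by (intro translation_tendsto_L1[OF \<psi>, of _ N]) auto
    then have "\<forall>\<^sub>F n in sequentially. \<delta> (h n) < e" using e by (rule order_tendstoD)
    then show False using h(2) by (auto simp: eventually_sequentially dest: less_asym)
  qed
  then obtain n where n: "\<And>h. h \<in> X.mball h0 (1 / Suc n) \<inter> U \<Longrightarrow> \<delta> h \<le> e" by blast
  show ?thesis
  proof (intro exI[of _ "X.mball h0 (1 / Suc n) \<inter> U"] conjI ballI)
    show "openin T (X.mball h0 (1 / Suc n) \<inter> U)" using Md UN by auto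
    show "h0 \<in> X.mball h0 (1 / Suc n) \<inter> U" using h0' UN by simp
    fix h x assume h: "h \<in> X.mball h0 (1 / Suc n) \<inter> U" and x: "x \<in> space M"
    have hc: "h \<in> carrier G" using h UN openin_carrier by auto
    have i: "integrable m (\<lambda>g. \<bar>\<psi> (g \<otimes> inv h) - \<psi> (g \<otimes> inv h0)\<bar>)"
      by (rule integrable_translation_diff[OF \<psi> hc h0])
    have "\<bar>smoothing \<psi> f (\<alpha> h x) - smoothing \<psi> f (\<alpha> h0 x)\<bar>
        = \<bar>\<integral>g. \<psi> (g \<otimes> inv h) * f (\<alpha> g x) - \<psi> (g \<otimes> inv h0) * f (\<alpha> g x) \<partial>m\<bar>"
      using smoothing_act[OF \<psi> f x hc] smoothing_act[OF \<psi> f x h0] by simp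
    also have "\<dots> \<le> (\<integral>g. \<bar>\<psi> (g \<otimes> inv h) * f (\<alpha> g x) - \<psi> (g \<otimes> inv h0) * f (\<alpha> g x)\<bar> \<partial>m)"
      by (rule integral_abs_bound)
    also have "\<dots> \<le> \<delta> h" unfolding \<delta>_def
    proof (rule integral_mono)
      show "integrable m (\<lambda>g. \<bar>\<psi> (g \<otimes> inv h) * f (\<alpha> g x) - \<psi> (g \<otimes> inv h0) * f (\<alpha> g x)\<bar>)"
        using smoothing_act(2)[OF \<psi> f x hc] smoothing_act(2)[OF \<psi> f x h0] by auto
      fix g assume "g \<in> space m"
      then have "0 \<le> f (\<alpha> g x)" "f (\<alpha> g x) \<le> 1" using f x by (auto simp: unit_valued_def)
      then show "\<bar>\<psi> (g \<otimes> inv h) * f (\<alpha> g x) - \<psi> (g \<otimes> inv h0) * f (\<alpha> g x)\<bar>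
         \<le> \<bar>\<psi> (g \<otimes> inv h) - \<psi> (g \<otimes> inv h0)\<bar>"
        by (auto simp: abs_mult intro!: mult_right_le_one_le simp flip: left_diff_distrib)
    qed (rule i)
    also have "\<dots> \<le> e" by (rule n[OF h])
    finally show "\<bar>smoothing \<psi> f (\<alpha> h x) - smoothing \<psi> f (\<alpha> h0 x)\<bar> \<le> e" .
  qed
qed

end

section \<open>Countably many test functions that separate points\<close>

context Haar_action
begin

text \<open>
  The test functions are a fixed bump at the identity times finite products of bumps supported in
  balls; the latter converge to the indicators of finite intersections of balls, which form an
  intersection-stable generator of the Borel sets.
\<close>

lemma ex_separating_test_functions:
  obtains \<Psi> :: "nat \<Rightarrow> 'g \<Rightarrow> real" and P where
    "\<forall>n. test_function (\<Psi> n)" "\<forall>n. \<forall>g\<in>carrier G. 0 \<le> \<Psi> n g"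
    "openin T P" "P \<noteq> {}" "\<forall>g\<in>P. 0 < \<Psi> 0 g"
    "\<forall>a b. a \<in> borel_measurable m \<longrightarrow> b \<in> borel_measurable m \<longrightarrow>
        (\<forall>g\<in>carrier G. 0 \<le> a g \<and> a g \<le> 1) \<longrightarrow> (\<forall>g\<in>carrier G. 0 \<le> b g \<and> b g \<le> 1) \<longrightarrow>
        (\<forall>n. (\<integral>g. \<Psi> n g * a g \<partial>m) = (\<integral>g. \<Psi> n g * b g \<partial>m)) \<longrightarrow>
        (AE g in m. \<Psi> 0 g * a g = \<Psi> 0 g * b g)"
proof -
  obtain X d where Md: "Metric_space X d" "T = Metric_space.mtopology X d"
    using polish unfolding polish_topology_def completely_metrizable_space_def by auto
  interpret X: Metric_space X d by fact
  have X: "carrier G = X" using Md(2) topspace_eq by simp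
  have "topspace T \<noteq> {}" by auto
  then obtain q :: "nat \<Rightarrow> 'g" where q: "range q \<subseteq> topspace T" "T closure_of (range q) = topspace T"
    by (rule polish_dense_sequence[OF polish])
  have qX: "q i \<in> X" for i using q(1) X by auto
  have oneX: "\<one> \<in> X" using X one_closed by simp
  obtain C V where C: "compactin T C" "unit_nhd V" "V \<subseteq> C"
    by (rule ex_compact_unit_nhd)
  have "openin X.mtopology V" "\<one> \<in> V" 
    using C(2) unfolding unit_nhd_def Md(2)[symmetric] by simp_all
  then have "\<exists>r>0. X.mball \<one> r \<subseteq> V" by (simp add: X.openin_mtopology)
  then obtain r where r: "r > 0" "X.mball \<one> r \<subseteq> V" by auto
  \<comment> \<open>On \<open>G\<close> this tent is positive exactly on the ball of radius
    \<open>r\<close> about the identity, which lies in the compact set \<open>C\<close>; all test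
    functions take their support from it.\<close>
  define \<phi> where "\<phi> g = max 0 (r - d \<one> g)" for g
  define ball where "ball p = X.mball (q (fst p)) (1 / Suc (snd p))" for p :: "nat \<times> nat"
  \<comment> \<open>As \<open>k\<close> grows this tends to the indicator of \<open>ball p\<close>:
    inside the ball the factor \<open>k\<close> lifts a positive margin up to the cap 1, outside the
    margin is 0.\<close>
  define bump where "bump k p g = min 1 (real k * max 0 (1 / Suc (snd p) - d (q (fst p)) g))"
    for k :: nat and p :: "nat \<times> nat" and g
  \<comment> \<open>Indexing by lists makes the boxes below stable under intersection, by appending,
    and makes the box of the empty list the whole group.\<close>
  define cut where "cut l k g = prod_list (map (\<lambda>p. bump k p g) l)" for l k g
  define box where "box l = {g \<in> carrier G. \<forall>p\<in>set l. g \<in> ball p}" for l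
  have dcont: "continuous_map T euclideanreal (d x)" if "x \<in> X" for x
  proof -
    have "continuous_map T euclidean (\<lambda>g. mdist (metric (X, d)) x g)"
      unfolding Md(2) using that by (intro continuous_map_mdist) (auto simp: X.mtopology_of)
    then show ?thesis by simp
  qed
  have bump01: "0 \<le> bump k p g" "bump k p g \<le> 1" for k p g by (auto simp: bump_def)
  have cut01: "0 \<le> cut l k g \<and> cut l k g \<le> 1" for l k g
  proof (induction l)
    case (Cons p l)
    then have "bump k p g * cut l k g \<le> 1" "0 \<le> bump k p g * cut l k g"
      using bump01[of k p g] by (auto intro!: mult_le_one)
    then show ?case by (simp add: cut_def)
  qed (simp add: cut_def)
  have cutcont: "continuous_map T euclideanreal (cut l k)" for l k
  proof (induction l)
    case Nil
    then show ?case by (simp add: cut_def[abs_def])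
  next
    case (Cons p l)
    have "continuous_map T euclideanreal (bump k p)"
      unfolding bump_def[abs_def]
      by (intro continuous_map_real_min continuous_map_real_mult continuous_map_real_max
          continuous_map_diff dcont qX) auto
    with Cons show ?case
      unfolding cut_def[abs_def] by (auto intro: continuous_map_real_mult)
  qed
  have bumplim: "(\<lambda>k. bump k p g) \<longlonglongrightarrow> indicator (ball p) g" if g: "g \<in> carrier G" for p g
  proof (cases "g \<in> ball p")
    case True
    define \<epsilon> where "\<epsilon> = 1 / Suc (snd p) - d (q (fst p)) g"
    have \<epsilon>: "\<epsilon> > 0" using True by (simp add: \<epsilon>_def ball_def)
    obtain k0 where k0: "real k0 * \<epsilon> > 1" using \<epsilon> reals_Archimedean3 by blast
    have "bump k p g = 1" if "k \<ge> k0" for k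
    proof -
      have "real k0 * \<epsilon> \<le> real k * \<epsilon>" using that \<epsilon> by (intro mult_right_mono) auto
      with k0 have "1 \<le> real k * max 0 \<epsilon>" using \<epsilon> by linarith
      then show ?thesis unfolding bump_def \<epsilon>_def[symmetric] by linarith
    qed
    then have "\<forall>\<^sub>F k in sequentially. bump k p g = 1" by (auto simp: eventually_sequentially)
    then show ?thesis using True by (simp add: tendsto_eventually)
  next
    case False
    then have "bump k p g = 0" for k
      using g X qX by (simp add: bump_def ball_def)
    then show ?thesis using False by simp
  qed
  have cutlim: "(\<lambda>k. cut l k g) \<longlonglongrightarrow> indicator (box l) g" if g: "g \<in> carrier G" for l g
  proof (induction l)
    case Nil
    then show ?case using g by (simp add: cut_def box_def)
  next
    case (Cons p l)
    have "(\<lambda>k. bump k p g * cut l k g) \<longlonglongrightarrow> indicator (ball p) g * indicator (box l) g"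
      using bumplim[OF g] Cons by (rule tendsto_mult)
    moreover have "indicator (ball p) g * indicator (box l) g = (indicator (box (p # l)) g :: real)"
      using g by (auto simp: indicator_def box_def)
    ultimately show ?case by (simp add: cut_def)
  qed
  have phi0: "0 \<le> \<phi> g" for g by (simp add: \<phi>_def)
  have phi_r: "\<phi> g \<le> r" for g using r by (simp add: \<phi>_def)
  have phicont: "continuous_map T euclideanreal \<phi>"
    unfolding \<phi>_def[abs_def] by (intro continuous_map_real_max continuous_map_diff dcont oneX) auto
  have phisupp: "\<phi> g = 0" if "g \<in> carrier G" "g \<notin> C" for g
  proof -
    have "g \<notin> X.mball \<one> r" using that r C by auto
    then show ?thesis using that X oneX by (simp add: \<phi>_def)
  qed
  have test: "test_function (\<lambda>g. \<phi> g * cut l k g)" for l k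
    unfolding test_function_def
  proof (intro conjI exI ballI impI)
    show "continuous_map T euclideanreal (\<lambda>g. \<phi> g * cut l k g)"
      by (intro continuous_map_real_mult phicont cutcont)
    show "\<bar>\<phi> g * cut l k g\<bar> \<le> r" for g
      using phi0[of g] phi_r[of g] cut01[of l k g]
      by (simp add: abs_mult mult_left_le order_trans[OF mult_left_le])
    show "compactin T C" by (rule C(1))
    show "\<phi> g * cut l k g = 0" if "g \<in> carrier G" "g \<notin> C" for g
      using phisupp that by simp
  qed
  have cutNil: "cut [] k g = 1" for k g by (simp add: cut_def)
  have testphi: "test_function \<phi>" using test[of "[]" 0] by (simp add: cutNil)
  have ballopen: "openin T (ball p)" for p unfolding Md(2) by (simp add: ball_def)
  have boxopen: "openin T (box l)" for l
  proof (induction l)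
    case Nil
    then show ?case by (simp add: box_def flip: topspace_eq)
  next
    case (Cons p l)
    have "box (p # l) = ball p \<inter> box l" by (auto simp: box_def)
    then show ?case using openin_Int[OF ballopen Cons] by simp
  qed
  have gen: "sets m = sigma_sets (carrier G) (range box)"
  proof -
    have "\<exists>W\<in>range box. x \<in> W \<and> W \<subseteq> U" if U: "openin T U" "x \<in> U" for U x
    proof -
      obtain i n where "x \<in> X.mball (q i) (1 / Suc n)" "X.mball (q i) (1 / Suc n) \<subseteq> U"
      proof (rule X.dense_ball_refine)
        show "range q \<subseteq> X" "X.mtopology closure_of range q = X" "openin X.mtopology U" "x \<in> U"
          using q U unfolding Md(2)[symmetric] by (simp_all flip: X)
      qed
      moreover have "box [(i, n)] = X.mball (q i) (1 / Suc n)"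
        unfolding box_def ball_def X by auto
      ultimately have "x \<in> box [(i, n)]" "box [(i, n)] \<subseteq> U" by simp_all
      then show ?thesis by blast
    qed
    then have "sets (borel_of T) = sigma_sets (topspace T) (range box)"
      using boxopen by (intro sigma_sets_eq_borel_of) auto
    then show ?thesis using sets_m by simp
  qed
  have stable: "Int_stable (range box)"
  proof (rule Int_stableI)
    fix A B assume "A \<in> range box" "B \<in> range box"
    then obtain l l' where "A = box l" "B = box l'" by auto
    then have "A \<inter> B = box (l @ l')" by (auto simp: box_def)
    then show "A \<inter> B \<in> range box" by simp
  qed
  have separate: "AE g in m. \<phi> g * a g = \<phi> g * b g"
    if a: "a \<in> borel_measurable m" "\<And>g. g \<in> carrier G \<Longrightarrow> 0 \<le> a g \<and> a g \<le> 1"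
      and b: "b \<in> borel_measurable m" "\<And>g. g \<in> carrier G \<Longrightarrow> 0 \<le> b g \<and> b g \<le> 1"
      and eq: "\<And>l k. (\<integral>g. (\<phi> g * cut l k g) * a g \<partial>m) = (\<integral>g. (\<phi> g * cut l k g) * b g \<partial>m)"
    for a b :: "'g \<Rightarrow> real"
  proof -
    have lim: "(\<lambda>k. \<integral>g. (\<phi> g * cut l k g) * c g \<partial>m) \<longlonglongrightarrow> (\<integral>g. (\<phi> g * indicator (box l) g) * c g \<partial>m)"
      if c: "c \<in> borel_measurable m" "\<And>g. g \<in> carrier G \<Longrightarrow> 0 \<le> c g \<and> c g \<le> 1" for c :: "'g \<Rightarrow> real" and l
    proof (rule integral_dominated_convergence[OF _ _ integrable_test_function[OF testphi]])
      have [measurable]: "box l \<in> sets m" using boxopen openin_sets by blast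
      have [measurable]: "\<phi> \<in> borel_measurable m" by (rule test_function_measurable[OF testphi])
      note c(1)[measurable]
      show "(\<lambda>g. (\<phi> g * indicator (box l) g) * c g) \<in> borel_measurable m" by measurable
      show "(\<lambda>g. (\<phi> g * cut l k g) * c g) \<in> borel_measurable m" for k
        using integrable_test_mult[OF test c] by (rule borel_measurable_integrable)
      show "AE g in m. (\<lambda>k. (\<phi> g * cut l k g) * c g) \<longlonglongrightarrow> (\<phi> g * indicator (box l) g) * c g"
        by (intro AE_I2 tendsto_mult tendsto_const cutlim) simp
      show "AE g in m. norm ((\<phi> g * cut l k g) * c g) \<le> \<phi> g" for k
      proof (rule AE_I2)
        fix g assume "g \<in> space m"
        then have cg: "0 \<le> c g" "c g \<le> 1" using c by auto
        have "(\<phi> g * cut l k g) * c g \<le> \<phi> g * cut l k g"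
          using cg phi0 cut01 by (intro mult_left_le) auto
        also have "\<dots> \<le> \<phi> g" using phi0 cut01 by (intro mult_left_le) auto
        finally show "norm ((\<phi> g * cut l k g) * c g) \<le> \<phi> g"
          using cg phi0[of g] cut01[of l k g] by (simp add: abs_mult)
      qed
    qed
    have eqbox: "(\<integral>g. (\<phi> g * indicator (box l) g) * a g \<partial>m) = (\<integral>g. (\<phi> g * indicator (box l) g) * b g \<partial>m)" for l
      using LIMSEQ_unique[OF lim[OF a]] lim[OF b] eq by simp
    \<comment> \<open>For \<open>a\<close> and \<open>b\<close> these are finite measures that agree
      on the boxes, an intersection-stable generator; hence they coincide, and their densities agree
      almost everywhere.\<close>
    define D where "D c = density m (\<lambda>g. ennreal (\<phi> g * c g))" for c
    have emD: "emeasure (D c) (box l) = ennreal (\<integral>g. (\<phi> g * indicator (box l) g) * c g \<partial>m)"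
      if c: "c \<in> borel_measurable m" "\<And>g. g \<in> carrier G \<Longrightarrow> 0 \<le> c g \<and> c g \<le> 1" for c l
    proof -
      have [measurable]: "box l \<in> sets m" using boxopen openin_sets by blast
      have int: "integrable m (\<lambda>g. \<phi> g * c g)" by (rule integrable_test_mult[OF testphi c])
      have "emeasure (D c) (box l) = (\<integral>\<^sup>+g. ennreal (\<phi> g * c g) * indicator (box l) g \<partial>m)"
        unfolding D_def using int by (intro emeasure_density) auto
      also have "\<dots> = (\<integral>\<^sup>+g. ennreal (indicator (box l) g *\<^sub>R (\<phi> g * c g)) \<partial>m)"
        by (intro nn_integral_cong) (auto simp: indicator_def)
      also have "\<dots> = ennreal (\<integral>g. indicator (box l) g *\<^sub>R (\<phi> g * c g) \<partial>m)"
        using c phi0 by (intro nn_integral_eq_integral integrable_mult_indicator int AE_I2) auto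
      also have "(\<integral>g. indicator (box l) g *\<^sub>R (\<phi> g * c g) \<partial>m) = (\<integral>g. (\<phi> g * indicator (box l) g) * c g \<partial>m)"
        by (intro Bochner_Integration.integral_cong) auto
      finally show ?thesis .
    qed
    have DD: "D a = D b"
    proof (rule measure_eqI_generator_eq[OF stable, where A = "\<lambda>_. box []" and \<Omega> = "carrier G"])
      show "range box \<subseteq> Pow (carrier G)" by (auto simp: box_def)
      show "emeasure (D a) Y = emeasure (D b) Y" if "Y \<in> range box" for Y
        using that emD[OF a] emD[OF b] eqbox by auto
      show "sets (D a) = sigma_sets (carrier G) (range box)" "sets (D b) = sigma_sets (carrier G) (range box)"
        using gen by (simp_all add: D_def)
      show "(\<Union>i. box []) = carrier G" by (auto simp: box_def)
      show "emeasure (D a) (box []) \<noteq> \<infinity>" by (simp add: emD[OF a])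
    qed auto
    have inta: "integrable m (\<lambda>g. \<phi> g * a g)" and intb: "integrable m (\<lambda>g. \<phi> g * b g)"
      using integrable_test_mult[OF testphi a] integrable_test_mult[OF testphi b] by auto
    have "AE g in m. ennreal (\<phi> g * a g) = ennreal (\<phi> g * b g)"
    proof (subst finite_density_unique[symmetric])
      have "(\<integral>\<^sup>+g. ennreal (\<phi> g * a g) \<partial>m) = ennreal (\<integral>g. \<phi> g * a g \<partial>m)"
        using a phi0 by (intro nn_integral_eq_integral inta AE_I2) auto
      then show "(\<integral>\<^sup>+g. ennreal (\<phi> g * a g) \<partial>m) \<noteq> \<infinity>" by simp
      show "density m (\<lambda>g. ennreal (\<phi> g * a g)) = density m (\<lambda>g. ennreal (\<phi> g * b g))"
        using DD by (simp add: D_def)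
    qed (use inta intb in auto)
    then show ?thesis
    proof (rule AE_mp[OF _ AE_I2], intro impI)
      fix g assume "g \<in> space m" and e: "ennreal (\<phi> g * a g) = ennreal (\<phi> g * b g)"
      then have "0 \<le> \<phi> g * a g" "0 \<le> \<phi> g * b g" using a b phi0 by auto
      then show "\<phi> g * a g = \<phi> g * b g" using e by simp
    qed
  qed
  \<comment> \<open>Index 0 is reserved for the bare \<open>\<phi>\<close>, whose strict positivity
    near the identity is part of the conclusion; the positive indices enumerate all pairs of a list
    and a \<open>k\<close>.\<close>
  define \<Psi> where "\<Psi> n = (case n of 0 \<Rightarrow> \<phi> | Suc j \<Rightarrow> (\<lambda>(l, k) g. \<phi> g * cut l k g) (from_nat j))"
    for n
  show thesis
  proof (rule that[of \<Psi> "X.mball \<one> r"]; (intro allI impI ballI)?)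
    show "test_function (\<Psi> n)" for n
      using test testphi by (cases n) (simp_all add: \<Psi>_def split: prod.split)
    show "0 \<le> \<Psi> n g" for n g
      using phi0 cut01 by (cases n) (simp_all add: \<Psi>_def split: prod.split)
    show "openin T (X.mball \<one> r)" unfolding Md(2) by simp
    show "X.mball \<one> r \<noteq> {}" using r oneX by (auto simp: X.mball_eq_empty)
    show "0 < \<Psi> 0 g" if "g \<in> X.mball \<one> r" for g
      using that by (simp add: \<Psi>_def \<phi>_def)
    fix a b :: "'g \<Rightarrow> real"
    assume ab: "a \<in> borel_measurable m" "b \<in> borel_measurable m"
      "\<forall>g\<in>carrier G. 0 \<le> a g \<and> a g \<le> 1" "\<forall>g\<in>carrier G. 0 \<le> b g \<and> b g \<le> 1"
      and eq: "\<forall>n. (\<integral>g. \<Psi> n g * a g \<partial>m) = (\<integral>g. \<Psi> n g * b g \<partial>m)"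
    have "(\<integral>g. (\<phi> g * cut l k g) * a g \<partial>m) = (\<integral>g. (\<phi> g * cut l k g) * b g \<partial>m)" for l k
      using eq[rule_format, of "Suc (to_nat (l, k))"] by (simp add: \<Psi>_def)
    then show "AE g in m. \<Psi> 0 g * a g = \<Psi> 0 g * b g"
      using separate[of a b] ab by (simp add: \<Psi>_def)
  qed
qed

end

text \<open>A countable base of the underlying Polish topology separates points because that
  topology is Hausdorff.\<close>

lemma standard_borel_separating_sequence:
  assumes "standard_borel_space M"
  obtains A :: "nat \<Rightarrow> 'a set" where "\<forall>n. A n \<in> sets M"
    "\<forall>x\<in>space M. \<forall>y\<in>space M. (\<forall>n. x \<in> A n \<longleftrightarrow> y \<in> A n) \<longrightarrow> x = y"
proof -
  obtain S where S: "polish_topology S" "sets M = sets (borel_of S)"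
    using assms unfolding standard_borel_space_def by auto
  have sp: "space M = topspace S" using sets_eq_imp_space_eq[OF S(2)] by simp
  obtain \<B> where B: "countable \<B>" "\<And>V. V \<in> \<B> \<Longrightarrow> openin S V"
    "\<And>U x. openin S U \<Longrightarrow> x \<in> U \<Longrightarrow> \<exists>V\<in>\<B>. x \<in> V \<and> V \<subseteq> U"
    using polish_imp_second_countable[OF S(1)] unfolding second_countable_def by auto
  have haus: "Hausdorff_space S"
    using S(1) by (simp add: polish_topology_def completely_metrizable_imp_metrizable_space
        metrizable_imp_Hausdorff_space)
  \<comment> \<open>Inserting the empty set ensures that there is something to enumerate even when
    the base is empty.\<close>
  define A where "A = from_nat_into (insert {} \<B>)"
  have range: "range A = insert {} \<B>" unfolding A_def using B(1) by (intro range_from_nat_into) auto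
  show thesis
  proof (rule that[of A]; intro allI ballI impI)
    fix n
    have "A n \<in> insert {} \<B>" using range by auto
    then show "A n \<in> sets M" using B(2) S(2) openin_borel_of by auto
  next
    fix x y assume xy: "x \<in> space M" "y \<in> space M" and same: "\<forall>n. x \<in> A n \<longleftrightarrow> y \<in> A n"
    show "x = y"
    proof (rule ccontr)
      assume "x \<noteq> y"
      then obtain U V where UV: "openin S U" "openin S V" "x \<in> U" "y \<in> V" "disjnt U V"
        using haus xy sp unfolding Hausdorff_space_def by metis
      obtain W where W: "W \<in> \<B>" "x \<in> W" "W \<subseteq> U" using B(3) UV(1,3) by metis
      then obtain n where "W = A n" using range by (metis imageE insertI2)
      then have "y \<in> U" using same W by auto
      then show False using UV by (auto simp: disjnt_def)
    qed
  qed
qed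

context Haar_action
begin

lemma unit_valued_indicator: "A \<in> sets M \<Longrightarrow> unit_valued (indicator A)"
  by (auto simp: unit_valued_def indicator_def)

text \<open>Nonempty open sets have positive Haar measure and so are not contained in an exceptional
  null set. This extracts a single group element from an almost-everywhere statement.\<close>

lemma AE_nonzero_open:
  assumes "AE g in m. Q g" "openin T P" "P \<noteq> {}"
  obtains g where "g \<in> P" "Q g"
proof (rule ccontr)
  assume "\<not> thesis"
  then have "AE g in m. g \<notin> P" using assms(1) that by (auto elim!: eventually_mono)
  then have "emeasure m P = 0"
    using openin_sets[OF assms(2)] openin_carrier[OF assms(2)] by (subst (asm) AE_iff_measurable[of P]) auto
  then show False using emeasure_open_pos[OF assms(2,3)] by simp
qed

text \<open>A vanishing integral would force the nonnegative integrand to be zero almost everywhere,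
  yet it is strictly positive throughout the nonempty open set \<open>P\<close>.\<close>

lemma smoothing_pos:
  assumes "test_function \<psi>" "\<And>g. g \<in> carrier G \<Longrightarrow> 0 \<le> \<psi> g"
    and "openin T P" "P \<noteq> {}" "\<And>g. g \<in> P \<Longrightarrow> 0 < \<psi> g"
    and w: "unit_valued w" "\<And>x. x \<in> space M \<Longrightarrow> 0 < w x" and x: "x \<in> space M"
  shows "0 < smoothing \<psi> w x"
proof (rule ccontr)
  have nn: "AE g in m. 0 \<le> \<psi> g * w (\<alpha> g x)"
    using assms(2) w x by (intro AE_I2) (auto simp: unit_valued_def)
  have int: "integrable m (\<lambda>g. \<psi> g * w (\<alpha> g x))"
    using integrable_smoothing assms(1) w(1) x by blast
  assume "\<not> 0 < smoothing \<psi> w x"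
  moreover have "0 \<le> smoothing \<psi> w x"
    unfolding smoothing_def using nn by (rule integral_nonneg_AE)
  ultimately have "(\<integral>g. \<psi> g * w (\<alpha> g x) \<partial>m) = 0" by (simp add: smoothing_def)
  then have "AE g in m. \<psi> g * w (\<alpha> g x) = 0"
    using integral_nonneg_eq_0_iff_AE[OF int nn] by simp
  then obtain g where g: "g \<in> P" "\<psi> g * w (\<alpha> g x) = 0"
    using AE_nonzero_open assms(3,4) by blast
  then have "g \<in> carrier G" using assms(3) openin_carrier by auto
  then have "0 < w (\<alpha> g x)" using w(2) x by simp
  then show False using g assms(5)[OF g(1)] by simp
qed

text \<open>After exchanging the integrals by Tonelli, the inner integral of
  \<open>w (\<alpha> g x)\<close> over \<open>x\<close> does not depend on \<open>g\<close>, because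
  \<open>\<alpha> g\<close> preserves \<open>M\<close>. The result is the product of the integrals
  of \<open>\<psi>\<close> and \<open>w\<close>.\<close>

lemma nn_integral_smoothing_finite:
  assumes \<psi>: "test_function \<psi>" "\<And>g. g \<in> carrier G \<Longrightarrow> 0 \<le> \<psi> g"
    and w: "unit_valued w" "(\<integral>\<^sup>+x. ennreal (w x) \<partial>M) < \<infinity>"
  shows "(\<integral>\<^sup>+x. ennreal (smoothing \<psi> w x) \<partial>M) < \<infinity>"
proof -
  interpret P: pair_sigma_finite M m
    by (intro pair_sigma_finite.intro M.sigma_finite_measure_axioms m.sigma_finite_measure_axioms)
  have [measurable]: "\<psi> \<in> borel_measurable m" "w \<in> borel_measurable M"
    using test_function_measurable \<psi> w by (auto simp: unit_valued_def)
  have [measurable]: "(\<lambda>p. \<alpha> (snd p) (fst p)) \<in> M \<Otimes>\<^sub>M m \<rightarrow>\<^sub>M M"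
    using measurable_compose[OF measurable_pair_swap'[of M m] measurable_action]
    by (simp add: case_prod_unfold)
  have "(\<integral>\<^sup>+x. ennreal (smoothing \<psi> w x) \<partial>M) = (\<integral>\<^sup>+x. (\<integral>\<^sup>+g. ennreal (\<psi> g * w (\<alpha> g x)) \<partial>m) \<partial>M)"
  proof (rule nn_integral_cong)
    fix x assume x: "x \<in> space M"
    show "ennreal (smoothing \<psi> w x) = (\<integral>\<^sup>+g. ennreal (\<psi> g * w (\<alpha> g x)) \<partial>m)"
      unfolding smoothing_def using x \<psi>(2) w(1)
      by (intro nn_integral_eq_integral[symmetric] integrable_smoothing[OF \<psi>(1) w(1)] AE_I2)
        (auto simp: unit_valued_def)
  qed
  also have "\<dots> = (\<integral>\<^sup>+g. (\<integral>\<^sup>+x. ennreal (\<psi> g * w (\<alpha> g x)) \<partial>M) \<partial>m)"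
  proof (rule P.Fubini'[symmetric])
    show "(\<lambda>(x, g). ennreal (\<psi> g * w (\<alpha> g x))) \<in> borel_measurable (M \<Otimes>\<^sub>M m)"
      unfolding case_prod_unfold by measurable
  qed
  also have "\<dots> = (\<integral>\<^sup>+g. ennreal (\<psi> g) * (\<integral>\<^sup>+x. ennreal (w x) \<partial>M) \<partial>m)"
  proof (rule nn_integral_cong)
    fix g assume "g \<in> space m"
    then have g: "g \<in> carrier G" by simp
    note measurable_act[OF g, measurable]
    have "(\<integral>\<^sup>+x. ennreal (\<psi> g * w (\<alpha> g x)) \<partial>M) = (\<integral>\<^sup>+x. ennreal (\<psi> g) * ennreal (w (\<alpha> g x)) \<partial>M)"
      using \<psi>(2)[OF g] by (intro nn_integral_cong) (simp add: ennreal_mult')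
    also have "\<dots> = ennreal (\<psi> g) * (\<integral>\<^sup>+x. ennreal (w (\<alpha> g x)) \<partial>M)"
      by (rule nn_integral_cmult) measurable
    also have "(\<integral>\<^sup>+x. ennreal (w (\<alpha> g x)) \<partial>M) = (\<integral>\<^sup>+x. ennreal (w x) \<partial>distr M M (\<alpha> g))"
      by (rule nn_integral_distr[symmetric]) measurable
    finally show "(\<integral>\<^sup>+x. ennreal (\<psi> g * w (\<alpha> g x)) \<partial>M) = ennreal (\<psi> g) * (\<integral>\<^sup>+x. ennreal (w x) \<partial>M)"
      by (simp add: distr_act[OF g])
  qed
  also have "\<dots> = (\<integral>\<^sup>+g. ennreal (\<psi> g) \<partial>m) * (\<integral>\<^sup>+x. ennreal (w x) \<partial>M)"
    by (rule nn_integral_multc) measurable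
  also have "\<dots> < \<infinity>"
  proof -
    have "(\<integral>\<^sup>+g. ennreal (\<psi> g) \<partial>m) = ennreal (\<integral>g. \<psi> g \<partial>m)"
      using \<psi> by (intro nn_integral_eq_integral integrable_test_function AE_I2) auto
    then show ?thesis using w(2) by (simp add: ennreal_mult_less_top)
  qed
  finally show ?thesis .
qed

lemma ex_positive_integrable:
  obtains w where "unit_valued w" "\<forall>x\<in>space M. 0 < w x" "(\<integral>\<^sup>+x. ennreal (w x) \<partial>M) < \<infinity>"
proof -
  obtain h where h: "h \<in> borel_measurable M" "integral\<^sup>N M h \<noteq> \<infinity>"
    "\<And>x. x \<in> space M \<Longrightarrow> 0 < h x \<and> h x < \<infinity>"
    using M.Ex_finite_integrable_function by auto
  \<comment> \<open>Truncation at 1 makes the function \<open>unit_valued\<close>; it preserves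
    positivity and can only decrease the integral.\<close>
  define w where "w x = min 1 (enn2real (h x))" for x
  show thesis
  proof (rule that[of w])
    show "unit_valued w" using h(1) by (auto simp: unit_valued_def w_def[abs_def])
    show "\<forall>x\<in>space M. 0 < w x"
      using h(3) by (simp add: w_def enn2real_positive_iff)
    have "(\<integral>\<^sup>+x. ennreal (w x) \<partial>M) \<le> integral\<^sup>N M h"
    proof (rule nn_integral_mono)
      fix x assume "x \<in> space M"
      then have "ennreal (enn2real (h x)) = h x" using h(3)[of x] by simp
      moreover have "ennreal (w x) \<le> ennreal (enn2real (h x))" by (simp add: w_def ennreal_leI)
      ultimately show "ennreal (w x) \<le> h x" by simp
    qed
    then show "(\<integral>\<^sup>+x. ennreal (w x) \<partial>M) < \<infinity>" using h(2) by (simp add: top.not_eq_extremum order_le_less_trans)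
  qed
qed

lemma ex_equicontinuous_family:
  assumes "standard_borel_space M"
  shows "\<exists>F :: nat \<Rightarrow> 'a \<Rightarrow> real.
    (\<forall>n. F n \<in> borel_measurable M) \<and>
    (\<forall>n. \<exists>B. \<forall>x\<in>space M. \<bar>F n x\<bar> \<le> B) \<and>
    (\<forall>n. \<forall>h0\<in>carrier G. \<forall>e>0. \<exists>W. openin T W \<and> h0 \<in> W \<and>
        (\<forall>h\<in>W. \<forall>x\<in>space M. \<bar>F n (\<alpha> h x) - F n (\<alpha> h0 x)\<bar> \<le> e)) \<and>
    (\<forall>x\<in>space M. \<forall>y\<in>space M. (\<forall>n. F n x = F n y) \<longrightarrow> x = y) \<and>
    (\<forall>x\<in>space M. 0 < F 0 x) \<and> (\<integral>\<^sup>+x. ennreal (F 0 x) \<partial>M) < \<infinity>"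
proof -
  obtain A :: "nat \<Rightarrow> 'a set" where "\<forall>n. A n \<in> sets M"
    and Asep: "\<forall>x\<in>space M. \<forall>y\<in>space M. (\<forall>n. x \<in> A n \<longleftrightarrow> y \<in> A n) \<longrightarrow> x = y"
    by (rule standard_borel_separating_sequence[OF assms])
  then have A: "A n \<in> sets M" for n by simp
  obtain w where w1: "unit_valued w" and w2: "\<forall>x\<in>space M. 0 < w x"
    and w3: "(\<integral>\<^sup>+x. ennreal (w x) \<partial>M) < \<infinity>"
    by (rule ex_positive_integrable)
  have w: "unit_valued w" "x \<in> space M \<Longrightarrow> 0 < w x" "(\<integral>\<^sup>+x. ennreal (w x) \<partial>M) < \<infinity>" for x
    using w1 w2 w3 by auto
  obtain \<Psi> :: "nat \<Rightarrow> 'g \<Rightarrow> real" and P where \<Psi>: "\<forall>n. test_function (\<Psi> n)" "\<forall>n. \<forall>g\<in>carrier G. 0 \<le> \<Psi> n g"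
    and P: "openin T P" "P \<noteq> {}" "\<forall>g\<in>P. 0 < \<Psi> 0 g"
    and sep: "\<forall>a b. a \<in> borel_measurable m \<longrightarrow> b \<in> borel_measurable m \<longrightarrow>
        (\<forall>g\<in>carrier G. 0 \<le> a g \<and> a g \<le> 1) \<longrightarrow> (\<forall>g\<in>carrier G. 0 \<le> b g \<and> b g \<le> 1) \<longrightarrow>
        (\<forall>n. (\<integral>g. \<Psi> n g * a g \<partial>m) = (\<integral>g. \<Psi> n g * b g \<partial>m)) \<longrightarrow>
        (AE g in m. \<Psi> 0 g * a g = \<Psi> 0 g * b g)"
    by (rule ex_separating_test_functions)
  have test: "test_function (\<Psi> n)" for n using \<Psi>(1) by simp
  have nn: "0 \<le> \<Psi> n g" if "g \<in> carrier G" for n g using \<Psi>(2) that by simp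
  \<comment> \<open>Slot 0 is the positive integrable function that later cuts out the model; the
    other slots run through all pairs of a test function and a separating set.\<close>
  define F where "F n = (case n of 0 \<Rightarrow> smoothing (\<Psi> 0) w
     | Suc j \<Rightarrow> smoothing (\<Psi> (fst (prod_decode j))) (indicator (A (snd (prod_decode j)))))" for n
  have Feq: "\<exists>\<psi> f. test_function \<psi> \<and> unit_valued f \<and> F n = smoothing \<psi> f" for n
  proof (cases n)
    case 0
    then show ?thesis using test w(1) by (auto simp: F_def)
  next
    case (Suc j)
    then show ?thesis using test unit_valued_indicator[OF A] by (auto simp: F_def)
  qed
  have "x = y" if x: "x \<in> space M" and y: "y \<in> space M" and eq: "\<forall>n. F n x = F n y" for x y
  proof -
    have "AE g in m. \<Psi> 0 g * indicator (A n) (\<alpha> g x) = \<Psi> 0 g * (indicator (A n) (\<alpha> g y) :: real)" for n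
    proof (rule sep[rule_format])
      show "(\<lambda>g. indicator (A n) (\<alpha> g x) :: real) \<in> borel_measurable m"
        by (rule measurable_orbit[OF unit_valued_indicator[OF A] x])
      show "(\<lambda>g. indicator (A n) (\<alpha> g y) :: real) \<in> borel_measurable m"
        by (rule measurable_orbit[OF unit_valued_indicator[OF A] y])
      show "(\<integral>g. \<Psi> k g * indicator (A n) (\<alpha> g x) \<partial>m) = (\<integral>g. \<Psi> k g * indicator (A n) (\<alpha> g y) \<partial>m)" for k
        using eq[rule_format, of "Suc (prod_encode (k, n))"] by (simp add: F_def smoothing_def)
    qed (auto simp: indicator_def)
    \<comment> \<open>Countably many exceptional null sets are merged, so one \<open>g\<close> in
      \<open>P\<close> works for every \<open>n\<close>. There \<open>\<Psi> 0 g\<close> is nonzero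
      and cancels, hence \<open>\<alpha> g x\<close> and \<open>\<alpha> g y\<close> lie in the same
      sets \<open>A n\<close> and are equal.\<close>
    then have "AE g in m. \<forall>n. \<Psi> 0 g * indicator (A n) (\<alpha> g x) = \<Psi> 0 g * (indicator (A n) (\<alpha> g y) :: real)"
      unfolding AE_all_countable by (rule allI)
    then obtain g where g: "g \<in> P"
      "\<forall>n. \<Psi> 0 g * indicator (A n) (\<alpha> g x) = \<Psi> 0 g * (indicator (A n) (\<alpha> g y) :: real)"
      by (rule AE_nonzero_open[OF _ P(1,2)])
    have gc: "g \<in> carrier G" using g(1) P(1) openin_carrier by auto
    have "\<forall>n. \<alpha> g x \<in> A n \<longleftrightarrow> \<alpha> g y \<in> A n"
    proof
      fix n
      have "(indicator (A n) (\<alpha> g x) :: real) = indicator (A n) (\<alpha> g y)"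
        using g P(3) by (metis less_irrefl mult_left_cancel)
      then show "\<alpha> g x \<in> A n \<longleftrightarrow> \<alpha> g y \<in> A n" by (auto simp: indicator_def split: if_splits)
    qed
    then have "\<alpha> g x = \<alpha> g y" using Asep x y gc by simp
    then show "x = y" using act_inj gc x y by blast
  qed
  moreover have "0 < F 0 x" if "x \<in> space M" for x
    using smoothing_pos[OF test nn P(1,2) _ w(1,2) that] P(3) by (simp add: F_def)
  moreover have "(\<integral>\<^sup>+x. ennreal (F 0 x) \<partial>M) < \<infinity>"
    using nn_integral_smoothing_finite[OF test nn w(1,3)] by (simp add: F_def)
  moreover have "F n \<in> borel_measurable M" for n
    using Feq[of n] smoothing_measurable by auto
  moreover have "\<exists>B. \<forall>x\<in>space M. \<bar>F n x\<bar> \<le> B" for n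
    using Feq[of n] smoothing_bounded by metis
  moreover have "\<exists>W. openin T W \<and> h0 \<in> W \<and> (\<forall>h\<in>W. \<forall>x\<in>space M. \<bar>F n (\<alpha> h x) - F n (\<alpha> h0 x)\<bar> \<le> e)"
    if "h0 \<in> carrier G" "e > 0" for n h0 e
    using Feq[of n] smoothing_equicontinuous[OF _ _ that] by auto
  ultimately show ?thesis by (intro exI[of _ F]) auto
qed

end

section \<open>Borel and Radon measures on subspaces\<close>

lemma sets_borel_of_subspace:
  fixes Y :: "'a :: topological_space set"
  assumes "Y \<in> sets borel"
  shows "sets (borel_of (top_of_set Y)) = sets (restrict_space borel Y)"
proof -
  have "{U. openin (top_of_set Y) U} = (\<inter>) Y ` {S. open S}"
    by (auto simp: openin_open)
  moreover have "(\<inter>) Y ` sigma_sets UNIV {S. open S} = sigma_sets Y ((\<inter>) Y ` {S. open S})"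
    using assms by (intro sigma_sets_Int) (auto simp: borel_def)
  ultimately show ?thesis
    by (simp add: sets_borel_of sets_restrict_space borel_def)
qed

text \<open>Countable bases make every open set of the product a countable union of measurable
  rectangles. A jointly continuous action is thereby measurable for the product
  sigma-algebra.\<close>

lemma borel_of_prod_subset:
  assumes "second_countable S" "second_countable T"
  shows "sets (borel_of (prod_topology S T)) \<subseteq> sets (borel_of S \<Otimes>\<^sub>M borel_of T)"
proof -
  obtain \<A> where A: "countable \<A>" "\<And>V. V \<in> \<A> \<Longrightarrow> openin S V"
    "\<And>U x. openin S U \<Longrightarrow> x \<in> U \<Longrightarrow> \<exists>V\<in>\<A>. x \<in> V \<and> V \<subseteq> U"
    using assms(1) unfolding second_countable_def by auto
  obtain \<B> where B: "countable \<B>" "\<And>V. V \<in> \<B> \<Longrightarrow> openin T V"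
    "\<And>U x. openin T U \<Longrightarrow> x \<in> U \<Longrightarrow> \<exists>V\<in>\<B>. x \<in> V \<and> V \<subseteq> U"
    using assms(2) unfolding second_countable_def by auto
  have "U \<in> sets (borel_of S \<Otimes>\<^sub>M borel_of T)" if U: "openin (prod_topology S T) U" for U
  proof -
    define \<C> where "\<C> = {(V, W). V \<in> \<A> \<and> W \<in> \<B> \<and> V \<times> W \<subseteq> U}"
    have "countable \<C>"
      using A(1) B(1) by (intro countable_subset[of \<C> "\<A> \<times> \<B>"]) (auto simp: \<C>_def)
    moreover have "U = (\<Union>(V, W)\<in>\<C>. V \<times> W)"
    proof
      show "U \<subseteq> (\<Union>(V, W)\<in>\<C>. V \<times> W)"
      proof
        fix p assume p: "p \<in> U"
        obtain x y where xy: "p = (x, y)" by (cases p)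
        obtain V' W' where VW': "openin S V'" "openin T W'" "x \<in> V'" "y \<in> W'" "V' \<times> W' \<subseteq> U"
          using U p unfolding openin_prod_topology_alt xy by meson
        obtain V where V: "V \<in> \<A>" "x \<in> V" "V \<subseteq> V'" using A(3) VW' by meson
        obtain W where W: "W \<in> \<B>" "y \<in> W" "W \<subseteq> W'" using B(3) VW' by meson
        have "(V, W) \<in> \<C>" using V W VW' by (auto simp: \<C>_def)
        then show "p \<in> (\<Union>(V, W)\<in>\<C>. V \<times> W)" using V W xy by auto
      qed
    qed (auto simp: \<C>_def)
    moreover have "(case p of (V, W) \<Rightarrow> V \<times> W) \<in> sets (borel_of S \<Otimes>\<^sub>M borel_of T)" if "p \<in> \<C>" for p
      using that A(2) B(2) by (auto simp: \<C>_def intro!: pair_measureI openin_borel_of)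
    ultimately show ?thesis by (metis (no_types, lifting) sets.countable_UN'')
  qed
  then have "sigma_sets (topspace S \<times> topspace T) {U. openin (prod_topology S T) U}
      \<subseteq> sets (borel_of S \<Otimes>\<^sub>M borel_of T)"
    using sets.sigma_sets_subset[of "{U. openin (prod_topology S T) U}" "borel_of S \<Otimes>\<^sub>M borel_of T"]
    by (auto simp: space_pair_measure)
  then show ?thesis by (simp add: sets_borel_of)
qed

lemma continuous_map_prod_measurable:
  assumes "second_countable S" "second_countable T" "continuous_map (prod_topology S T) Z f"
  shows "f \<in> borel_of S \<Otimes>\<^sub>M borel_of T \<rightarrow>\<^sub>M borel_of Z"
proof (rule measurableI)
  have sp: "space (borel_of S \<Otimes>\<^sub>M borel_of T) = space (borel_of (prod_topology S T))"
    by (simp add: space_pair_measure)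
  note meas = continuous_map_measurable[OF assms(3)]
  show "f x \<in> space (borel_of Z)" if "x \<in> space (borel_of S \<Otimes>\<^sub>M borel_of T)" for x
    using measurable_space[OF meas] that unfolding sp by blast
  show "f -` A \<inter> space (borel_of S \<Otimes>\<^sub>M borel_of T) \<in> sets (borel_of S \<Otimes>\<^sub>M borel_of T)"
    if "A \<in> sets (borel_of Z)" for A
    unfolding sp using measurable_sets[OF meas that] borel_of_prod_subset[OF assms(1,2)] by (rule rev_subsetD)
qed

lemma group_actionI:
  fixes G (structure)
  assumes "group G"
    and ext: "\<And>g. g \<in> carrier G \<Longrightarrow> \<phi> g \<in> extensional E"
    and closed: "\<And>g x. g \<in> carrier G \<Longrightarrow> x \<in> E \<Longrightarrow> \<phi> g x \<in> E"
    and one: "\<And>x. x \<in> E \<Longrightarrow> \<phi> \<one> x = x"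
    and mult: "\<And>g h x. g \<in> carrier G \<Longrightarrow> h \<in> carrier G \<Longrightarrow> x \<in> E \<Longrightarrow> \<phi> (g \<otimes> h) x = \<phi> g (\<phi> h x)"
  shows "group_action G E \<phi>"
proof -
  interpret group G by fact
  have bij: "\<phi> g \<in> Bij E" if g: "g \<in> carrier G" for g
  proof -
    have "bij_betw (\<phi> g) E E"
    proof (rule bij_betwI)
      show "\<phi> (inv g) (\<phi> g x) = x" "\<phi> g (\<phi> (inv g) x) = x" if "x \<in> E" for x
        using that g by (simp_all add: one flip: mult)
    qed (use closed g in auto)
    then show ?thesis using ext g by (simp add: Bij_def)
  qed
  have "\<phi> (g \<otimes> h) = \<phi> g \<otimes>\<^bsub>BijGroup E\<^esub> \<phi> h" if gh: "g \<in> carrier G" "h \<in> carrier G" for g h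
  proof -
    have "\<phi> (g \<otimes> h) = compose E (\<phi> g) (\<phi> h)"
      using ext gh mult by (intro extensionalityI[of _ E]) (auto simp: compose_def)
    then show ?thesis using bij gh by (simp add: BijGroup_def)
  qed
  then have "\<phi> \<in> hom G (BijGroup E)"
    using bij by (auto simp: hom_def BijGroup_def)
  then show ?thesis
    using group_BijGroup assms(1) by (auto simp: group_action_def group_hom_def group_hom_axioms_def)
qed

text \<open>\<open>N\<close> may be infinite and lives on a subspace, so regularity is first
  obtained for its finite pieces on the sets \<open>V n\<close>, viewed as measures on the ambient
  Polish space, and then assembled.\<close>

lemma locally_finite_radon:
  fixes Y :: "'a :: polish_space set" and V :: "nat \<Rightarrow> 'a set"
  assumes Y: "Y \<in> sets borel" and N: "sets N = sets (borel_of (top_of_set Y))"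
    and V: "\<And>n. open (V n)" "Y \<subseteq> (\<Union>n. V n)" "\<And>n. emeasure N (V n \<inter> Y) < \<infinity>"
  shows "radon_measure (top_of_set Y) N" "sigma_finite_measure N"
proof -
  have spN: "space N = Y" using sets_eq_imp_space_eq[OF N] by simp
  have N': "sets N = sets (restrict_space borel Y)" using N sets_borel_of_subspace[OF Y] by simp
  have setsN: "A \<in> sets N \<longleftrightarrow> A \<in> sets borel \<and> A \<subseteq> Y" for A
    unfolding N' using Y by (auto simp: sets_restrict_space_iff)
  have open_sets: "U \<inter> Y \<in> sets N" if "open U" for U using that Y setsN by auto
  \<comment> \<open>The part of \<open>N\<close> carried by \<open>W \<inter> Y\<close>, pushed to
    the ambient Polish type. It is finite for the \<open>W\<close> used below, so inner and outer
    regularity of finite Borel measures apply.\<close>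
  define P where "P W = distr (restrict_space N (W \<inter> Y)) borel (\<lambda>x. x)" for W
  have id: "(\<lambda>x. x) \<in> N \<rightarrow>\<^sub>M borel"
    using measurable_cong_sets[OF N' refl] measurable_restrict_space1[of "\<lambda>x. x" borel borel Y] by auto
  have emP: "emeasure (P W) B = emeasure N (B \<inter> (W \<inter> Y))" if "open W" "B \<in> sets borel" for W B
  proof -
    have "emeasure (P W) B = emeasure (restrict_space N (W \<inter> Y)) (B \<inter> (W \<inter> Y))"
      unfolding P_def using that spN measurable_restrict_space1[OF id]
      by (subst emeasure_distr) (auto simp: space_restrict_space intro!: arg_cong2[where f = emeasure])
    also have "\<dots> = emeasure N (B \<inter> (W \<inter> Y))"
      using open_sets[OF that(1)] sets.Int_space_eq2 by (intro emeasure_restrict_space) auto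
    finally show ?thesis .
  qed
  have Pfin: "emeasure (P W) (space (P W)) \<noteq> \<infinity>" if "open W" "emeasure N (W \<inter> Y) < \<infinity>" for W
    using emP[OF that(1), of UNIV] that(2) by (simp add: P_def)
  have Psets: "sets (P W) = sets borel" for W by (simp add: P_def)
  have outer: "emeasure N A = (INF U\<in>{U. openin (top_of_set Y) U \<and> A \<subseteq> U}. emeasure N U)"
    if A: "A \<in> sets N" for A
  proof (rule antisym)
    show "emeasure N A \<le> (INF U\<in>{U. openin (top_of_set Y) U \<and> A \<subseteq> U}. emeasure N U)"
      using N openin_borel_of by (intro INF_greatest emeasure_mono) auto
    show "(INF U\<in>{U. openin (top_of_set Y) U \<and> A \<subseteq> U}. emeasure N U) \<le> emeasure N A"
    proof (rule ennreal_le_epsilon)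
      fix e :: real assume e: "0 < e"
      have AY: "A \<in> sets borel" "A \<subseteq> Y" using A setsN by auto
      \<comment> \<open>Only the excess over \<open>A\<close> inside \<open>V n\<close> is made
        small. This stays meaningful when \<open>A\<close> has infinite measure, since its part in
        \<open>V n\<close> is finite.\<close>
      have "\<exists>U. open U \<and> A \<subseteq> U \<and> emeasure N (U \<inter> V n \<inter> Y - A) \<le> ennreal (e * (1/2) ^ Suc n)" for n
      proof -
        have fin: "emeasure N (A \<inter> (V n \<inter> Y)) \<noteq> \<infinity>"
        proof -
          have "emeasure N (A \<inter> (V n \<inter> Y)) \<le> emeasure N (V n \<inter> Y)"
            using open_sets[OF V(1)] by (intro emeasure_mono) auto
          also have "\<dots> < \<infinity>" by (rule V(3))
          finally show ?thesis by simp
        qed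
        have pos: "0 < e * (1/2) ^ Suc n" using e by simp
        have "emeasure (P (V n)) A < emeasure (P (V n)) A + ennreal (e * (1/2) ^ Suc n)"
          using fin pos by (simp add: emP[OF V(1) AY(1)] ennreal_add_left_cancel_less less_top del: power_Suc)
        then have "(INF U\<in>{U. A \<subseteq> U \<and> open U}. emeasure (P (V n)) U) < emeasure (P (V n)) A + ennreal (e * (1/2) ^ Suc n)"
          using outer_regular[OF Psets Pfin[OF V(1,3)] AY(1)] by simp
        then obtain U where U: "A \<subseteq> U" "open U"
          "emeasure (P (V n)) U < emeasure (P (V n)) A + ennreal (e * (1/2) ^ Suc n)"
          unfolding INF_less_iff by auto
        have eq: "U \<inter> V n \<inter> Y - A = (U \<inter> (V n \<inter> Y)) - (A \<inter> (V n \<inter> Y))" by auto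
        have UV: "U \<inter> (V n \<inter> Y) \<in> sets N"
          using open_sets[OF open_Int[OF U(2) V(1)]] by (simp add: Int_assoc)
        have AV: "A \<inter> (V n \<inter> Y) \<in> sets N" using A open_sets[OF V(1)] by auto
        have "emeasure N (U \<inter> (V n \<inter> Y)) \<le> ennreal (e * (1/2) ^ Suc n) + emeasure N (A \<inter> (V n \<inter> Y))"
          using U(2,3) emP[OF V(1)] AY(1) by (simp add: add.commute less_imp_le)
        then have "emeasure N (U \<inter> (V n \<inter> Y)) - emeasure N (A \<inter> (V n \<inter> Y)) \<le> ennreal (e * (1/2) ^ Suc n)"
          using fin by (simp add: ennreal_minus_le_iff add.commute)
        then have "emeasure N (U \<inter> V n \<inter> Y - A) \<le> ennreal (e * (1/2) ^ Suc n)"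
          unfolding eq using fin UV AV U(1) by (subst emeasure_Diff) auto
        then show ?thesis using U by auto
      qed
      then obtain U where U: "\<And>n. open (U n)" "\<And>n. A \<subseteq> U n"
        "\<And>n. emeasure N (U n \<inter> V n \<inter> Y - A) \<le> ennreal (e * (1/2) ^ Suc n)"
        by metis
      define Z where "Z = Y \<inter> (\<Union>n. U n \<inter> V n)"
      have Z: "openin (top_of_set Y) Z"
        unfolding Z_def using U(1) V(1) by (intro openin_open_Int open_UN ballI open_Int)
      have AZ: "A \<subseteq> Z"
      proof
        fix x assume x: "x \<in> A"
        then obtain n where "x \<in> V n" using V(2) AY(2) by auto
        then show "x \<in> Z" using U(2)[of n] x AY(2) by (auto simp: Z_def)
      qed
      have m: "U n \<inter> V n \<inter> Y - A \<in> sets N" for n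
        using open_sets[OF open_Int[OF U(1) V(1)]] A by (intro sets.Diff) auto
      have mU: "(\<Union>n. U n \<inter> V n \<inter> Y - A) \<in> sets N" using m by (intro sets.countable_UN) auto
      have "emeasure N Z \<le> emeasure N (A \<union> (\<Union>n. U n \<inter> V n \<inter> Y - A))"
        by (intro emeasure_mono sets.Un A mU) (auto simp: Z_def)
      also have "\<dots> \<le> emeasure N A + emeasure N (\<Union>n. U n \<inter> V n \<inter> Y - A)"
        by (rule emeasure_subadditive[OF A mU])
      also have "\<dots> \<le> emeasure N A + (\<Sum>n. emeasure N (U n \<inter> V n \<inter> Y - A))"
        using m by (intro add_left_mono emeasure_subadditive_countably) auto
      also have "\<dots> \<le> emeasure N A + ennreal e"
        using suminf_le_add_half_powers[of "\<lambda>n. emeasure N (U n \<inter> V n \<inter> Y - A)" "\<lambda>_. 0" e] U(3) e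
        by (intro add_left_mono) simp
      finally have "emeasure N Z \<le> emeasure N A + ennreal e" .
      moreover have "(INF U\<in>{U. openin (top_of_set Y) U \<and> A \<subseteq> U}. emeasure N U) \<le> emeasure N Z"
        using Z AZ by (intro INF_lower) auto
      ultimately show "(INF U\<in>{U. openin (top_of_set Y) U \<and> A \<subseteq> U}. emeasure N U) \<le> emeasure N A + ennreal e"
        by (rule order_trans[rotated])
    qed
  qed
  have compact_sets: "K \<in> sets N" if "compactin (top_of_set Y) K" for K
    using that setsN by (auto simp: compactin_subtopology intro: borel_compact)
  have inner: "emeasure N U = (SUP K\<in>{K. compactin (top_of_set Y) K \<and> K \<subseteq> U}. emeasure N K)"
    (is "_ = ?S") if U: "openin (top_of_set Y) U" for U
  proof (rule antisym)
    have UN: "U \<in> sets N" using N U openin_borel_of by auto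
    then have UY: "U \<in> sets borel" "U \<subseteq> Y" using setsN by auto
    show "?S \<le> emeasure N U" using UN by (intro SUP_least emeasure_mono) auto
    \<comment> \<open>These finite unions have finite measure on \<open>Y\<close> and increase to a
      cover of it, so the measure of \<open>U\<close> is the supremum of the measures of the pieces
      \<open>U \<inter> W n\<close>, each approximated by compact sets.\<close>
    define W where "W n = (\<Union>i<n. V i)" for n :: nat
    have W: "open (W n)" for n using V(1) by (auto simp: W_def)
    have Wfin: "emeasure N (W n \<inter> Y) < \<infinity>" for n
    proof -
      have "emeasure N (W n \<inter> Y) = emeasure N (\<Union>i<n. V i \<inter> Y)" by (simp add: W_def)
      also have "\<dots> \<le> (\<Sum>i<n. emeasure N (V i \<inter> Y))"
        using open_sets[OF V(1)] by (intro emeasure_subadditive_finite) auto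
      also have "\<dots> < \<infinity>" using V(3) by (simp add: less_top)
      finally show ?thesis .
    qed
    have le: "emeasure N (U \<inter> W n) \<le> ?S" for n
    proof -
      have UW: "U \<inter> W n \<in> sets borel" using UY W by auto
      have "emeasure N (U \<inter> W n) = emeasure (P (W n)) (U \<inter> W n)"
      proof -
        have "U \<inter> W n \<inter> (W n \<inter> Y) = U \<inter> W n" using UY by auto
        then show ?thesis using emP[OF W UW, of n] by metis
      qed
      also have "\<dots> = (SUP K\<in>{K. K \<subseteq> U \<inter> W n \<and> compact K}. emeasure (P (W n)) K)"
        by (rule inner_regular[OF Psets Pfin[OF W Wfin] UW])
      also have "\<dots> \<le> ?S"
      proof (rule SUP_least)
        fix K assume "K \<in> {K. K \<subseteq> U \<inter> W n \<and> compact K}"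
        then have K: "K \<subseteq> U \<inter> W n" "compact K" by auto
        have "emeasure (P (W n)) K = emeasure N (K \<inter> (W n \<inter> Y))"
          using K by (intro emP W borel_compact)
        also have "K \<inter> (W n \<inter> Y) = K" using K UY by auto
        also have "emeasure N K \<le> ?S"
          using K UY by (intro SUP_upper) (auto simp: compactin_subtopology)
        finally show "emeasure (P (W n)) K \<le> ?S" .
      qed
      finally show ?thesis .
    qed
    have "U \<inter> W n \<in> sets N" for n using UY W setsN by auto
    moreover have "incseq (\<lambda>n. U \<inter> W n)" 
      unfolding incseq_def W_def by (intro allI impI Int_mono UN_mono) auto
    moreover have "(\<Union>n. U \<inter> W n) = U"
    proof
      show "U \<subseteq> (\<Union>n. U \<inter> W n)"
      proof
        fix x assume x: "x \<in> U"
        then obtain i where "x \<in> V i" using UY(2) V(2) by auto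
        then have "x \<in> U \<inter> W (Suc i)" using x by (auto simp: W_def)
        then show "x \<in> (\<Union>n. U \<inter> W n)" by (rule UN_I[OF UNIV_I])
      qed
    qed auto
    ultimately have "emeasure N U = (SUP n. emeasure N (U \<inter> W n))"
      using SUP_emeasure_incseq[of "\<lambda>n. U \<inter> W n" N] by (simp add: image_subset_iff)
    also have "\<dots> \<le> ?S" using le by (intro SUP_least)
    finally show "emeasure N U \<le> ?S" .
  qed
  have compact_fin: "emeasure N K < \<infinity>" if K: "compactin (top_of_set Y) K" for K
  proof -
    have K': "compact K" "K \<subseteq> Y" using K by (auto simp: compactin_subtopology)
    then have "K \<subseteq> (\<Union>n\<in>UNIV. V n)" using V(2) by auto
    then obtain I where I: "finite I" "K \<subseteq> (\<Union>n\<in>I. V n)"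
      using compactE_image[OF K'(1), of UNIV V] V(1) by metis
    have "emeasure N K \<le> emeasure N (\<Union>n\<in>I. V n \<inter> Y)"
      using I K' open_sets[OF V(1)] by (intro emeasure_mono sets.finite_UN) auto
    also have "\<dots> \<le> (\<Sum>n\<in>I. emeasure N (V n \<inter> Y))"
      using I open_sets[OF V(1)] by (intro emeasure_subadditive_finite) auto
    also have "\<dots> < \<infinity>" using V(3) I(1) by (simp add: less_top)
    finally show ?thesis .
  qed
  show "radon_measure (top_of_set Y) N"
    unfolding radon_measure_def
    using N compact_fin inner outer by (simp add: Hausdorff_space_subtopology)
  show "sigma_finite_measure N"
  proof
    show "\<exists>A. countable A \<and> A \<subseteq> sets N \<and> \<Union>A = space N \<and> (\<forall>a\<in>A. emeasure N a \<noteq> \<infinity>)"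
      using V(2,3) open_sets[OF V(1)] spN
      by (intro exI[of _ "range (\<lambda>n. V n \<inter> Y)"]) (auto simp: less_top)
  qed
qed

text \<open>A separating sequence of sets shrinks an atom of \<open>N\<close> to a single point of
  positive mass. By injectivity its preimage is a single point of \<open>M\<close> with the same
  mass, which is an atom of \<open>M\<close>.\<close>

lemma atomless_injective_image:
  assumes atomless: "atomless M" and std: "standard_borel_space N"
    and \<Phi>: "\<Phi> \<in> M \<rightarrow>\<^sub>M N" "inj_on \<Phi> (space M)" and N: "\<And>A. A \<in> sets N \<Longrightarrow> emeasure N A = emeasure M (\<Phi> -` A \<inter> space M)"
  shows "atomless N"
  unfolding atomless_def
proof
  assume "\<exists>A\<in>sets N. 0 < emeasure N A \<and> (\<forall>B\<in>sets N. B \<subseteq> A \<longrightarrow> emeasure N B = 0 \<or> emeasure N (A - B) = 0)"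
  then obtain A where A: "A \<in> sets N" "0 < emeasure N A"
    and atom: "\<And>B. B \<in> sets N \<Longrightarrow> B \<subseteq> A \<Longrightarrow> emeasure N B = 0 \<or> emeasure N (A - B) = 0"
    by blast
  obtain C :: "nat \<Rightarrow> 'b set" where C: "\<forall>n. C n \<in> sets N"
    and sep: "\<forall>x\<in>space N. \<forall>y\<in>space N. (\<forall>n. x \<in> C n \<longleftrightarrow> y \<in> C n) \<longrightarrow> x = y"
    by (rule standard_borel_separating_sequence[OF std])
  \<comment> \<open>Each \<open>C n\<close> splits the atom into a null part and a part of full
    mass; \<open>E n\<close> is the latter. The intersection of all of them keeps full mass, and no
    \<open>C n\<close> separates two of its points.\<close>
  define E where "E n = (if emeasure N (A \<inter> C n) = 0 then A - C n else A \<inter> C n)" for n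
  have E: "E n \<in> sets N" "E n \<subseteq> A" for n using A C by (auto simp: E_def)
  have null: "emeasure N (A - E n) = 0" for n
    using atom[of "A \<inter> C n"] A C by (auto simp: E_def Diff_Diff_Int)
  define Z where "Z = A \<inter> (\<Inter>n. E n)"
  have Z: "Z \<in> sets N" unfolding Z_def using A E by auto
  have "A - E n \<in> null_sets N" for n using null A(1) E(1) by auto
  then have "(\<Union>n. A - E n) \<in> null_sets N" by (rule null_sets_UN)
  then have "emeasure N (A - (\<Union>n. A - E n)) = emeasure N A"
    using A(1) by (rule emeasure_Diff_null_set)
  moreover have "A - (\<Union>n. A - E n) = Z" by (auto simp: Z_def)
  ultimately have Zpos: "0 < emeasure N Z" using A(2) by simp
  have single: "x = y" if "x \<in> Z" "y \<in> Z" for x y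
  proof -
    have "x \<in> C n \<longleftrightarrow> y \<in> C n" for n
    proof -
      have "x \<in> E n" "y \<in> E n" using that by (auto simp: Z_def)
      then show ?thesis by (auto simp: E_def split: if_splits)
    qed
    moreover have "x \<in> space N" "y \<in> space N" using that Z sets.sets_into_space by blast+
    ultimately show ?thesis using sep by blast
  qed
  define A' where "A' = \<Phi> -` Z \<inter> space M"
  have A': "A' \<in> sets M" unfolding A'_def using \<Phi>(1) Z by (rule measurable_sets)
  have pos': "0 < emeasure M A'" using Zpos N[OF Z] by (simp add: A'_def)
  have single': "x = y" if "x \<in> A'" "y \<in> A'" for x y
    using that single[of "\<Phi> x" "\<Phi> y"] \<Phi>(2) by (auto simp: A'_def inj_on_def)
  have "emeasure M B = 0 \<or> emeasure M (A' - B) = 0" if "B \<subseteq> A'" for B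
  proof (cases "B = {}")
    case False
    then obtain b where "b \<in> B" by auto
    then have "A' - B = {}" using single'[of _ b] that by auto
    then show ?thesis by (metis emeasure_empty)
  qed simp
  then have "\<exists>A\<in>sets M. 0 < emeasure M A \<and>
      (\<forall>B\<in>sets M. B \<subseteq> A \<longrightarrow> emeasure M B = 0 \<or> emeasure M (A - B) = 0)"
    using A' pos' by (intro bexI[of _ A'] conjI ballI impI) auto
  then show False using atomless by (simp add: atomless_def)
qed

section \<open>The continuous model\<close>

lemma continuous_map_real_eps:
  fixes f :: "'a \<Rightarrow> real"
  assumes "\<And>x e. x \<in> topspace X \<Longrightarrow> 0 < e \<Longrightarrow> \<exists>U. openin X U \<and> x \<in> U \<and> (\<forall>y\<in>U. \<bar>f y - f x\<bar> < e)"
  shows "continuous_map X euclideanreal f"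
  using assms Met_TC.continuous_map_to_metric[of X f]
  by (auto simp: dist_real_def abs_minus_commute)

locale equicontinuous_family = Haar_action G T m M \<alpha>
  for G :: "('g, 'm) monoid_scheme" (structure) and T :: "'g topology"
    and m :: "'g measure" and M :: "'a measure" and \<alpha> :: "'g \<Rightarrow> 'a \<Rightarrow> 'a" +
  fixes F :: "nat \<Rightarrow> 'a \<Rightarrow> real" and B :: "nat \<Rightarrow> real" and D :: "nat \<Rightarrow> 'g"
  assumes F_measurable: "\<And>n. F n \<in> borel_measurable M"
    and F_bounded: "\<And>n x. x \<in> space M \<Longrightarrow> \<bar>F n x\<bar> \<le> B n"
    and F_equicontinuous: "\<And>n h0 e. h0 \<in> carrier G \<Longrightarrow> 0 < e \<Longrightarrow>
      \<exists>W. openin T W \<and> h0 \<in> W \<and> (\<forall>h\<in>W. \<forall>x\<in>space M. \<bar>F n (\<alpha> h x) - F n (\<alpha> h0 x)\<bar> \<le> e)"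
    and F_separates: "\<And>x y. x \<in> space M \<Longrightarrow> y \<in> space M \<Longrightarrow> (\<And>n. F n x = F n y) \<Longrightarrow> x = y"
    and F_pos: "\<And>x. x \<in> space M \<Longrightarrow> 0 < F 0 x"
    and F_integrable: "(\<integral>\<^sup>+x. ennreal (F 0 x) \<partial>M) < \<infinity>"
    and D_carrier: "\<And>j. D j \<in> carrier G"
    and D_dense: "T closure_of (range D) = carrier G"
begin

text \<open>The index type also contains elements outside \<open>carrier G\<close>; the value 0
  there makes the function determined by its values on the group, as injectivity of
  \<open>sample\<close> on the hull requires.\<close>

definition orbit_map :: "'a \<Rightarrow> nat \<times> 'g \<Rightarrow> real" where
  "orbit_map x = (\<lambda>(i, g). if g \<in> carrier G then F i (\<alpha> g x) else 0)"

text \<open>The closure is taken for pointwise convergence over a possibly uncountable index set: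
  compact by Tychonoff's theorem, but metrizable only after sampling.\<close>

definition orbit_hull :: "(nat \<times> 'g \<Rightarrow> real) set" where
  "orbit_hull = closure (orbit_map ` space M)"

definition sample :: "(nat \<times> 'g \<Rightarrow> real) \<Rightarrow> nat \<Rightarrow> real" where
  "sample k n = k (fst (prod_decode n), D (snd (prod_decode n)))"

text \<open>Multiplying the argument on the right yields a left action: translating by
  \<open>h\<close> and then by \<open>g\<close> evaluates \<open>k\<close> at \<open>x g h\<close>,
  as translating by \<open>g \<otimes> h\<close> does.\<close>

definition translate :: "'g \<Rightarrow> (nat \<times> 'g \<Rightarrow> real) \<Rightarrow> nat \<times> 'g \<Rightarrow> real" where
  "translate h k = (\<lambda>(i, g). if g \<in> carrier G then k (i, g \<otimes> h) else 0)"

definition unsample :: "(nat \<Rightarrow> real) \<Rightarrow> nat \<times> 'g \<Rightarrow> real" where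
  "unsample = inv_into orbit_hull sample"

text \<open>Phrased through sampled coordinates, this is an open set of sequences. On the sampled
  hull it expresses the translation-invariant condition that the coordinate of index 0 is positive
  somewhere on the group.\<close>

definition pos_part :: "(nat \<Rightarrow> real) set" where
  "pos_part = {y. \<exists>j. 0 < y (prod_encode (0, j))}"

definition model :: "(nat \<Rightarrow> real) set" where
  "model = sample ` orbit_hull \<inter> pos_part"

definition embed :: "'a \<Rightarrow> nat \<Rightarrow> real" where
  "embed x = sample (orbit_map x)"

definition model_act :: "'g \<Rightarrow> (nat \<Rightarrow> real) \<Rightarrow> nat \<Rightarrow> real" where
  "model_act h = (\<lambda>y\<in>model. sample (translate h (unsample y)))"

definition model_measure :: "(nat \<Rightarrow> real) measure" where
  "model_measure = distr M (borel_of (top_of_set model)) embed"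

section \<open>The compact hull of the orbit functions and its sampling\<close>

lemma orbit_map_hull: "x \<in> space M \<Longrightarrow> orbit_map x \<in> orbit_hull"
  unfolding orbit_hull_def using closure_subset[of "orbit_map ` space M"] by auto

text \<open>Equations and non-strict inequalities between coordinates pass from orbit functions to
  their pointwise limits.\<close>

lemma hull_induct:
  assumes "k \<in> orbit_hull" "closed {k. Q k}" "\<And>x. x \<in> space M \<Longrightarrow> Q (orbit_map x)"
  shows "Q k"
proof -
  have "orbit_hull \<subseteq> {k. Q k}" unfolding orbit_hull_def using assms by (intro closure_minimal) auto
  then show ?thesis using assms(1) by auto
qed

lemma continuous_on_coordinate: "continuous_on S (\<lambda>k :: 'i \<Rightarrow> real. k p)"
  by (rule continuous_on_subset[OF continuous_on_product_coordinates]) simp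

lemma compact_hull: "compact orbit_hull"
proof -
  define Box where "Box = PiE UNIV (\<lambda>(i :: nat, g :: 'g). {- \<bar>B i\<bar>..\<bar>B i\<bar>})"
  have "compactin (product_topology (\<lambda>_. euclidean) UNIV) Box"
    unfolding Box_def compactin_PiE by auto
  then have cBox: "compact Box" by (simp add: euclidean_product_topology)
  have "orbit_map x \<in> Box" if "x \<in> space M" for x
  proof -
    have "\<bar>F i (\<alpha> g x)\<bar> \<le> \<bar>B i\<bar>" if "g \<in> carrier G" for i g
      using F_bounded[of "\<alpha> g x" i] that \<open>x \<in> space M\<close> by force
    then show ?thesis by (auto simp: Box_def orbit_map_def abs_le_iff minus_le_iff)
  qed
  moreover have "closed Box"
  proof -
    have "Box = {k. \<forall>p. - \<bar>B (fst p)\<bar> \<le> k p \<and> k p \<le> \<bar>B (fst p)\<bar>}"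
      by (auto simp: Box_def PiE_iff)
    then show ?thesis
      by (simp add: closed_Collect_all closed_Collect_conj closed_Collect_le continuous_on_const
          continuous_on_coordinate)
  qed
  ultimately have "orbit_hull \<subseteq> Box"
    unfolding orbit_hull_def by (intro closure_minimal) auto
  then show ?thesis
    using compact_Int_closed[OF cBox, of orbit_hull] by (simp add: Int_absorb1 orbit_hull_def)
qed

text \<open>Equicontinuity of the orbit functions at \<open>g \<otimes> h0\<close> is pulled back
  along \<open>h \<mapsto> g \<otimes> h\<close>. The bound is non-strict, hence closed, and so
  extends to the hull with the same \<open>W\<close>.\<close>

lemma hull_equicontinuous:
  assumes "g \<in> carrier G" "h0 \<in> carrier G" "0 < e"
  obtains W where "openin T W" "h0 \<in> W"
    "\<forall>h\<in>W. \<forall>k\<in>orbit_hull. \<bar>k (i, g \<otimes> h) - k (i, g \<otimes> h0)\<bar> \<le> e"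
proof -
  obtain W' where W': "openin T W'" "g \<otimes> h0 \<in> W'"
    "\<forall>h\<in>W'. \<forall>x\<in>space M. \<bar>F i (\<alpha> h x) - F i (\<alpha> (g \<otimes> h0) x)\<bar> \<le> e"
    using F_equicontinuous[of "g \<otimes> h0" e i] assms by auto
  define W where "W = {h \<in> carrier G. g \<otimes> h \<in> W'}"
  have "continuous_map T T (\<lambda>h. g \<otimes> h)" using assms(1) by (intro continuous_mult_compose) auto
  from openin_continuous_map_preimage[OF this W'(1)] have "openin T W" by (simp add: W_def)
  moreover have "h0 \<in> W" using W' assms by (simp add: W_def)
  moreover have "\<bar>k (i, g \<otimes> h) - k (i, g \<otimes> h0)\<bar> \<le> e" if h: "h \<in> W" and k: "k \<in> orbit_hull" for h k
    using k
  proof (rule hull_induct)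
    show "closed {k :: nat \<times> 'g \<Rightarrow> real. \<bar>k (i, g \<otimes> h) - k (i, g \<otimes> h0)\<bar> \<le> e}"
      by (intro closed_Collect_le continuous_on_rabs continuous_on_diff continuous_on_coordinate continuous_on_const)
    show "\<bar>orbit_map x (i, g \<otimes> h) - orbit_map x (i, g \<otimes> h0)\<bar> \<le> e" if "x \<in> space M" for x
      using that h W'(3) assms by (auto simp: orbit_map_def W_def)
  qed
  ultimately show thesis using that by blast
qed

lemma hull_outside: "k \<in> orbit_hull \<Longrightarrow> g \<notin> carrier G \<Longrightarrow> k (i, g) = 0"
proof (erule hull_induct)
  show "closed {k :: nat \<times> 'g \<Rightarrow> real. k (i, g) = 0}"
    by (intro closed_Collect_eq continuous_on_coordinate continuous_on_const)
qed (simp add: orbit_map_def)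

lemma dense_meets: "openin T W \<Longrightarrow> h \<in> W \<Longrightarrow> \<exists>j. D j \<in> W"
proof -
  assume W: "openin T W" "h \<in> W"
  then have "h \<in> T closure_of (range D)" using D_dense openin_carrier by auto
  then obtain y where "y \<in> range D" "y \<in> W" using W unfolding in_closure_of by blast
  then show ?thesis by auto
qed

lemma sample_prod_encode [simp]: "sample k (prod_encode (i, j)) = k (i, D j)"
  by (simp add: sample_def)

text \<open>The reason that sampling loses nothing: equicontinuity on the hull carries information
  at a sample point over to any nearby group element.\<close>

lemma hull_approx:
  assumes "g \<in> carrier G" "0 < e"
  obtains j where "\<forall>k\<in>orbit_hull. \<bar>k (i, D j) - k (i, g)\<bar> \<le> e"
proof -
  obtain W where W: "openin T W" "g \<in> W"
    "\<forall>h\<in>W. \<forall>k\<in>orbit_hull. \<bar>k (i, \<one> \<otimes> h) - k (i, \<one> \<otimes> g)\<bar> \<le> e"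
    by (rule hull_equicontinuous[OF one_closed assms])
  obtain j where "D j \<in> W" using dense_meets W by blast
  then have "\<forall>k\<in>orbit_hull. \<bar>k (i, D j) - k (i, g)\<bar> \<le> e"
    using W(3) assms(1) D_carrier[of j] by fastforce
  then show thesis by (rule that)
qed

lemma inj_on_sample: "inj_on sample orbit_hull"
proof (rule inj_onI)
  fix k l assume kl: "k \<in> orbit_hull" "l \<in> orbit_hull" "sample k = sample l"
  have "k (i, g) = l (i, g)" for i g
  proof (cases "g \<in> carrier G")
    case True
    have "\<bar>k (i, g) - l (i, g)\<bar> \<le> 0 + e" if e: "0 < e" for e
    proof -
      obtain j where "\<forall>k\<in>orbit_hull. \<bar>k (i, D j) - k (i, g)\<bar> \<le> e / 2"
        by (rule hull_approx[OF True, of "e / 2"]) (use e in auto)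
      then have "\<bar>k (i, D j) - k (i, g)\<bar> \<le> e / 2" "\<bar>l (i, D j) - l (i, g)\<bar> \<le> e / 2"
        using kl by auto
      moreover have "k (i, D j) = l (i, D j)"
        using arg_cong[OF kl(3), of "\<lambda>f. f (prod_encode (i, j))"] by simp
      ultimately show ?thesis by linarith
    qed
    then have "\<bar>k (i, g) - l (i, g)\<bar> \<le> 0" by (rule field_le_epsilon)
    then show ?thesis by simp
  next
    case False
    then show ?thesis using hull_outside[OF kl(1) False] hull_outside[OF kl(2) False] by simp
  qed
  then show "k = l" by (auto simp: fun_eq_iff)
qed

lemma unsample_sample: "k \<in> orbit_hull \<Longrightarrow> unsample (sample k) = k"
  unfolding unsample_def using inj_on_sample by (rule inv_into_f_f)

lemma continuous_on_sample: "continuous_on S sample"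
  unfolding sample_def[abs_def]
  by (rule continuous_on_coordinatewise_then_product) (rule continuous_on_coordinate)

text \<open>A continuous injection from a compact space into a Hausdorff space has a continuous
  inverse on its image.\<close>

lemma continuous_on_unsample: "continuous_on (sample ` orbit_hull) unsample"
  using continuous_on_sample compact_hull unsample_sample by (intro continuous_on_inv) auto

lemma translate_orbit_map:
  assumes "h \<in> carrier G" "x \<in> space M"
  shows "translate h (orbit_map x) = orbit_map (\<alpha> h x)"
  using assms by (auto simp: translate_def orbit_map_def act_mult fun_eq_iff)

text \<open>For fixed \<open>h\<close>, translation is continuous for pointwise convergence and
  permits no escape from the orbit functions, so it maps their closure into itself.\<close>

lemma translate_hull:
  assumes "h \<in> carrier G" "k \<in> orbit_hull"
  shows "translate h k \<in> orbit_hull"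
proof -
  have "continuous_on (closure (orbit_map ` space M)) (translate h)"
  proof (rule continuous_on_coordinatewise_then_product)
    fix p show "continuous_on (closure (orbit_map ` space M)) (\<lambda>k. translate h k p)"
      by (cases p; cases "snd p \<in> carrier G") (simp_all add: translate_def continuous_on_coordinate)
  qed
  moreover have "translate h ` orbit_map ` space M \<subseteq> orbit_hull"
    using assms by (auto simp: translate_orbit_map orbit_map_hull)
  ultimately have "translate h ` closure (orbit_map ` space M) \<subseteq> orbit_hull"
    by (intro image_closure_subset) (simp_all add: orbit_hull_def)
  then show ?thesis using assms(2) by (auto simp: orbit_hull_def)
qed

lemma translate_mult:
  assumes "g \<in> carrier G" "h \<in> carrier G"
  shows "translate (g \<otimes> h) k = translate g (translate h k)"
  using assms by (auto simp: translate_def m_assoc fun_eq_iff)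

lemma translate_one: "k \<in> orbit_hull \<Longrightarrow> translate \<one> k = k"
  using hull_outside by (auto simp: translate_def fun_eq_iff)

lemma sample_pos_part_iff:
  assumes "k \<in> orbit_hull"
  shows "sample k \<in> pos_part \<longleftrightarrow> (\<exists>g\<in>carrier G. 0 < k (0, g))"
proof
  assume "sample k \<in> pos_part"
  then show "\<exists>g\<in>carrier G. 0 < k (0, g)" using D_carrier by (auto simp: pos_part_def)
next
  assume "\<exists>g\<in>carrier G. 0 < k (0, g)"
  then obtain g where g: "g \<in> carrier G" "0 < k (0, g)" by auto
  obtain j where "\<forall>l\<in>orbit_hull. \<bar>l (0, D j) - l (0, g)\<bar> \<le> k (0, g) / 2"
    by (rule hull_approx[OF g(1), of "k (0, g) / 2"]) (use g in auto)
  then have "\<bar>k (0, D j) - k (0, g)\<bar> \<le> k (0, g) / 2" using assms by auto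
  then have "0 < k (0, D j)" using g(2) by linarith
  then have "0 < sample k (prod_encode (0, j))" by simp
  then show "sample k \<in> pos_part" by (auto simp: pos_part_def)
qed

text \<open>Moving \<open>h\<close> changes the coordinate at which \<open>k\<close> is read.
  Equicontinuity controls that change uniformly over the hull with half of \<open>e\<close>; the
  other half bounds the single coordinate of \<open>k\<close> at
  \<open>g \<otimes> h0\<close>.\<close>

lemma continuous_map_translate:
  "continuous_map (prod_topology T (top_of_set orbit_hull)) (top_of_set orbit_hull) (\<lambda>(h, k). translate h k)"
proof -
  have coord: "continuous_map (prod_topology T (top_of_set orbit_hull)) euclideanreal (\<lambda>(h, k). k (i, g \<otimes> h))"
    if g: "g \<in> carrier G" for i g
  proof (rule continuous_map_real_eps)
    fix p and e :: real
    assume "p \<in> topspace (prod_topology T (top_of_set orbit_hull))" and e: "0 < e"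
    then obtain h0 k0 where p: "p = (h0, k0)" "h0 \<in> carrier G" "k0 \<in> orbit_hull" by auto
    obtain W where W: "openin T W" "h0 \<in> W"
      "\<forall>h\<in>W. \<forall>k\<in>orbit_hull. \<bar>k (i, g \<otimes> h) - k (i, g \<otimes> h0)\<bar> \<le> e / 2"
      by (rule hull_equicontinuous[OF g p(2), of "e / 2"]) (use e in auto)
    define O\<^sub>0 where "O\<^sub>0 = {k :: nat \<times> 'g \<Rightarrow> real. \<bar>k (i, g \<otimes> h0) - k0 (i, g \<otimes> h0)\<bar> < e / 2}"
    have "open O\<^sub>0" unfolding O\<^sub>0_def
      by (intro open_Collect_less continuous_on_rabs continuous_on_diff continuous_on_coordinate continuous_on_const)
    then have "openin (prod_topology T (top_of_set orbit_hull)) (W \<times> (orbit_hull \<inter> O\<^sub>0))"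
      using W(1) openin_open_Int[of O\<^sub>0 orbit_hull] by (simp add: openin_prod_Times_iff)
    moreover have "p \<in> W \<times> (orbit_hull \<inter> O\<^sub>0)" using p W e by (simp add: O\<^sub>0_def)
    moreover have "\<bar>(case q of (h, k) \<Rightarrow> k (i, g \<otimes> h)) - (case p of (h, k) \<Rightarrow> k (i, g \<otimes> h))\<bar> < e"
      if qW: "q \<in> W \<times> (orbit_hull \<inter> O\<^sub>0)" for q
    proof -
      obtain h k where q: "q = (h, k)" "h \<in> W" "k \<in> orbit_hull" "k \<in> O\<^sub>0" using qW by auto
      have "\<bar>k (i, g \<otimes> h) - k (i, g \<otimes> h0)\<bar> \<le> e / 2" using W(3) q by auto
      moreover have "\<bar>k (i, g \<otimes> h0) - k0 (i, g \<otimes> h0)\<bar> < e / 2" using q by (simp add: O\<^sub>0_def)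
      ultimately have "\<bar>k (i, g \<otimes> h) - k0 (i, g \<otimes> h0)\<bar> < e" by linarith
      then show ?thesis using q p by simp
    qed
    ultimately show "\<exists>U. openin (prod_topology T (top_of_set orbit_hull)) U \<and> p \<in> U \<and>
       (\<forall>q\<in>U. \<bar>(case q of (h, k) \<Rightarrow> k (i, g \<otimes> h)) - (case p of (h, k) \<Rightarrow> k (i, g \<otimes> h))\<bar> < e)"
      by blast
  qed
  have "continuous_map (prod_topology T (top_of_set orbit_hull)) (product_topology (\<lambda>_. euclideanreal) UNIV)
      (\<lambda>(h, k). translate h k)"
    unfolding continuous_map_componentwise_UNIV
  proof
    fix q :: "nat \<times> 'g"
    obtain i g where q: "q = (i, g)" by (cases q)
    show "continuous_map (prod_topology T (top_of_set orbit_hull)) euclideanreal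
        (\<lambda>p. (case p of (h, k) \<Rightarrow> translate h k) q)"
      using coord[of g i] by (cases "g \<in> carrier G") (simp_all add: q translate_def case_prod_unfold)
  qed
  then show ?thesis
    using translate_hull by (auto simp: continuous_map_in_subtopology euclidean_product_topology)
qed

section \<open>The model as an open invariant part of the sampled hull\<close>

lemma model_cases:
  assumes "y \<in> model"
  obtains k where "k \<in> orbit_hull" "y = sample k" "unsample y = k" "sample k \<in> pos_part"
  using assms unsample_sample unfolding model_def by blast

lemma sample_translate_model:
  assumes "h \<in> carrier G" "k \<in> orbit_hull" "sample k \<in> pos_part"
  shows "sample (translate h k) \<in> model"
proof -
  obtain g where g: "g \<in> carrier G" "0 < k (0, g)" using assms sample_pos_part_iff by auto
  \<comment> \<open>A point \<open>g\<close> where \<open>k\<close> is positive becomes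
    \<open>g \<otimes> inv h\<close> for the translate, since the translation multiplies the
    argument by \<open>h\<close> again.\<close>
  have "0 < translate h k (0, g \<otimes> inv h)" using g assms by (simp add: translate_def m_assoc)
  then have "sample (translate h k) \<in> pos_part"
    using g assms sample_pos_part_iff translate_hull by (meson inv_closed m_closed)
  then show ?thesis using translate_hull assms by (simp add: model_def)
qed

lemma model_act_sample:
  assumes "k \<in> orbit_hull" "sample k \<in> pos_part"
  shows "model_act h (sample k) = sample (translate h k)"
  using assms by (simp add: model_act_def model_def unsample_sample)

lemma group_action_model: "group_action G model model_act"
proof (rule group_actionI)
  show "group G" by (rule is_group)
  show "model_act g \<in> extensional model" for g by (simp add: model_act_def)
  show "model_act g y \<in> model" if "g \<in> carrier G" "y \<in> model" for g y
    using that(2) by (rule model_cases) (use that(1) in \<open>simp add: model_act_sample sample_translate_model\<close>)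
  show "model_act \<one> y = y" if "y \<in> model" for y
    using that by (rule model_cases) (simp add: model_act_sample translate_one)
  show "model_act (g \<otimes> h) y = model_act g (model_act h y)"
    if "g \<in> carrier G" "h \<in> carrier G" "y \<in> model" for g h y
    using that(3)
  proof (rule model_cases)
    fix k assume k: "k \<in> orbit_hull" "y = sample k" "sample k \<in> pos_part"
    have "sample (translate h k) \<in> pos_part"
      using sample_translate_model[OF that(2) k(1,3)] by (simp add: model_def)
    then show ?thesis
      using k that translate_hull by (simp add: model_act_sample translate_mult)
  qed
qed

lemma open_pos_part: "open pos_part"
proof -
  have eq: "pos_part = (\<Union>j. {y. 0 < y (prod_encode (0, j))})" by (auto simp: pos_part_def)
  have op: "open {y :: nat \<Rightarrow> real. 0 < y n}" for n
    by (intro open_Collect_less continuous_on_const continuous_on_coordinate)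
  show ?thesis unfolding eq by (intro open_UN ballI op)
qed

lemma compact_sample_hull: "compact (sample ` orbit_hull)"
  by (intro compact_continuous_image continuous_on_sample compact_hull)

lemma model_borel: "model \<in> sets borel"
  unfolding model_def by (intro sets.Int borel_compact[OF compact_sample_hull] borel_open[OF open_pos_part])

lemma openin_model: "openin (top_of_set (sample ` orbit_hull)) model"
  unfolding model_def using open_pos_part by (simp add: openin_open_Int)

lemma top_of_set_model: "top_of_set model = subtopology (top_of_set (sample ` orbit_hull)) model"
  unfolding model_def by (simp add: subtopology_subtopology Int_absorb1 inf_assoc[symmetric])

lemma second_countable_model: "second_countable (top_of_set model)"
proof -
  have "second_countable (euclidean :: (nat \<Rightarrow> real) topology)"
    unfolding second_countable_def
  proof -
    obtain \<B> :: "(nat \<Rightarrow> real) set set" where "countable \<B>" "topological_basis \<B>"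
      using ex_countable_basis by blast
    then show "\<exists>\<B>. countable \<B> \<and> (\<forall>V\<in>\<B>. openin euclidean V) \<and>
        (\<forall>U x. openin euclidean U \<and> (x :: nat \<Rightarrow> real) \<in> U \<longrightarrow> (\<exists>V\<in>\<B>. x \<in> V \<and> V \<subseteq> U))"
      by (intro exI[of _ \<B>]) (metis open_openin topological_basisE topological_basis_open)
  qed
  then show ?thesis by (rule second_countable_subtopology)
qed

text \<open>The model is open in a compact, hence closed, subset of the space of real sequences, and
  complete metrizability passes to closed and to open subspaces.\<close>

lemma polish_model: "polish_topology (top_of_set model)"
  unfolding polish_topology_def
proof
  have "completely_metrizable_space (top_of_set (sample ` orbit_hull))"
    using compact_imp_closed[OF compact_sample_hull]
    by (intro completely_metrizable_space_closedin completely_metrizable_space_euclidean) simp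
  then show "completely_metrizable_space (top_of_set model)"
    unfolding top_of_set_model using openin_model by (rule completely_metrizable_space_openin)
  show "separable_space (top_of_set model)"
    by (rule second_countable_imp_separable_space[OF second_countable_model])
qed

lemma locally_compact_model: "locally_compact_space (top_of_set model)"
proof -
  have "compact_space (top_of_set (sample ` orbit_hull))"
    using compact_sample_hull by (simp add: compact_space_subtopology)
  moreover have "Hausdorff_space (top_of_set (sample ` orbit_hull))"
    by (simp add: Hausdorff_space_subtopology)
  ultimately show ?thesis
    unfolding top_of_set_model using openin_model
    by (intro locally_compact_space_open_subset compact_imp_locally_compact_space) auto
qed

text \<open>The model action is translation conjugated by the homeomorphism \<open>sample\<close> of
  the hull onto its image, so joint continuity is inherited from \<open>translate\<close>.\<close>

lemma continuous_action_model: "continuous_action T (top_of_set model) model_act"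
proof -
  let ?P = "prod_topology T (top_of_set model)"
  have sub: "model \<subseteq> sample ` orbit_hull" by (auto simp: model_def)
  have us: "continuous_map (top_of_set model) (top_of_set orbit_hull) unsample"
    unfolding continuous_map_in_subtopology
  proof
    show "continuous_map (top_of_set model) euclidean unsample"
      using continuous_on_subset[OF continuous_on_unsample sub] by simp
    show "unsample \<in> topspace (top_of_set model) \<rightarrow> orbit_hull"
    proof
      fix y assume "y \<in> topspace (top_of_set model)"
      then obtain k where "k \<in> orbit_hull" "y = sample k" by (auto simp: model_def)
      then show "unsample y \<in> orbit_hull" by (simp add: unsample_sample)
    qed
  qed
  have "continuous_map ?P (prod_topology T (top_of_set orbit_hull)) (\<lambda>p. (fst p, unsample (snd p)))"
    using continuous_map_compose[OF continuous_map_snd us]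
    by (intro continuous_map_pairedI continuous_map_fst) (simp add: o_def)
  from continuous_map_compose[OF this continuous_map_translate]
  have tr: "continuous_map ?P (top_of_set orbit_hull) (\<lambda>p. translate (fst p) (unsample (snd p)))"
    by (simp add: o_def)
  have "continuous_map (top_of_set orbit_hull) euclidean sample"
    using continuous_on_sample by simp
  from continuous_map_compose[OF tr this]
  have "continuous_map ?P euclidean (\<lambda>p. sample (translate (fst p) (unsample (snd p))))"
    by (simp add: o_def)
  moreover have "sample (translate (fst p) (unsample (snd p))) = (case p of (g, y) \<Rightarrow> model_act g y)"
    if "p \<in> topspace ?P" for p
    using that by (auto simp: model_act_def)
  ultimately have "continuous_map ?P euclidean (\<lambda>(g, y). model_act g y)"
    by (rule continuous_map_eq)
  moreover have "model_act g y \<in> model" if "g \<in> carrier G" "y \<in> model" for g y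
    using group_action.element_image[OF group_action_model that] by simp
  ultimately show ?thesis
    unfolding continuous_action_def by (auto simp: continuous_map_in_subtopology)
qed

section \<open>The embedding and the pushforward measure\<close>

lemma embed_model: "x \<in> space M \<Longrightarrow> embed x \<in> model"
proof -
  assume x: "x \<in> space M"
  \<comment> \<open>At the identity this coordinate is \<open>F 0 x\<close>, which is positive for
    every \<open>x\<close>, so the embedding is defined on the whole space.\<close>
  have "0 < orbit_map x (0, \<one>)" using x F_pos by (simp add: orbit_map_def act_one)
  then show ?thesis
    using x sample_pos_part_iff[OF orbit_map_hull[OF x]] orbit_map_hull[OF x]
    unfolding embed_def model_def by auto
qed

lemma embed_act:
  assumes "h \<in> carrier G" "x \<in> space M"
  shows "embed (\<alpha> h x) = model_act h (embed x)"
  using assms embed_model[of x] orbit_map_hull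
  by (simp add: embed_def model_act_sample translate_orbit_map model_def)

lemma inj_on_embed: "inj_on embed (space M)"
proof (rule inj_onI)
  fix x y assume xy: "x \<in> space M" "y \<in> space M" "embed x = embed y"
  then have "sample (orbit_map x) = sample (orbit_map y)" by (simp add: embed_def)
  then have "orbit_map x = orbit_map y"
    using inj_onD[OF inj_on_sample _ orbit_map_hull orbit_map_hull] xy(1,2) by simp
  then have "F n x = F n y" for n
  proof -
    assume "orbit_map x = orbit_map y"
    then have "orbit_map x (n, \<one>) = orbit_map y (n, \<one>)" by simp
    then show ?thesis using xy by (simp add: orbit_map_def act_one)
  qed
  then show "x = y" by (rule F_separates[OF xy(1,2)])
qed

lemma embed_eq: "embed x (prod_encode (i, j)) = F i (\<alpha> (D j) x)"
  using D_carrier by (simp add: embed_def orbit_map_def)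

lemma embed_measurable_borel: "embed \<in> M \<rightarrow>\<^sub>M borel"
proof (rule measurable_coordinatewise_then_product)
  fix n
  have "(\<lambda>x. embed x n) = (\<lambda>x. F (fst (prod_decode n)) (\<alpha> (D (snd (prod_decode n))) x))"
    using embed_eq[of _ "fst (prod_decode n)" "snd (prod_decode n)"] by simp
  then show "(\<lambda>x. embed x n) \<in> borel_measurable M"
    using measurable_compose[OF measurable_act[OF D_carrier] F_measurable] by simp
qed

lemma embed_measurable: "embed \<in> M \<rightarrow>\<^sub>M borel_of (top_of_set model)"
proof -
  have "embed \<in> M \<rightarrow>\<^sub>M restrict_space borel model"
    using embed_measurable_borel embed_model by (intro measurable_restrict_space2) auto
  then show ?thesis
    by (subst measurable_cong_sets[OF refl sets_borel_of_subspace[OF model_borel]])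
qed

lemma sets_model_measure: "sets model_measure = sets (borel_of (top_of_set model))"
  by (simp add: model_measure_def)

lemma space_model_measure: "space model_measure = model"
  by (simp add: model_measure_def)

lemma embed_measurable_model: "embed \<in> M \<rightarrow>\<^sub>M model_measure"
  using embed_measurable by (subst measurable_cong_sets[OF refl sets_model_measure])

lemma emeasure_model_measure:
  "A \<in> sets model_measure \<Longrightarrow> emeasure model_measure A = emeasure M (embed -` A \<inter> space M)"
  unfolding model_measure_def using embed_measurable by (simp add: emeasure_distr)

lemma measure_preserving_model: "measure_preserving_action G T model_measure model_act"
  unfolding measure_preserving_action_def
proof (intro conjI ballI)
  interpret N: group_action G model model_act by (rule group_action_model)
  show "group_action G (space model_measure) model_act"
    by (simp add: space_model_measure group_action_model)
  have cont: "continuous_map (prod_topology T (top_of_set model)) (top_of_set model) (\<lambda>(g, y). model_act g y)"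
    using continuous_action_model by (simp add: continuous_action_def)
  have "(\<lambda>(g, y). model_act g y) \<in> borel_of T \<Otimes>\<^sub>M borel_of (top_of_set model) \<rightarrow>\<^sub>M borel_of (top_of_set model)"
    using polish_imp_second_countable[OF polish] second_countable_model cont
    by (rule continuous_map_prod_measurable)
  then show "(\<lambda>(g, y). model_act g y) \<in> borel_of T \<Otimes>\<^sub>M model_measure \<rightarrow>\<^sub>M model_measure"
    by (subst measurable_cong_sets[OF sets_pair_measure_cong[OF refl sets_model_measure] sets_model_measure])
  fix g assume g: "g \<in> carrier G"
  have "continuous_map (top_of_set model) (top_of_set model) (model_act g)"
  proof -
    have "continuous_map (top_of_set model) (prod_topology T (top_of_set model)) (\<lambda>y. (g, y))"
      using g by (intro continuous_map_pairedI) auto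
    from continuous_map_compose[OF this cont] show ?thesis by (simp add: o_def)
  qed
  from continuous_map_measurable[OF this]
  have meas: "model_act g \<in> model_measure \<rightarrow>\<^sub>M model_measure"
    by (subst measurable_cong_sets[OF sets_model_measure sets_model_measure])
  show "measure_preserving_bijection model_measure (model_act g)"
    unfolding measure_preserving_bijection_def
  proof (intro conjI ballI)
    show "bij_betw (model_act g) (space model_measure) (space model_measure)"
      using N.bij_prop0[OF g] by (simp add: Bij_def space_model_measure)
    fix A assume A: "A \<in> sets model_measure"
    have A': "model_act g -` A \<inter> space model_measure \<in> sets model_measure"
      using meas A by (rule measurable_sets)
    \<comment> \<open>Equivariance turns the preimage under \<open>model_act g\<close> into one
      under \<open>\<alpha> g\<close>, and invariance of \<open>M\<close> then gives invariance of
      the pushforward.\<close>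
    have "embed -` (model_act g -` A \<inter> space model_measure) \<inter> space M
        = \<alpha> g -` (embed -` A \<inter> space M) \<inter> space M"
      using g by (auto simp: embed_act space_model_measure embed_model)
    then have "emeasure model_measure (model_act g -` A \<inter> space model_measure)
        = emeasure M (\<alpha> g -` (embed -` A \<inter> space M) \<inter> space M)"
      using emeasure_model_measure[OF A'] by simp
    also have "\<dots> = emeasure M (embed -` A \<inter> space M)"
    proof -
      have "\<forall>A\<in>sets M. emeasure M (\<alpha> g -` A \<inter> space M) = emeasure M A"
        using action g by (simp add: measure_preserving_action_def measure_preserving_bijection_def)
      then show ?thesis using measurable_sets[OF embed_measurable_model A] by (rule bspec)
    qed
    finally show "emeasure model_measure (model_act g -` A \<inter> space model_measure) = emeasure model_measure A"
      using emeasure_model_measure[OF A] by simp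
  qed (rule meas)
qed

lemma radon_model:
  "radon_measure (top_of_set model) model_measure" "sigma_finite_measure model_measure"
proof -
  \<comment> \<open>The index \<open>n\<close> encodes a sample point \<open>j\<close> and a level
    \<open>1 / Suc l\<close>. These sets cover the model because some sampled coordinate of index 0
    is positive, hence above such a level.\<close>
  define V where "V n = {y :: nat \<Rightarrow> real. 1 / Suc (snd (prod_decode n)) < y (prod_encode (0, fst (prod_decode n)))}" for n
  have V: "open (V n)" for n
    unfolding V_def by (intro open_Collect_less continuous_on_const continuous_on_coordinate)
  have cover: "model \<subseteq> (\<Union>n. V n)"
  proof
    fix y assume "y \<in> model"
    then obtain j where j: "0 < y (prod_encode (0, j))" by (auto simp: model_def pos_part_def)
    obtain l where "1 / Suc l < y (prod_encode (0, j))" using nat_approx_posE[OF j] .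
    then have "y \<in> V (prod_encode (j, l))" by (simp add: V_def)
    then show "y \<in> (\<Union>n. V n)" by blast
  qed
  have fin: "emeasure model_measure (V n \<inter> model) < \<infinity>" for n
  proof -
    define c where "c = 1 / real (Suc (snd (prod_decode n)))"
    define h where "h = D (fst (prod_decode n))"
    have c: "0 < c" by (simp add: c_def)
    have h: "h \<in> carrier G" using D_carrier by (simp add: h_def)
    have Vm: "V n \<inter> model \<in> sets model_measure"
      using V[of n] openin_borel_of by (metis sets_model_measure Int_commute openin_open_Int)
    have meas: "(\<lambda>x. ennreal (F 0 (\<alpha> h x))) \<in> borel_measurable M"
      using measurable_compose[OF measurable_act[OF h] F_measurable[of 0]] by simp
    have S: "embed -` (V n \<inter> model) \<inter> space M \<in> sets M"
      using embed_measurable_model Vm by (rule measurable_sets)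
    \<comment> \<open>Markov's inequality for \<open>F 0\<close> composed with
      \<open>\<alpha> h\<close>, whose integral equals that of \<open>F 0\<close> because
      \<open>\<alpha> h\<close> preserves \<open>M\<close>.\<close>
    have "ennreal c * emeasure M (embed -` (V n \<inter> model) \<inter> space M)
        = (\<integral>\<^sup>+x. ennreal c * indicator (embed -` (V n \<inter> model) \<inter> space M) x \<partial>M)"
      using S by (simp add: nn_integral_cmult_indicator)
    also have "\<dots> \<le> (\<integral>\<^sup>+x. ennreal (F 0 (\<alpha> h x)) \<partial>M)"
    proof (rule nn_integral_mono)
      fix x assume "x \<in> space M"
      show "ennreal c * indicator (embed -` (V n \<inter> model) \<inter> space M) x \<le> ennreal (F 0 (\<alpha> h x))"
        by (auto simp: indicator_def V_def c_def h_def embed_eq intro!: ennreal_leI)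
    qed
    also have "\<dots> = (\<integral>\<^sup>+x. ennreal (F 0 x) \<partial>distr M M (\<alpha> h))"
      using F_measurable[of 0] by (intro nn_integral_distr[symmetric] measurable_act[OF h]) auto
    also have "\<dots> < \<infinity>" using F_integrable by (simp add: distr_act[OF h])
    finally have "emeasure M (embed -` (V n \<inter> model) \<inter> space M) < \<infinity>"
      using c by (auto simp: ennreal_mult_less_top)
    then show ?thesis by (simp add: emeasure_model_measure[OF Vm])
  qed
  show "radon_measure (top_of_set model) model_measure" "sigma_finite_measure model_measure"
    using locally_finite_radon[OF model_borel sets_model_measure V cover fin] by auto
qed

text \<open>Injectivity of the embedding carries over both uncountability and the absence of atoms;
  sigma-finiteness comes from the cover used for the Radon property.\<close>

lemma standard_model:
  assumes M: "standard_sigma_finite_space M"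
  shows "standard_sigma_finite_space model_measure"
  unfolding standard_sigma_finite_space_def
proof (intro conjI)
  have "uncountable model"
  proof
    assume "countable model"
    moreover have "embed ` space M \<subseteq> model" using embed_model by auto
    ultimately have "countable (space M)"
      using inj_on_embed countable_image_inj_on countable_subset by metis
    then show False using M by (simp add: standard_sigma_finite_space_def standard_borel_space_def)
  qed
  then show std: "standard_borel_space model_measure"
    unfolding standard_borel_space_def using polish_model sets_model_measure
    by (auto simp: space_model_measure)
  show "sigma_finite_measure model_measure" by (rule radon_model(2))
  have "embed -` space model_measure \<inter> space M = space M"
    using embed_model by (auto simp: space_model_measure)
  then show "emeasure model_measure (space model_measure) \<noteq> 0"
    using emeasure_model_measure[OF sets.top] M by (simp add: standard_sigma_finite_space_def)
  show "atomless model_measure"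
    using M std embed_measurable_model inj_on_embed emeasure_model_measure
    by (intro atomless_injective_image[of M model_measure embed]) (auto simp: standard_sigma_finite_space_def)
qed

lemma spatially_isomorphic_model: "spatially_isomorphic G M \<alpha> model_measure model_act"
  unfolding spatially_isomorphic_def
proof (intro exI[of _ "space M"] exI[of _ embed] conjI ballI)
  have R: "restrict_space M (space M) = M"
    by (rule measure_eqI)
      (auto simp: sets_restrict_space_iff emeasure_restrict_space intro: sets.sets_into_space[THEN subsetD])
  show "embed \<in> restrict_space M (space M) \<rightarrow>\<^sub>M model_measure"
    by (simp add: R embed_measurable_model)
  have "distr M model_measure embed = model_measure"
    unfolding model_measure_def by (intro distr_cong) auto
  then show "distr (restrict_space M (space M)) model_measure embed = model_measure"
    by (simp add: R)
qed (use inj_on_embed embed_act act.surj_prop in auto)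

end

theorem theorem1:
  fixes M :: "'a measure" and G :: "('g, 'm) monoid_scheme" and TG :: "'g topology"
    and \<alpha> :: "'g \<Rightarrow> 'a \<Rightarrow> 'a"
  assumes "standard_sigma_finite_space M"
    and "polish_group G TG" and "locally_compact_space TG"
    and "measure_preserving_action G TG M \<alpha>"
  shows "\<exists>(TY :: (nat \<Rightarrow> real) topology) (N :: (nat \<Rightarrow> real) measure) \<beta>.
           polish_topology TY \<and> locally_compact_space TY \<and>
           radon_measure TY N \<and> standard_sigma_finite_space N \<and>
           measure_preserving_action G TG N \<beta> \<and> continuous_action TG TY \<beta> \<and>
           spatially_isomorphic G M \<alpha> N \<beta>"
proof -
  have polish: "polish_topology TG" and tg: "topological_group G TG"
    using assms(2) by (simp_all add: polish_group_def)
  have haus: "Hausdorff_space TG"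
    using polish by (simp add: polish_topology_def completely_metrizable_imp_metrizable_space
        metrizable_imp_Hausdorff_space)
  interpret locally_compact_group G TG
    using tg haus assms(3) by unfold_locales
  obtain m where m: "sets m = sets (borel_of TG)"
    "\<forall>h\<in>carrier G. \<forall>A\<in>sets m. emeasure m (right_translate h A) = emeasure m A"
    "\<forall>K. compactin TG K \<longrightarrow> emeasure m K < \<infinity>"
    "\<forall>U. openin TG U \<longrightarrow> U \<noteq> {} \<longrightarrow> emeasure m U > 0"
    by (rule ex_right_Haar_measure)
  interpret Haar_action G TG m M \<alpha>
  proof (intro Haar_action.intro Haar_action_axioms.intro)
    show "locally_compact_group G TG" by unfold_locales
    show "polish_topology TG" by (rule polish)
    show "sets m = sets (borel_of TG)" by (rule m(1))
    show "emeasure m (right_translate h A) = emeasure m A" if "h \<in> carrier G" "A \<in> sets m" for h A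
      using m(2) that by simp
    show "emeasure m K < \<infinity>" if "compactin TG K" for K using m(3) that by simp
    show "emeasure m U > 0" if "openin TG U" "U \<noteq> {}" for U
      using m(4) that by simp
    show "measure_preserving_action G TG M \<alpha>" by (rule assms(4))
    show "sigma_finite_measure M" using assms(1) by (simp add: standard_sigma_finite_space_def)
  qed
  have "standard_borel_space M" using assms(1) by (simp add: standard_sigma_finite_space_def)
  from ex_equicontinuous_family[OF this] obtain F :: "nat \<Rightarrow> 'a \<Rightarrow> real" where F:
    "\<forall>n. F n \<in> borel_measurable M"
    "\<forall>n. \<exists>B. \<forall>x\<in>space M. \<bar>F n x\<bar> \<le> B"
    "\<forall>n. \<forall>h0\<in>carrier G. \<forall>e>0. \<exists>W. openin TG W \<and> h0 \<in> W \<and>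
        (\<forall>h\<in>W. \<forall>x\<in>space M. \<bar>F n (\<alpha> h x) - F n (\<alpha> h0 x)\<bar> \<le> e)"
    "\<forall>x\<in>space M. \<forall>y\<in>space M. (\<forall>n. F n x = F n y) \<longrightarrow> x = y"
    "\<forall>x\<in>space M. 0 < F 0 x" "(\<integral>\<^sup>+x. ennreal (F 0 x) \<partial>M) < \<infinity>"
    by (elim exE conjE)
  from choice[OF F(2)] obtain B where B: "\<forall>n. \<forall>x\<in>space M. \<bar>F n x\<bar> \<le> B n"
    by (elim exE)
  have "topspace TG \<noteq> {}" by auto
  then obtain D :: "nat \<Rightarrow> 'g" where D: "range D \<subseteq> topspace TG" "TG closure_of (range D) = topspace TG"
    by (rule polish_dense_sequence[OF polish])
  interpret equicontinuous_family G TG m M \<alpha> F B D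
  proof
    show "F n \<in> borel_measurable M" for n using F(1) by (rule spec)
    show "\<bar>F n x\<bar> \<le> B n" if "x \<in> space M" for n x using B that by simp
    show "\<exists>W. openin TG W \<and> h0 \<in> W \<and> (\<forall>h\<in>W. \<forall>x\<in>space M. \<bar>F n (\<alpha> h x) - F n (\<alpha> h0 x)\<bar> \<le> e)"
      if "h0 \<in> carrier G" "0 < e" for n h0 e
      using F(3) that by simp
    show "x = y" if "x \<in> space M" "y \<in> space M" "\<And>n. F n x = F n y" for x y
      using F(4) that by simp
    show "0 < F 0 x" if "x \<in> space M" for x using F(5) that by simp
    show "(\<integral>\<^sup>+x. ennreal (F 0 x) \<partial>M) < \<infinity>" by (rule F(6))
    show "D j \<in> carrier G" for j using D(1) by auto
    show "TG closure_of (range D) = carrier G" using D(2) by simp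
  qed
  show ?thesis
    by (intro exI[of _ "top_of_set model"] exI[of _ model_measure] exI[of _ model_act] conjI
        polish_model locally_compact_model radon_model(1) standard_model[OF assms(1)]
        measure_preserving_model continuous_action_model spatially_isomorphic_model)
qed

end
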